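(* Let $f$ be a meromorphic function on $\mathbb{C}$ of finite order $\kappa$ which is of zeta-type, i.e. there are an increasing sequence of real numbers $1<q_1<q_2<\cdots$, complex numbers $c_n$ and a real number $\sigma$ such that $$\log f(z)=\sum_{n=1}^{\infty}\frac{c_n}{q_n^{z}},$$ the series converging absolutely and uniformly in every half-plane $\mathrm{Re}(z)\geq\sigma+\epsilon$, $\epsilon>0$. Let $N_f$ and $P_f$ be the sets of zeros and poles of $f$, let $$X_f=\{z\in\mathbb{C} : z-\rho\notin(-\infty,0]\ \text{for all } \rho\in N_f\cup P_f\},$$ and for $z\in X_f$ and $\mathrm{Re}(s)>\kappa$ define the superzeta function $$\mathcal{Z}_f(s,z)=\sum_{\rho\in N_f}\mathrm{ord}(\rho)(z-\rho)^{-s}-\sum_{\rho\in P_f}\mathrm{ord}(\rho)(z-\rho)^{-s},$$ where $\mathrm{ord}(\rho)$ is the order of the zero or pole $\rho$ and $(z-\rho)^{-s}$ is defined with the principal branch of the logarithm ($\arg\in(-\pi,\pi)$). Fix $z\in X_f$. Then $\mathcal{Z}_f(s,z)$ has a holomorphic continuation to all $s\in\mathbb{C}$, given through the equation $$\mathcal{Z}_f(s,z)=\frac{\sin\pi s}{\pi}\int_0^{\infty}\frac{f'}{f}(z+y)\,y^{-s}\,dy$$ (with the integral understood via its meromorphic continuation in $s$ where it does not converge).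
   Context: Both series defining $\mathcal{Z}_f(s,z)$ converge absolutely for $\mathrm{Re}(s)>\kappa$. *)

theory Defs
  imports "HOL-Complex_Analysis.Complex_Analysis"
begin

text \<open>
  Meromorphic functions are total functions with \<open>f meromorphic_on UNIV\<close>, so on a discrete closed
  set the value of \<open>f\<close> may differ from the value of the meromorphic function it represents.
  Zeros, poles and orders are therefore the punctured-neighbourhood notions
  \<^const>\<open>isolated_zero\<close>, \<^const>\<open>is_pole\<close> and \<^const>\<open>zorder\<close>, and the integrals
  below do not see null sets.
\<close>

definition zeros_of :: "(complex \<Rightarrow> complex) \<Rightarrow> complex set" where
  "zeros_of f = {\<rho>. isolated_zero f \<rho>}"

definition poles_of :: "(complex \<Rightarrow> complex) \<Rightarrow> complex set" where
  "poles_of f = {\<rho>. is_pole f \<rho>}"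

text \<open>\<^const>\<open>zorder\<close> is negative at a pole; the order of a pole is a positive integer.\<close>

definition ord_at :: "(complex \<Rightarrow> complex) \<Rightarrow> complex \<Rightarrow> nat" where
  "ord_at f \<rho> = nat \<bar>zorder f \<rho>\<bar>"


text \<open>
  The order of a meromorphic function is the order of growth of its Nevanlinna characteristic
  \<open>T(r,f) = m(r,f) + N(r,f)\<close>. Since \<open>ln 0 = 0\<close>, \<open>log_plus\<close> vanishes at \<open>0\<close>, as it should.
\<close>

definition log_plus :: "real \<Rightarrow> real" where
  "log_plus x = max 0 (ln x)"

definition proximity :: "(complex \<Rightarrow> complex) \<Rightarrow> real \<Rightarrow> real" where
  "proximity f r = 1 / (2 * pi) * (LBINT t:{0..2*pi}. log_plus (norm (f (of_real r * cis t))))"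

definition pole_count :: "(complex \<Rightarrow> complex) \<Rightarrow> real \<Rightarrow> nat" where
  "pole_count f t = (\<Sum>\<rho>\<in>poles_of f \<inter> cball 0 t. ord_at f \<rho>)"

definition integrated_pole_count :: "(complex \<Rightarrow> complex) \<Rightarrow> real \<Rightarrow> real" where
  "integrated_pole_count f r =
     (LBINT t:{0<..r}. (real (pole_count f t) - real (pole_count f 0)) / t)
       + real (pole_count f 0) * ln r"

definition nevanlinna_char :: "(complex \<Rightarrow> complex) \<Rightarrow> real \<Rightarrow> real" where
  "nevanlinna_char f r = proximity f r + integrated_pole_count f r"

definition meromorphic_order :: "(complex \<Rightarrow> complex) \<Rightarrow> ereal" where
  "meromorphic_order f = Limsup at_top (\<lambda>r. ereal (log_plus (nevanlinna_char f r) / ln r))"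


text \<open>
  The equation \<open>log f = \<Sum> c\<^sub>n q\<^sub>n\<^sup>-\<^sup>z\<close> says that the series is a branch of the logarithm of \<open>f\<close>,
  i.e. that its exponential is \<open>f\<close>. The sequences are indexed from \<open>0\<close>.
\<close>

definition zeta_type :: "(complex \<Rightarrow> complex) \<Rightarrow> bool" where
  "zeta_type f \<longleftrightarrow>
     (\<exists>(q :: nat \<Rightarrow> real) (c :: nat \<Rightarrow> complex) (\<sigma> :: real).
        1 < q 0 \<and> strict_mono q \<and>
        (\<forall>\<epsilon>>0.
           (\<forall>z. Re z \<ge> \<sigma> + \<epsilon> \<longrightarrow>
              summable (\<lambda>n. norm (c n / of_real (q n) powr z)) \<and>
              f z = exp (\<Sum>n. c n / of_real (q n) powr z)) \<and>
           uniformly_convergent_on {z. Re z \<ge> \<sigma> + \<epsilon>}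
             (\<lambda>N z. \<Sum>n<N. c n / of_real (q n) powr z)))"


definition superzeta_domain :: "(complex \<Rightarrow> complex) \<Rightarrow> complex set" where
  "superzeta_domain f = {z. \<forall>\<rho>\<in>zeros_of f \<union> poles_of f. z - \<rho> \<notin> \<real>\<^sub>\<le>\<^sub>0}"

definition superzeta :: "(complex \<Rightarrow> complex) \<Rightarrow> complex \<Rightarrow> complex \<Rightarrow> complex" where
  "superzeta f s z =
     (\<Sum>\<^sub>\<infinity>\<rho>\<in>zeros_of f. of_nat (ord_at f \<rho>) * (z - \<rho>) powr (- s))
     - (\<Sum>\<^sub>\<infinity>\<rho>\<in>poles_of f. of_nat (ord_at f \<rho>) * (z - \<rho>) powr (- s))"

definition superzeta_integrand ::
    "(complex \<Rightarrow> complex) \<Rightarrow> complex \<Rightarrow> complex \<Rightarrow> real \<Rightarrow> complex" where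
  "superzeta_integrand f z s y =
     deriv f (z + of_real y) / f (z + of_real y) * of_real y powr (- s)"

end

theory Submission
  imports Defs
begin

text \<open>
  Let \<open>L = f'/f\<close>, let \<open>\<rho>\<close> range over the zeros and poles of \<open>f\<close> and let \<open>k\<^sub>\<rho>\<close> be the order of \<open>f\<close>
  at \<open>\<rho>\<close>. On a disc of radius \<open>R\<close> write \<open>f = exp h \<cdot> \<Prod> B\<^sub>\<rho>\<close> with Blaschke factors \<open>B\<^sub>\<rho>\<close>. Poisson's
  formula for \<open>h\<close> bounds the number of zeros and the mass of \<open>log |f|\<close> on the circle by the Nevanlinna
  characteristic, so that, letting \<open>R\<close> tend to infinity in the \<open>(n + 1)\<close>-st derivative of \<open>log f\<close>,
  \<open>L\<^sup>(\<^sup>n\<^sup>)(w) = (-1)\<^sup>n n! \<Sum> k\<^sub>\<rho> (w - \<rho>)\<^sup>-\<^sup>n\<^sup>-\<^sup>1\<close> for \<open>n + 1 > \<kappa>\<close>. Integrating this against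
  \<open>y\<^sup>n\<^sup>-\<^sup>s\<close> along \<open>w = z + y\<close> and using the Beta integral expresses the superzeta function for
  \<open>\<kappa> < Re s < n + 1\<close> as \<open>(-1)\<^sup>n / (\<Gamma>(n + 1 - s) \<Gamma>(s)) \<integral> L\<^sup>(\<^sup>n\<^sup>)(z + y) y\<^sup>n\<^sup>-\<^sup>s dy\<close>. As \<open>f\<close> is of zeta
  type, \<open>L\<close> decays exponentially along the ray, so this expression is holomorphic for
  \<open>Re s < n + 1\<close>. By partial integration it does not depend on \<open>n\<close>, and for \<open>n = 0\<close> it is the
  integral in the theorem.
\<close>

text \<open>The obstacle is that \<open>L\<close> itself need not be the sum of its polar parts: for
  \<kappa> \<ge> 1 the sum over \<rho> may diverge, and an entire part can remain. Differentiating n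
  times with n + 1 > \<kappa> cures both, since the contributions of \<open>h\<close> and of the
  reflected poles of the Blaschke factors are O(R^(\<alpha> - n - 1)) for \<kappa> < \<alpha> < n +
  1. The price is that the series meets the integral of a derivative of \<open>L\<close>, in the
  strip \<kappa> < Re s < n + 1. The integral of \<open>L\<close> itself converges at 0 in general
  only for Re s < 1, a half-plane which may be disjoint from that of the series. The characteristic
  controls only the poles and the positive part of log |f|. The zeros and the negative part follow
  by comparison with one point where \<open>F\<close> does not vanish. The limit of the derivatives
  is taken pointwise along radii that avoid exceptional points; the majorant that allows it to be
  integrated comes separately, from the count of zeros and poles.\<close>

section \<open>Parameter integrals and a Mellin integral\<close>

text \<open>Difference quotients converge by dominated convergence. Only \<open>g\<close> itself
  comes with a majorant; Cauchy's inequality on discs of radius r/2 turns it into the bound 2 G / r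
  for the derivative in s, hence for the difference quotients (\<open>quot\<close>), at points
  within r/2 of \<open>s0\<close>.\<close>

lemma holomorphic_on_integral_param:
  fixes g :: "complex \<Rightarrow> 'a \<Rightarrow> complex"
  assumes "open U"
    and meas: "\<And>s. s \<in> U \<Longrightarrow> g s \<in> borel_measurable M"
    and holo: "\<And>y. y \<in> space M \<Longrightarrow> (\<lambda>s. g s y) holomorphic_on U"
    and dom: "\<And>s0. s0 \<in> U \<Longrightarrow> \<exists>r>0. \<exists>G. integrable M G \<and> cball s0 r \<subseteq> U \<and>
                (\<forall>s\<in>cball s0 r. \<forall>y\<in>space M. norm (g s y) \<le> G y)"
  shows "(\<lambda>s. \<integral>y. g s y \<partial>M) holomorphic_on U"
  unfolding holomorphic_on_open[OF \<open>open U\<close>]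
proof
  fix s0 assume "s0 \<in> U"
  from dom[OF this] obtain r G where r: "r > 0" "integrable M G" "cball s0 r \<subseteq> U"
    and G: "\<And>s y. s \<in> cball s0 r \<Longrightarrow> y \<in> space M \<Longrightarrow> norm (g s y) \<le> G y" by metis
  have int: "integrable M (g s)" if "s \<in> cball s0 r" for s
    using that r G by (intro Bochner_Integration.integrable_bound[OF r(2)] meas) (auto intro!: AE_I2 order_trans[OF G])
  have quot: "norm ((g s y - g s0 y) / (s - s0)) \<le> 2 * G y / r"
    if s: "s \<in> ball s0 (r/2)" "s \<noteq> s0" and y: "y \<in> space M" for s y
  proof -
    have "norm (g s y - g s0 y) \<le> (2 * G y / r) * norm (s - s0)"
    proof (rule field_differentiable_bound[of "ball s0 (r/2)" "\<lambda>s. g s y"])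
      fix u assume u: "u \<in> ball s0 (r/2)"
      then have sub: "cball u (r/2) \<subseteq> cball s0 r"
        by (subst cball_subset_cball_iff) (auto simp: dist_commute)
      have "u \<in> U" using u r by (auto simp: dist_norm)
      then show "((\<lambda>s. g s y) has_field_derivative deriv (\<lambda>s. g s y) u) (at u within ball s0 (r/2))"
        using holomorphic_derivI[OF holo[OF y] \<open>open U\<close>] by (blast intro: DERIV_subset)
      have "norm ((deriv ^^ 1) (\<lambda>s. g s y) u) \<le> fact 1 * G y / (r/2) ^ 1"
      proof (rule Cauchy_inequality)
        show "(\<lambda>s. g s y) holomorphic_on ball u (r/2)"
          using sub r by (intro holomorphic_on_subset[OF holo[OF y]]) (auto simp: subset_iff)
        show "continuous_on (cball u (r/2)) (\<lambda>s. g s y)"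
          using sub r by (intro holomorphic_on_imp_continuous_on holomorphic_on_subset[OF holo[OF y]]) auto
        fix x assume "norm (u - x) = r/2"
        then have "x \<in> cball s0 r" using sub by (auto simp: dist_norm)
        then show "norm (g x y) \<le> G y" using G y by auto
      qed (use r in auto)
      then show "norm (deriv (\<lambda>s. g s y) u) \<le> 2 * G y / r" by (simp add: mult.commute)
    qed (use s r in auto)
    then show ?thesis using s by (simp add: norm_divide field_simps)
  qed
  have "((\<lambda>s. ((\<integral>y. g s y \<partial>M) - (\<integral>y. g s0 y \<partial>M)) / (s - s0)) \<longlongrightarrow>
           (\<integral>y. deriv (\<lambda>s. g s y) s0 \<partial>M)) (at s0)"
    unfolding tendsto_at_iff_sequentially
  proof (intro allI impI)
    fix X :: "nat \<Rightarrow> complex"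
    assume X: "\<forall>i. X i \<in> UNIV - {s0}" "X \<longlonglongrightarrow> s0"
    from X(2) have "eventually (\<lambda>n. X n \<in> ball s0 (r/2)) sequentially"
      using r by (intro topological_tendstoD) auto
    then obtain N where N: "\<And>n. n \<ge> N \<Longrightarrow> X n \<in> ball s0 (r/2)"
      by (auto simp: eventually_sequentially)
    define Y where "Y = (\<lambda>n. X (n + N))"
    have Y: "Y n \<in> ball s0 (r/2)" "Y n \<noteq> s0" for n using N X(1) by (auto simp: Y_def)
    have YU: "Y n \<in> U" "Y n \<in> cball s0 r" for n using Y(1)[of n] r by auto
    have Ylim: "Y \<longlonglongrightarrow> s0" unfolding Y_def by (rule LIMSEQ_ignore_initial_segment[OF X(2)])
    have lim: "(\<lambda>n. (g (Y n) y - g s0 y) / (Y n - s0)) \<longlonglongrightarrow> deriv (\<lambda>s. g s y) s0" if "y \<in> space M" for y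
    proof -
      have "((\<lambda>s. (g s y - g s0 y) / (s - s0)) \<longlongrightarrow> deriv (\<lambda>s. g s y) s0) (at s0)"
        using holomorphic_derivI[OF holo[OF that] \<open>open U\<close> \<open>s0 \<in> U\<close>] by (simp add: has_field_derivative_iff)
      then show ?thesis unfolding tendsto_at_iff_sequentially using Y(2) Ylim by (auto simp: o_def)
    qed
    have m: "(\<lambda>y. (g (Y n) y - g s0 y) / (Y n - s0)) \<in> borel_measurable M" for n
      using meas[OF YU(1)] meas[OF \<open>s0 \<in> U\<close>] by measurable
    have "(\<lambda>n. \<integral>y. (g (Y n) y - g s0 y) / (Y n - s0) \<partial>M) \<longlonglongrightarrow> (\<integral>y. deriv (\<lambda>s. g s y) s0 \<partial>M)"
    proof (rule integral_dominated_convergence[where w = "\<lambda>y. 2 * G y / r"])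
      show "(\<lambda>y. deriv (\<lambda>s. g s y) s0) \<in> borel_measurable M"
        by (rule borel_measurable_LIMSEQ_metric[OF m]) (rule lim)
      show "integrable M (\<lambda>y. 2 * G y / r)" using r(2) by simp
    qed (use m lim quot Y in auto)
    also have "(\<lambda>n. \<integral>y. (g (Y n) y - g s0 y) / (Y n - s0) \<partial>M) =
        (\<lambda>n. ((\<integral>y. g (Y n) y \<partial>M) - (\<integral>y. g s0 y \<partial>M)) / (Y n - s0))"
      using int YU(2) r by (simp add: Bochner_Integration.integral_diff)
    finally have "(\<lambda>n. ((\<lambda>s. ((\<integral>y. g s y \<partial>M) - (\<integral>y. g s0 y \<partial>M)) / (s - s0)) \<circ> X) (n + N)) \<longlonglongrightarrow> (\<integral>y. deriv (\<lambda>s. g s y) s0 \<partial>M)"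
      by (simp add: Y_def o_def)
    then show "((\<lambda>s. ((\<integral>y. g s y \<partial>M) - (\<integral>y. g s0 y \<partial>M)) / (s - s0)) \<circ> X) \<longlonglongrightarrow> (\<integral>y. deriv (\<lambda>s. g s y) s0 \<partial>M)"
      by (rule LIMSEQ_offset)
  qed
  then show "\<exists>f'. ((\<lambda>s. \<integral>y. g s y \<partial>M) has_field_derivative f') (at s0)"
    by (auto simp: has_field_derivative_iff)
qed

text \<open>A majorant for integrals over \<open>{0<..}\<close>: the behaviour at 0 and at infinity
  is governed by independent exponents, and a > -1 with b < -1 suffices for integrability.\<close>

definition pow_bound :: "real \<Rightarrow> real \<Rightarrow> real \<Rightarrow> real" where
  "pow_bound a b y = (if y < 1 then y powr a else y powr b)"

lemma pow_bound_nonneg: "pow_bound a b y \<ge> 0"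
  by (simp add: pow_bound_def)

lemma set_integrable_pow_bound:
  assumes "a > -1" "b < -1"
  shows "set_integrable lborel {0<..} (pow_bound a b)"
proof -
  have "(\<lambda>t. t powr a) integrable_on {0..1}"
    using assms by (intro integrable_on_powr_from_0) auto
  hence "(\<lambda>t. t powr a) absolutely_integrable_on {0..1}"
    by (subst absolutely_integrable_on_iff_nonneg) auto
  then have 1: "set_integrable lborel {0..1} (\<lambda>t. t powr a)"
    unfolding set_integrable_def by (subst (asm) integrable_completion) auto
  have "(\<lambda>t. t powr b) integrable_on {1..}"
    using has_integral_powr_to_inf[of b 1] assms by (auto simp: integrable_on_def)
  hence "(\<lambda>t. t powr b) absolutely_integrable_on {1..}"
    by (subst absolutely_integrable_on_iff_nonneg) auto
  then have 2: "set_integrable lborel {1..} (\<lambda>t. t powr b)"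
    unfolding set_integrable_def by (subst (asm) integrable_completion) auto
  have "set_integrable lborel {0<..<1} (pow_bound a b)"
    using set_integrable_subset[OF 1, of "{0<..<1}", OF _ greaterThanLessThan_subseteq_atLeastAtMost_iff[THEN iffD2]]
    by (subst set_integrable_cong[OF refl refl, of _ _ "\<lambda>t. t powr a"]) (auto simp: pow_bound_def)
  moreover have "set_integrable lborel {1..} (pow_bound a b)"
    using 2 by (subst set_integrable_cong[OF refl refl, of _ _ "\<lambda>t. t powr b"]) (auto simp: pow_bound_def)
  ultimately have "set_integrable lborel ({0<..<1} \<union> {1..}) (pow_bound a b)"
    by (intro set_integrable_Un) auto
  also have "{0<..<1} \<union> {1..} = {0::real<..}" by auto
  finally show ?thesis .
qed

section \<open>Gamma integrals and the Mellin integral for real parameters\<close>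

lemma nn_integral_Gamma_scaled:
  fixes p c :: real
  assumes "p > 0" "c > 0"
  shows "(\<integral>\<^sup>+t. ennreal (indicator {0..} t * t powr (p - 1) * exp (- (c * t))) \<partial>lborel) = ennreal (Gamma p * c powr (-p))"
proof -
  have "ennreal (Gamma p) = (\<integral>\<^sup>+t. ennreal (indicator {0..} t * t powr (p - 1) / exp t) \<partial>lborel)"
    by (rule Gamma_conv_nn_integral_real) fact
  also have "\<dots> = ennreal \<bar>c\<bar> * (\<integral>\<^sup>+t. ennreal (indicator {0..} (0 + c * t) * (0 + c * t) powr (p - 1) / exp (0 + c * t)) \<partial>lborel)"
    by (rule nn_integral_real_affine) (use assms in auto)
  also have "\<dots> = ennreal (c powr p) * (\<integral>\<^sup>+t. ennreal (indicator {0..} t * t powr (p - 1) * exp (- (c * t))) \<partial>lborel)"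
  proof -
    have "ennreal (indicator {0..} (0 + c * t) * (0 + c * t) powr (p - 1) / exp (0 + c * t)) =
        ennreal (c powr (p - 1)) * ennreal (indicator {0..} t * t powr (p - 1) * exp (- (c * t)))" for t
      using assms by (subst ennreal_mult' [symmetric])
        (auto simp: indicator_def zero_le_mult_iff powr_mult exp_minus field_simps)
    then have "(\<integral>\<^sup>+t. ennreal (indicator {0..} (0 + c * t) * (0 + c * t) powr (p - 1) / exp (0 + c * t)) \<partial>lborel) =
        ennreal (c powr (p - 1)) * (\<integral>\<^sup>+t. ennreal (indicator {0..} t * t powr (p - 1) * exp (- (c * t))) \<partial>lborel)"
      by (simp only: nn_integral_cmult) (subst nn_integral_cmult, auto)
    moreover have "ennreal \<bar>c\<bar> * ennreal (c powr (p - 1)) = ennreal (c powr p)"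
      using assms by (simp add: ennreal_mult' [symmetric] powr_diff)
    ultimately show ?thesis by (simp add: mult.assoc [symmetric])
  qed
  finally have "ennreal (c powr -p) * ennreal (Gamma p) = ennreal (c powr -p) * ennreal (c powr p) * (\<integral>\<^sup>+t. ennreal (indicator {0..} t * t powr (p - 1) * exp (- (c * t))) \<partial>lborel)"
    by (simp add: mult.assoc)
  then show ?thesis
    using assms by (simp add: ennreal_mult' [symmetric] powr_minus mult.commute)
qed

text \<open>Tonelli's theorem, after writing \<open>n! / (a + y)\<^sup>n\<^sup>+\<^sup>1\<close> as a Gamma integral.\<close>

lemma nn_integral_Mellin_real:
  fixes a s :: real
  assumes "a > 0" "0 < s" "s < real n + 1"
  shows "(\<integral>\<^sup>+y. ennreal (indicator {0<..} y * (y powr (real n - s) / (a + y) ^ (n + 1))) \<partial>lborel) =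
           ennreal (Gamma (real n + 1 - s) * Gamma s / fact n * a powr (-s))"
proof -
  let ?G = "\<lambda>t y. ennreal (1 / fact n) * ennreal (indicator {0<..} y * y powr (real n - s)) *
        ennreal (indicator {0..} t * t powr real n * exp (- ((a + y) * t)))"
  have 1: "ennreal (indicator {0<..} y * (y powr (real n - s) / (a + y) ^ (n + 1))) =
      (\<integral>\<^sup>+t. ?G t y \<partial>lborel)" for y
  proof (cases "y > 0")
    case True
    have "(\<integral>\<^sup>+t. ennreal (indicator {0..} t * t powr real n * exp (- ((a + y) * t))) \<partial>lborel) =
            ennreal (Gamma (real n + 1) * (a + y) powr (-(real n + 1)))"
      using nn_integral_Gamma_scaled[of "real n + 1" "a + y"] True assms by simp
    also have "(a + y) powr (-(real n + 1)) = 1 / (a + y) ^ (n + 1)"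
      using True assms by (subst powr_minus) (simp add: powr_add powr_realpow inverse_eq_divide)
    also have "Gamma (real n + 1) = fact n" using Gamma_fact[of n, where ?'a = real] by (simp add: add_ac)
    finally show ?thesis
      using True by (subst nn_integral_cmult) (auto simp: ennreal_mult' [symmetric])
  qed simp
  have 2: "(\<integral>\<^sup>+y. ?G t y \<partial>lborel) =
       ennreal (Gamma (real n + 1 - s) / fact n) * ennreal (indicator {0..} t * t powr (s - 1) * exp (- (a * t)))"
    if t: "t \<noteq> 0" for t :: real
  proof (cases "t > 0")
    case True
    have ae: "AE y in lborel. y \<noteq> (0::real)" by (rule AE_lborel_singleton)
    have ex: "exp (- ((a + y) * t)) = exp (- (a * t)) * exp (- (t * y))" for y
      by (simp add: mult_exp_exp algebra_simps)
    have "(\<integral>\<^sup>+y. ?G t y \<partial>lborel) =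
      (\<integral>\<^sup>+y. ennreal (1 / fact n * (t powr real n * exp (- (a * t)))) *
        ennreal (indicator {0..} y * y powr ((real n + 1 - s) - 1) * exp (- (t * y))) \<partial>lborel)"
      unfolding ex using True
      by (intro nn_integral_cong_AE eventually_mono[OF ae])
        (auto simp: ennreal_mult' [symmetric] indicator_def mult_ac)
    also have "\<dots> = ennreal (1 / fact n * (t powr real n * exp (- (a * t)))) * ennreal (Gamma (real n + 1 - s) * t powr (- (real n + 1 - s)))"
      using True assms by (subst nn_integral_cmult) (simp, subst nn_integral_Gamma_scaled, auto)
    also have "\<dots> = ennreal (Gamma (real n + 1 - s) / fact n) * ennreal (indicator {0..} t * t powr (s - 1) * exp (- (a * t)))"
    proof -
      have "t powr (s - 1) = t powr real n * t powr (- (real n + 1 - s))"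
        by (simp add: powr_add [symmetric])
      then show ?thesis
        using True assms by (simp add: ennreal_mult' [symmetric] Gamma_real_pos less_imp_le mult_ac)
    qed
    finally show ?thesis .
  qed (use t in auto)
  have ae: "AE t in lborel. t \<noteq> (0::real)" by (rule AE_lborel_singleton)
  have "(\<integral>\<^sup>+y. ennreal (indicator {0<..} y * (y powr (real n - s) / (a + y) ^ (n + 1))) \<partial>lborel) =
    (\<integral>\<^sup>+y. \<integral>\<^sup>+t. ?G t y \<partial>lborel \<partial>lborel)"
    by (simp only: 1)
  also have "\<dots> = (\<integral>\<^sup>+t. \<integral>\<^sup>+y. ?G t y \<partial>lborel \<partial>lborel)"
    by (rule lborel_pair.Fubini') (simp add: case_prod_unfold, measurable)
  also have "\<dots> = (\<integral>\<^sup>+t. ennreal (Gamma (real n + 1 - s) / fact n) * ennreal (indicator {0..} t * t powr (s - 1) * exp (- (a * t))) \<partial>lborel)"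
    by (intro nn_integral_cong_AE eventually_mono[OF ae] 2)
  also have "\<dots> = ennreal (Gamma (real n + 1 - s) / fact n) * ennreal (Gamma s * a powr (-s))"
    using assms by (subst nn_integral_cmult) (auto simp: nn_integral_Gamma_scaled)
  also have "\<dots> = ennreal (Gamma (real n + 1 - s) * Gamma s / fact n * a powr (-s))"
    using assms by (subst ennreal_mult' [symmetric]) (auto simp: mult_ac Gamma_real_pos less_imp_le)
  finally show ?thesis .
qed


text \<open>
  After scaling, \<open>a + y\<close> lies on the segment from \<open>sgn a\<close> to \<open>1\<close>, whose point nearest to the
  origin is the midpoint.
\<close>

lemma norm_add_nonneg_ge:
  fixes a :: complex
  assumes "a \<noteq> 0" "y \<ge> 0"
  shows "norm (a + of_real y) \<ge> norm (1 + sgn a) / 2 * (norm a + y)"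
proof -
  define r where "r = norm a"
  have r: "r > 0" "a = of_real r * sgn a" using assms by (simp_all add: r_def sgn_eq)
  define u where "u = sgn a"
  have u: "norm u = 1" using assms by (simp add: u_def norm_sgn)
  have "norm (1 + u) * (r + y) \<le> 2 * norm (of_real r * u + of_real y)"
  proof (rule power2_le_imp_le)
    have u2: "(Re u)\<^sup>2 + (Im u)\<^sup>2 = 1" using u by (metis cmod_power2 power_one)
    have Re1: "Re u \<le> 1" using abs_Re_le_cmod[of u] u by simp
    have *: "(norm (1 + u))\<^sup>2 = 2 + 2 * Re u" using u2 unfolding cmod_power2 by (simp add: power2_eq_square algebra_simps)
    have **: "(norm (of_real r * u + of_real y))\<^sup>2 = r\<^sup>2 + y\<^sup>2 + 2 * r * y * Re u"
    proof -
      have "(norm (of_real r * u + of_real y))\<^sup>2 = r\<^sup>2 * ((Re u)\<^sup>2 + (Im u)\<^sup>2) + y\<^sup>2 + 2 * r * y * Re u"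
        unfolding cmod_power2 by (simp add: power2_eq_square algebra_simps)
      then show ?thesis using u2 by simp
    qed
    \<comment> \<open>The defect vanishes for r = y, the case of the midpoint, so the constant is
      sharp.\<close>
    have "4 * (r\<^sup>2 + y\<^sup>2 + 2 * r * y * Re u) - (2 + 2 * Re u) * (r + y)\<^sup>2 = 2 * (1 - Re u) * (r - y)\<^sup>2"
      by (simp add: power2_eq_square algebra_simps)
    also have "\<dots> \<ge> 0" using Re1 by simp
    finally show "(norm (1 + u) * (r + y))\<^sup>2 \<le> (2 * norm (of_real r * u + of_real y))\<^sup>2"
      using * ** by (simp add: power_mult_distrib)
  qed (use r in auto)
  then show ?thesis using r by (simp add: u_def r_def)
qed

lemma one_plus_sgn_pos:
  fixes a :: complex
  assumes "a \<notin> \<real>\<^sub>\<le>\<^sub>0"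
  shows "norm (1 + sgn a) > 0"
proof -
  have "a \<noteq> 0" using assms by auto
  have "1 + sgn a \<noteq> 0"
  proof
    assume "1 + sgn a = 0"
    then have "sgn a = -1" by (simp add: add_eq_0_iff)
    then have "a = of_real (- norm a)"
      using \<open>a \<noteq> 0\<close> by (simp add: sgn_eq divide_eq_eq)
    then have "a \<in> \<real>\<^sub>\<le>\<^sub>0" by (metis complex_nonpos_Reals_iff Im_complex_of_real Re_complex_of_real neg_le_0_iff_le norm_ge_zero)
    with assms show False by simp
  qed
  then show ?thesis by simp
qed

section \<open>The Mellin integral in the slit plane\<close>

abbreviation (input) Mellin_kernel :: "nat \<Rightarrow> complex \<Rightarrow> complex \<Rightarrow> real \<Rightarrow> complex" where
  "Mellin_kernel n s a y \<equiv> of_real y powr (of_nat n - s) / (a + of_real y) ^ (n + 1)"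

text \<open>For 0 \<le> \<gamma> \<le> n + 1 one has (A + y)^(n + 1) \<ge> A^\<gamma> y^(n + 1 -
  \<gamma>), which trades decay in y for decay in A. Taking \<gamma> = \<alpha> for y < 1 and
  \<gamma> = \<beta> for y \<ge> 1 leaves a choice: \<alpha> = n + 1 and \<beta> = 0 serve a single
  base point, exponents close to Re s on either side serve when the bounds are summed over all zeros
  and poles.\<close>

lemma Mellin_integrand_bound:
  fixes a s :: complex
  assumes "norm (a + of_real y) \<ge> c * (A + y)" "c > 0" "A > 0" "y > 0"
    and "\<alpha> \<ge> 0" "\<beta> \<ge> 0" "\<alpha> \<le> real n + 1" "\<beta> \<le> real n + 1" 
  shows "norm (Mellin_kernel n s a y) \<le>
     (A powr (-\<alpha>) + A powr (-\<beta>)) / c ^ (n + 1) * pow_bound (\<alpha> - 1 - Re s) (\<beta> - 1 - Re s) y"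
proof -
  have *: "1 / (A + y) ^ (n + 1) \<le> A powr (-\<gamma>) * y powr (\<gamma> - (real n + 1))"
    if "0 \<le> \<gamma>" "\<gamma> \<le> real n + 1" for \<gamma>
  proof -
    have "A powr \<gamma> * y powr (real n + 1 - \<gamma>) \<le> (A + y) powr \<gamma> * (A + y) powr (real n + 1 - \<gamma>)"
      using assms that by (intro mult_mono powr_mono2) auto
    also have "\<dots> = (A + y) ^ (n + 1)"
      using assms by (subst powr_add [symmetric]) (simp add: powr_add powr_realpow)
    finally have "1 / (A + y) ^ (n + 1) \<le> 1 / (A powr \<gamma> * y powr (real n + 1 - \<gamma>))"
      using assms by (intro divide_left_mono) auto
    also have "\<dots> = A powr (-\<gamma>) * y powr (\<gamma> - (real n + 1))"
      using powr_minus[of y "real n + 1 - \<gamma>"] by (simp add: powr_minus field_simps)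
    finally show ?thesis .
  qed
  have pos: "0 < c * (A + y)" using assms by simp
  have "norm (Mellin_kernel n s a y) = y powr (real n - Re s) / norm (a + of_real y) ^ (n + 1)"
    using assms by (simp add: norm_divide norm_power norm_mult norm_powr_real_powr)
  also have "\<dots> \<le> y powr (real n - Re s) / (c * (A + y)) ^ (n + 1)"
    using assms pos by (intro divide_left_mono power_mono mult_pos_pos zero_less_power less_le_trans[OF pos]) auto
  also have "\<dots> = y powr (real n - Re s) / c ^ (n + 1) * (1 / (A + y) ^ (n + 1))"
    by (simp add: power_mult_distrib)
  also have "\<dots> \<le> (A powr (-\<alpha>) + A powr (-\<beta>)) / c ^ (n + 1) * pow_bound (\<alpha> - 1 - Re s) (\<beta> - 1 - Re s) y"
  proof -
    have ex: "y powr (real n - Re s) * y powr (\<gamma> - (real n + 1)) = y powr (\<gamma> - 1 - Re s)" for \<gamma>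
      by (simp add: powr_add [symmetric])
    define \<gamma> where "\<gamma> = (if y < 1 then \<alpha> else \<beta>)"
    have "y powr (real n - Re s) / c ^ (n + 1) * (1 / (A + y) ^ (n + 1)) \<le> y powr (real n - Re s) / c ^ (n + 1) * (A powr (-\<gamma>) * y powr (\<gamma> - (real n + 1)))"
      using assms by (intro mult_left_mono *) (auto simp: \<gamma>_def)
    also have "\<dots> = A powr (-\<gamma>) / c ^ (n + 1) * y powr (\<gamma> - 1 - Re s)"
      by (subst ex [symmetric]) simp
    also have "\<dots> \<le> (A powr (-\<alpha>) + A powr (-\<beta>)) / c ^ (n + 1) * pow_bound (\<alpha> - 1 - Re s) (\<beta> - 1 - Re s) y"
      using assms by (intro mult_mono divide_right_mono) (auto simp: \<gamma>_def pow_bound_def)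
    finally show ?thesis .
  qed
  finally show ?thesis .
qed


lemma pow_bound_mono:
  assumes "y > 0" "a' \<le> a" "b \<le> b'"
  shows "pow_bound a b y \<le> pow_bound a' b' y"
  using assms by (auto simp: pow_bound_def intro: powr_mono powr_mono')

lemma set_integrable_pow_boundI:
  fixes g :: "real \<Rightarrow> complex"
  assumes "continuous_on {0<..} g" "\<And>y. y > 0 \<Longrightarrow> norm (g y) \<le> C * pow_bound a b y" "a > -1" "b < -1"
  shows "set_integrable lborel {0<..} g"
proof (rule set_integrable_bound)
  show "set_integrable lborel {0<..} (\<lambda>y. C * pow_bound a b y)"
    using set_integrable_pow_bound[OF assms(3,4)] by simp
  show "set_borel_measurable lborel {0<..} g"
    using borel_measurable_continuous_on_indicator[OF _ assms(1)] by (simp add: set_borel_measurable_def)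
  show "AE x in lborel. x \<in> {0<..} \<longrightarrow> norm (g x) \<le> norm (C * pow_bound a b x)"
    using assms(2) by (auto intro!: AE_I2 order_trans[OF assms(2)])
qed

lemma holomorphic_on_set_integral_pow_bound:
  fixes g :: "complex \<Rightarrow> real \<Rightarrow> complex"
  assumes "open U"
    and cont: "\<And>s. s \<in> U \<Longrightarrow> continuous_on {0<..} (g s)"
    and holo: "\<And>y. y > 0 \<Longrightarrow> (\<lambda>s. g s y) holomorphic_on U"
    and dom: "\<And>s0. s0 \<in> U \<Longrightarrow> \<exists>r>0. \<exists>C. \<exists>a>-1. \<exists>b< -1. cball s0 r \<subseteq> U \<and>
                (\<forall>s\<in>cball s0 r. \<forall>y>0. norm (g s y) \<le> C * pow_bound a b y)"
  shows "(\<lambda>s. LBINT y:{0<..}. g s y) holomorphic_on U"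
  unfolding set_lebesgue_integral_def
proof (rule holomorphic_on_integral_param)
  fix s assume "s \<in> U"
  then show "(\<lambda>y. indicat_real {0<..} y *\<^sub>R g s y) \<in> borel_measurable lborel"
    using borel_measurable_continuous_on_indicator[OF _ cont] by simp
next
  fix y :: real
  show "(\<lambda>s. indicat_real {0<..} y *\<^sub>R g s y) holomorphic_on U"
    using holo by (cases "y > 0") auto
next
  fix s0 assume "s0 \<in> U"
  from dom[OF this] obtain r C a b where *: "r > 0" "a > -1" "b < -1" "cball s0 r \<subseteq> U"
     "\<And>s y. s \<in> cball s0 r \<Longrightarrow> y > 0 \<Longrightarrow> norm (g s y) \<le> C * pow_bound a b y" by metis
  have "integrable lborel (\<lambda>y. indicator {0<..} y *\<^sub>R (C * pow_bound a b y))"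
    using set_integrable_pow_bound[OF *(2,3)] set_integrable_mult_right[of C lborel "{0<..}" "pow_bound a b"]
    unfolding set_integrable_def by auto
  with * show "\<exists>r>0. \<exists>G. integrable lborel G \<and> cball s0 r \<subseteq> U \<and>
      (\<forall>s\<in>cball s0 r. \<forall>y\<in>space lborel. norm (indicat_real {0<..} y *\<^sub>R g s y) \<le> G y)"
    by (intro exI[of _ r] conjI exI[of _ "\<lambda>y. indicator {0<..} y *\<^sub>R (C * pow_bound a b y)"])
      (auto simp: indicator_def)
qed (use assms in auto)

lemma add_of_real_neq_0:
  assumes "a \<notin> \<real>\<^sub>\<le>\<^sub>0" "y \<ge> 0"
  shows "a + complex_of_real y \<noteq> 0"
  using assms by (metis add_eq_0_iff2 nonpos_Reals_of_real_iff neg_le_0_iff_le of_real_minus)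

lemma continuous_on_Mellin_integrand:
  assumes "a \<notin> \<real>\<^sub>\<le>\<^sub>0"
  shows "continuous_on {0<..} (\<lambda>y. Mellin_kernel n s a y)"
  using add_of_real_neq_0[OF assms]
  by (intro continuous_intros) (auto simp: less_imp_le)

lemma Mellin_integral_real:
  fixes a s :: real
  assumes "a > 0" "0 < s" "s < real n + 1"
  shows "(LBINT y:{0<..}. complex_of_real y powr (of_nat n - of_real s) / (of_real a + of_real y) ^ (n + 1)) =
           of_real a powr (- of_real s) * Gamma (of_nat n + 1 - of_real s) * Gamma (of_real s) / fact n"
proof -
  have "(LBINT y:{0<..}. complex_of_real y powr (of_nat n - of_real s) / (of_real a + of_real y) ^ (n + 1)) =
     (LBINT y:{0<..}. of_real (y powr (real n - s) / (a + y) ^ (n + 1)))"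
    by (intro set_lebesgue_integral_cong) (auto simp: powr_of_real [symmetric])
  also have "\<dots> = of_real (LBINT y:{0<..}. y powr (real n - s) / (a + y) ^ (n + 1))"
    by (rule set_integral_complex_of_real)
  also have "(LBINT y:{0<..}. y powr (real n - s) / (a + y) ^ (n + 1)) = Gamma (real n + 1 - s) * Gamma s / fact n * a powr (-s)"
  proof -
    have "(LBINT y:{0<..}. y powr (real n - s) / (a + y) ^ (n + 1)) =
        enn2real (\<integral>\<^sup>+y. ennreal (indicator {0<..} y * (y powr (real n - s) / (a + y) ^ (n + 1))) \<partial>lborel)"
      unfolding set_lebesgue_integral_def real_scaleR_def
      by (rule integral_eq_nn_integral) (use assms in \<open>auto simp: indicator_def\<close>)
    then show ?thesis
      unfolding nn_integral_Mellin_real[OF assms] using assms by (simp add: Gamma_real_pos less_imp_le)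
  qed
  also have "complex_of_real \<dots> = of_real a powr (- of_real s) * Gamma (of_nat n + 1 - of_real s) * Gamma (of_real s) / fact n"
    using assms Gamma_complex_of_real[of s] Gamma_complex_of_real[of "real n + 1 - s"] by (simp add: powr_of_real [symmetric])
  finally show ?thesis .
qed


lemma of_real_islimpt_Ioo:
  assumes "a < x" "x < b"
  shows "(of_real x :: complex) islimpt of_real ` {a<..<b}"
  by (rule islimpt_isCont_image)
    (use assms in \<open>auto intro!: open_imp_islimpt eventually_at_topological[THEN iffD2] continuous_intros simp: eventually_at_filter\<close>)

lemma Mellin_integrable_strip:
  fixes a s :: complex
  assumes a: "a \<notin> \<real>\<^sub>\<le>\<^sub>0" and s: "0 < Re s" "Re s < real n + 1"
  shows "set_integrable lborel {0<..} (\<lambda>y. Mellin_kernel n s a y)"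
proof (rule set_integrable_pow_boundI)
  have "a \<noteq> 0" using a by auto
  show "norm (Mellin_kernel n s a y) \<le>
    (norm a powr (-(real n + 1)) + norm a powr (-0)) / (norm (1 + sgn a) / 2) ^ (n + 1) * pow_bound (real n + 1 - 1 - Re s) (0 - 1 - Re s) y"
    if "y > 0" for y
    using that \<open>a \<noteq> 0\<close> one_plus_sgn_pos[OF a]
    by (intro Mellin_integrand_bound norm_add_nonneg_ge) auto
qed (use assms continuous_on_Mellin_integrand in auto)

lemma Mellin_holomorphic_exponent:
  assumes a: "a \<notin> \<real>\<^sub>\<le>\<^sub>0"
  shows "(\<lambda>s. LBINT y:{0<..}. Mellin_kernel n s a y) holomorphic_on
           {s. 0 < Re s \<and> Re s < real n + 1}" (is "_ holomorphic_on ?U")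
proof (rule holomorphic_on_set_integral_pow_bound)
  have "a \<noteq> 0" using a by auto
  show "open ?U" by (intro open_Collect_conj open_halfspace_Re_gt open_halfspace_Re_lt)
  show "continuous_on {0<..} (\<lambda>y. Mellin_kernel n s a y)" for s
    by (rule continuous_on_Mellin_integrand[OF a])
  show "(\<lambda>s. Mellin_kernel n s a y) holomorphic_on ?U" if "y > 0" for y
    using add_of_real_neq_0[OF a, of y] that by (intro holomorphic_intros) auto
  fix s0 assume s0: "s0 \<in> ?U"
  define r where "r = min (Re s0) (real n + 1 - Re s0) / 2"
  have r: "r > 0" "Re s0 - r > 0" "Re s0 + r < real n + 1" using s0 by (auto simp: r_def min_def field_simps)
  have re: "Re s0 - r \<le> Re s \<and> Re s \<le> Re s0 + r" if "s \<in> cball s0 r" for s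
    using that abs_Re_le_cmod[of "s0 - s"] by (auto simp: dist_norm)
  show "\<exists>r>0. \<exists>C. \<exists>a'>-1. \<exists>b< -1. cball s0 r \<subseteq> ?U \<and>
    (\<forall>s\<in>cball s0 r. \<forall>y>0. norm (Mellin_kernel n s a y) \<le> C * pow_bound a' b y)"
  proof (intro exI conjI ballI allI impI)
    show "real n + 1 - 1 - (Re s0 + r) > -1" "0 - 1 - (Re s0 - r) < -1" using r by auto
    show "cball s0 r \<subseteq> ?U" using re r by fastforce
    fix s y assume s: "s \<in> cball s0 r" and y: "y > (0::real)"
    let ?C = "(norm a powr (-(real n + 1)) + norm a powr (-0)) / (norm (1 + sgn a) / 2) ^ (n + 1)"
    have "norm (Mellin_kernel n s a y) \<le>
      ?C * pow_bound (real n + 1 - 1 - Re s) (0 - 1 - Re s) y"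
      using y \<open>a \<noteq> 0\<close> one_plus_sgn_pos[OF a]
      by (intro Mellin_integrand_bound norm_add_nonneg_ge) auto
    also have "\<dots> \<le> ?C * pow_bound (real n + 1 - 1 - (Re s0 + r)) (0 - 1 - (Re s0 - r)) y"
      using re[OF s] y one_plus_sgn_pos[OF a] by (intro mult_left_mono pow_bound_mono) auto
    finally show "norm (Mellin_kernel n s a y) \<le>
      ?C * pow_bound (real n + 1 - 1 - (Re s0 + r)) (0 - 1 - (Re s0 - r)) y" .
  qed (use r in auto)
qed

lemma Mellin_holomorphic_base:
  assumes s: "0 < Re s" "Re s < real n + 1"
  shows "(\<lambda>a. LBINT y:{0<..}. Mellin_kernel n s a y) holomorphic_on
           - \<real>\<^sub>\<le>\<^sub>0"
proof (rule holomorphic_on_set_integral_pow_bound)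
  show "open (- \<real>\<^sub>\<le>\<^sub>0 :: complex set)" by (simp add: open_Compl)
  show "continuous_on {0<..} (\<lambda>y. Mellin_kernel n s a y)" if "a \<in> - \<real>\<^sub>\<le>\<^sub>0" for a
    using that by (intro continuous_on_Mellin_integrand) auto
  show "(\<lambda>a. Mellin_kernel n s a y) holomorphic_on - \<real>\<^sub>\<le>\<^sub>0" if "y > 0" for y
    using that add_of_real_neq_0[of _ y] by (intro holomorphic_intros) auto
  fix a0 :: complex assume "a0 \<in> - \<real>\<^sub>\<le>\<^sub>0"
  then have a0: "a0 \<notin> \<real>\<^sub>\<le>\<^sub>0" and "a0 \<noteq> 0" by auto
  define c where "c = norm (1 + sgn a0) / 2"
  have c: "c > 0" using one_plus_sgn_pos[OF a0] by (simp add: c_def)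
  \<comment> \<open>With this radius, moving the base point from \<open>a0\<close> to
    \<open>a\<close> costs at most half of the lower bound c (|a0| + y), uniformly in y \<ge>
    0.\<close>
  define r where "r = c * norm a0 / 2"
  have r: "r > 0" using c \<open>a0 \<noteq> 0\<close> by (simp add: r_def)
  have lower: "norm (a + of_real y) \<ge> (c/2) * (norm a0 + y)" if "a \<in> cball a0 r" "y \<ge> 0" for a y
  proof -
    have "c * (norm a0 + y) \<le> norm (a0 + of_real y)"
      unfolding c_def using that \<open>a0 \<noteq> 0\<close> by (intro norm_add_nonneg_ge) auto
    also have "\<dots> \<le> norm (a + of_real y) + norm (a0 - a)"
      using norm_triangle_ineq[of "a + of_real y" "a0 - a"] by (simp add: add.commute)
    also have "\<dots> \<le> norm (a + of_real y) + r" using that by (auto simp: dist_norm)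
    finally have "c * (norm a0 + y) \<le> norm (a + of_real y) + r" .
    moreover have "r \<le> c * (norm a0 + y) / 2"
      using c that unfolding r_def by (intro divide_right_mono mult_left_mono) auto
    ultimately show ?thesis by simp
  qed
  show "\<exists>r>0. \<exists>C. \<exists>a'>-1. \<exists>b< -1. cball a0 r \<subseteq> - \<real>\<^sub>\<le>\<^sub>0 \<and>
    (\<forall>a\<in>cball a0 r. \<forall>y>0. norm (Mellin_kernel n s a y) \<le> C * pow_bound a' b y)"
  proof (intro exI conjI ballI allI impI)
    show "real n + 1 - 1 - Re s > -1" "0 - 1 - Re s < -1" using s by auto
    show "cball a0 r \<subseteq> - \<real>\<^sub>\<le>\<^sub>0"
    proof
      fix a assume a: "a \<in> cball a0 r"
      show "a \<in> - \<real>\<^sub>\<le>\<^sub>0"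
      proof
        assume "a \<in> \<real>\<^sub>\<le>\<^sub>0"
        then obtain x where x: "x \<le> 0" "a = of_real x" by (auto elim: nonpos_Reals_cases)
        have "0 < (c/2) * (norm a0 + (-x))" using c x \<open>a0 \<noteq> 0\<close> by (intro mult_pos_pos add_pos_nonneg) auto
        also have "\<dots> \<le> norm (a + of_real (-x))" using lower[OF a, of "-x"] x by auto
        finally show False using x by simp
      qed
    qed
    fix a y assume "a \<in> cball a0 r" "y > (0::real)"
    then show "norm (Mellin_kernel n s a y) \<le>
      (norm a0 powr (-(real n + 1)) + norm a0 powr (-0)) / (c/2) ^ (n + 1) * pow_bound (real n + 1 - 1 - Re s) (0 - 1 - Re s) y"
      using c \<open>a0 \<noteq> 0\<close> by (intro Mellin_integrand_bound lower) auto
  qed (use r in auto)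
qed

lemma connected_slotted_plane: "connected (- \<real>\<^sub>\<le>\<^sub>0 :: complex set)"
proof -
  have "\<real>\<^sub>\<le>\<^sub>0 = complex_of_real ` {..0}" by (auto simp: nonpos_Reals_def)
  then show ?thesis using starlike_imp_connected[OF starlike_slotted_complex_plane_left[of 0]] by simp
qed

text \<open>Two continuations from positive a and real s: first in s over the strip with a > 0
  fixed, then in a over the slit plane with s fixed. The real segment (0, 1) lies in both domains,
  as n + 1 \<ge> 1, and accumulates at 1/2.\<close>

theorem Mellin_integral:
  fixes a s :: complex
  assumes a: "a \<notin> \<real>\<^sub>\<le>\<^sub>0" and s: "0 < Re s" "Re s < real n + 1"
  shows "(LBINT y:{0<..}. Mellin_kernel n s a y) =
           a powr (- s) * Gamma (of_nat n + 1 - s) * Gamma s / fact n"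
proof -
  let ?J = "\<lambda>a s. LBINT y:{0<..}. Mellin_kernel n s a y"
  let ?G = "\<lambda>a s. a powr (- s) * Gamma (of_nat n + 1 - s) * Gamma s / fact n"
  let ?U = "{s. 0 < Re s \<and> Re s < real n + 1}"
  have holG: "(\<lambda>s. ?G a s) holomorphic_on ?U" for a
    by (intro holomorphic_intros) (auto elim!: nonpos_Ints_cases simp: complex_eq_iff)
  have 1: "?J (of_real x) s - ?G (of_real x) s = 0" if "x > 0" "s \<in> ?U" for x s
  proof (rule analytic_continuation[of "\<lambda>s. ?J (of_real x) s - ?G (of_real x) s" ?U])
    show "(\<lambda>s. ?J (of_real x) s - ?G (of_real x) s) holomorphic_on ?U"
      using that by (intro holomorphic_on_diff holG Mellin_holomorphic_exponent) auto
    show "open ?U" by (intro open_Collect_conj open_halfspace_Re_gt open_halfspace_Re_lt)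
    show "connected ?U"
      by (simp only: Collect_conj_eq)
        (intro convex_connected convex_Int convex_halfspace_Re_gt convex_halfspace_Re_lt)
    show "complex_of_real (1/2) islimpt of_real ` {0<..<1}" by (rule of_real_islimpt_Ioo) auto
    fix z :: complex assume "z \<in> of_real ` {0<..<1}"
    then show "?J (of_real x) z - ?G (of_real x) z = 0"
      using Mellin_integral_real[of x _ n] that by fastforce
  qed (use that in auto)
  have "?J a s - ?G a s = 0"
  proof (rule analytic_continuation[of "\<lambda>a. ?J a s - ?G a s" "- \<real>\<^sub>\<le>\<^sub>0"])
    show "(\<lambda>a. ?J a s - ?G a s) holomorphic_on - \<real>\<^sub>\<le>\<^sub>0"
      using s by (intro holomorphic_on_diff Mellin_holomorphic_base) (auto intro!: holomorphic_intros)
    show "complex_of_real (1/2) islimpt of_real ` {0<..<1}" by (rule of_real_islimpt_Ioo) auto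
    show "z \<in> of_real ` {0<..<1} \<Longrightarrow> ?J z s - ?G z s = 0" for z :: complex
      using 1[of _ s] s by auto
  qed (use a in \<open>auto simp: connected_slotted_plane complex_nonpos_Reals_iff\<close>)
  then show ?thesis by simp
qed

section \<open>Poisson's formula on a disc\<close>

lemma circle_Cauchy_integral:
  assumes "continuous_on (cball 0 R) h" "h holomorphic_on ball 0 R" "R > 0" "norm w < R"
  shows "((\<lambda>t. h (of_real R * cis t) * (of_real R * cis t) / (of_real R * cis t - w) ^ Suc m) has_integral
            2 * of_real pi * (deriv ^^ m) h w / fact m) {0..2*pi}"
proof -
  have "((\<lambda>u. h u / (u - w) ^ Suc m) has_contour_integral (2 * pi * \<i>) / fact m * (deriv ^^ m) h w) (circlepath 0 R)"
    using assms by (intro Cauchy_has_contour_integral_higher_derivative_circlepath) auto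
  then have "((\<lambda>t. h (of_real R * cis t) / (of_real R * cis t - w) ^ Suc m * R * \<i> * cis t) has_integral (2 * pi * \<i>) / fact m * (deriv ^^ m) h w) {0..2*pi}"
    unfolding circlepath_def by (subst (asm) has_contour_integral_part_circlepath_iff) auto
  from has_integral_mult_right[OF this, of "-\<i>"] show ?thesis
    by (simp add: mult_ac)
qed

text \<open>
  On the circle \<open>cnj u = R\<^sup>2 / u\<close>, so that the conjugate of the integrand is again the value of a
  holomorphic function.
\<close>

lemma circle_Cauchy_integral_cnj:
  assumes "continuous_on (cball 0 R) h" "h holomorphic_on ball 0 R" "R > 0" "norm w < R"
  shows "((\<lambda>t. cnj (h (of_real R * cis t)) * (of_real R * cis t) / (of_real R * cis t - w) ^ Suc m) has_integral
            (if m = 0 then 2 * of_real pi * cnj (h 0) else 0)) {0..2*pi}"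
proof -
  \<comment> \<open>\<open>G\<close> is the conjugate of the integrand after the substitution
    \<open>cnj u = R\<^sup>2 / u\<close>. Its denominator has no zero in the closed disc, so the
    integral is 2 pi times the conjugate of \<open>G 0\<close>, to which the factor v^m leaves a
    contribution for m = 0 only.\<close>
  define G where "G = (\<lambda>v. h v * (of_real (R\<^sup>2) * v ^ m) / (of_real (R\<^sup>2) - cnj w * v) ^ Suc m)"
  have nz: "of_real (R\<^sup>2) - cnj w * v \<noteq> 0" if "norm v \<le> R" for v
  proof
    assume "of_real (R\<^sup>2) - cnj w * v = 0"
    then have "norm (of_real (R\<^sup>2) :: complex) = norm (cnj w * v)" by simp
    then have "R * R = norm w * norm v" by (simp add: norm_mult power2_eq_square)
    also have "norm w * norm v \<le> norm w * R" using that by (intro mult_left_mono) auto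
    also have "\<dots> < R * R" using assms by simp
    finally show False by simp
  qed
  have "((\<lambda>t. G (of_real R * cis t) * (of_real R * cis t) / (of_real R * cis t - 0) ^ Suc 0) has_integral
            2 * of_real pi * (deriv ^^ 0) G 0 / fact 0) {0..2*pi}"
    unfolding G_def using assms nz
    by (intro circle_Cauchy_integral continuous_intros holomorphic_intros) auto
  then have "((\<lambda>t. G (of_real R * cis t)) has_integral 2 * of_real pi * G 0) {0..2*pi}"
    using assms by simp
  then have "((\<lambda>t. cnj (G (of_real R * cis t))) has_integral cnj (2 * of_real pi * G 0)) {0..2*pi}"
    by (rule has_integral_linear[OF _ bounded_linear_cnj, unfolded o_def])
  moreover have "cnj (G (of_real R * cis t)) = cnj (h (of_real R * cis t)) * (of_real R * cis t) / (of_real R * cis t - w) ^ Suc m" for t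
  proof -
    define u where "u = of_real R * cis t"
    have u: "norm u = R" using assms by (simp add: u_def norm_mult)
    have uu: "of_real (R\<^sup>2) = u * cnj u" using u by (simp add: complex_norm_square [symmetric])
    have "u \<noteq> 0" using u assms by auto
    have "cnj (G u) = cnj (h u) * (u * cnj u * cnj u ^ m) / (u * cnj u - w * cnj u) ^ Suc m"
      unfolding G_def by (simp del: of_real_power add: uu mult.commute)
    also have "u * cnj u - w * cnj u = cnj u * (u - w)" by (simp add: algebra_simps)
    also have "cnj (h u) * (u * cnj u * cnj u ^ m) / (cnj u * (u - w)) ^ Suc m = cnj (h u) * u / (u - w) ^ Suc m"
    proof -
      have 1: "cnj (h u) * (u * cnj u * cnj u ^ m) = (cnj (h u) * u) * cnj u ^ Suc m" by simp
      have 2: "(cnj u * (u - w)) ^ Suc m = (u - w) ^ Suc m * cnj u ^ Suc m"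
        by (simp only: power_mult_distrib mult.commute)
      have 3: "cnj u ^ Suc m \<noteq> 0" using \<open>u \<noteq> 0\<close> by simp
      show ?thesis unfolding 1 2 by (rule mult_divide_mult_cancel_right[OF 3])
    qed
    finally show ?thesis by (simp add: u_def)
  qed
  moreover have "cnj (2 * of_real pi * G 0) = (if m = 0 then 2 * of_real pi * cnj (h 0) else 0)"
    using assms by (simp add: G_def)
  ultimately show ?thesis by simp
qed

text \<open>Mean of the two preceding formulas, as Re h = (h + cnj h) / 2. For m > 0 the conjugate
  part drops out, so that Re h on the circle alone determines the derivatives of h inside.\<close>

lemma circle_Schwarz_integral:
  assumes "continuous_on (cball 0 R) h" "h holomorphic_on ball 0 R" "R > 0" "norm w < R"
  shows "((\<lambda>t. of_real (Re (h (of_real R * cis t))) * (of_real R * cis t) / (of_real R * cis t - w) ^ Suc m) has_integral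
            of_real pi * ((deriv ^^ m) h w / fact m + (if m = 0 then cnj (h 0) else 0))) {0..2*pi}"
proof -
  have *: "((\<lambda>t. (h (of_real R * cis t) * (of_real R * cis t) / (of_real R * cis t - w) ^ Suc m +
       cnj (h (of_real R * cis t)) * (of_real R * cis t) / (of_real R * cis t - w) ^ Suc m) * (1/2)) has_integral
     (2 * of_real pi * (deriv ^^ m) h w / fact m + (if m = 0 then 2 * of_real pi * cnj (h 0) else 0)) * (1/2)) {0..2*pi}"
    by (intro has_integral_mult_left has_integral_add circle_Cauchy_integral circle_Cauchy_integral_cnj assms)
  have **: "(a * b / c + cnj a * b / c) * (1/2) = of_real (Re a) * b / c" for a b c :: complex
    by (simp add: complex_add_cnj add_divide_distrib [symmetric] distrib_right [symmetric])
  show ?thesis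
    by (rule has_integral_eq_rhs[OF has_integral_eq[OF _ *]], rule **) (simp add: algebra_simps)
qed

lemma continuous_on_circle:
  assumes "continuous_on (cball 0 R) h" "R > 0"
  shows "continuous_on {0..2*pi} (\<lambda>t. h (of_real R * cis t))"
  by (rule continuous_on_compose2[OF assms(1)]) (use assms in \<open>auto intro!: continuous_intros simp: norm_mult\<close>)

text \<open>The bound is by the mass of |Re h| rather than by its maximum, because the
  characteristic controls log |F| on circles in the mean. The case m = 0 is excluded since Re h
  determines h only up to an imaginary constant.\<close>

lemma higher_deriv_bound_Re:
  assumes "continuous_on (cball 0 R) h" "h holomorphic_on ball 0 R" "R > 0" "norm w < R" "m > 0"
  shows "norm ((deriv ^^ m) h w) \<le> fact m / pi * R / (R - norm w) ^ Suc m * integral {0..2*pi} (\<lambda>t. \<bar>Re (h (of_real R * cis t))\<bar>)"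
proof -
  note I = circle_Schwarz_integral[OF assms(1-4), of m]
  have ge: "norm (of_real R * cis t - w) \<ge> R - norm w" for t
    using norm_triangle_ineq2[of "of_real R * cis t" w] assms by (simp add: norm_mult)
  have "norm (integral {0..2*pi} (\<lambda>t. of_real (Re (h (of_real R * cis t))) * (of_real R * cis t) / (of_real R * cis t - w) ^ Suc m)) \<le>
    integral {0..2*pi} (\<lambda>t. R / (R - norm w) ^ Suc m * \<bar>Re (h (of_real R * cis t))\<bar>)"
  proof (rule integral_norm_bound_integral)
    show "(\<lambda>t. R / (R - norm w) ^ Suc m * \<bar>Re (h (of_real R * cis t))\<bar>) integrable_on {0..2*pi}"
      by (intro integrable_continuous_real continuous_intros continuous_on_circle assms)
    fix t
    have "norm (of_real (Re (h (of_real R * cis t))) * (of_real R * cis t) / (of_real R * cis t - w) ^ Suc m) =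
      \<bar>Re (h (of_real R * cis t))\<bar> * R / norm (of_real R * cis t - w) ^ Suc m"
      using assms by (simp only: norm_mult norm_divide norm_power norm_cis norm_of_real)
    also have "\<dots> \<le> \<bar>Re (h (of_real R * cis t))\<bar> * R / (R - norm w) ^ Suc m"
      using assms ge[of t] by (intro divide_left_mono power_mono mult_pos_pos zero_less_power) auto
    finally show "norm (of_real (Re (h (of_real R * cis t))) * (of_real R * cis t) / (of_real R * cis t - w) ^ Suc m) \<le>
       R / (R - norm w) ^ Suc m * \<bar>Re (h (of_real R * cis t))\<bar>" by (simp add: mult_ac)
  qed (use I in \<open>auto intro: has_integral_integrable\<close>)
  moreover have "norm (integral {0..2*pi} (\<lambda>t. of_real (Re (h (of_real R * cis t))) * (of_real R * cis t) / (of_real R * cis t - w) ^ Suc m)) = pi * norm ((deriv ^^ m) h w) / fact m"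
    unfolding integral_unique[OF I] using assms by (simp add: norm_mult norm_divide)
  ultimately have "pi * norm ((deriv ^^ m) h w) / fact m \<le>
      R / (R - norm w) ^ Suc m * integral {0..2*pi} (\<lambda>t. \<bar>Re (h (of_real R * cis t))\<bar>)"
    by (simp only: integral_mult_right)
  from mult_left_mono[OF this, of "fact m / pi"] show ?thesis
    by (simp only: times_divide_eq_left times_divide_eq_right mult_ac) simp
qed

text \<open>\<open>P\<close> is the Poisson kernel (R^2 - |w|^2) / |u - w|^2, which lies between (R
  - |w|) / (R + |w|) and its reciprocal. For |w| \<le> R/3 these are at least 1/2 and at most
  2.\<close>

lemma Poisson_kernel_bounds:
  assumes "norm u = R" "R > 0" "norm w \<le> R / 3"
  defines "P \<equiv> Re (2 * u / (u - w)) - 1"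
  shows "1/2 \<le> P" "P \<le> 2"
proof -
  define d where "d = norm (u - w)"
  have d: "R - norm w \<le> d" "d \<le> R + norm w" "d > 0"
    using norm_triangle_ineq2[of u w] norm_triangle_ineq4[of u w] assms by (auto simp: d_def)
  then have "u \<noteq> w" by (auto simp: d_def)
  have "P * d\<^sup>2 = R\<^sup>2 - (norm w)\<^sup>2"
  proof -
    have "2 * u / (u - w) = 2 * u * cnj (u - w) / of_real (d\<^sup>2)"
      unfolding d_def by (subst complex_div_cnj) simp
    then have "Re (2 * u / (u - w)) = Re (2 * u * cnj (u - w)) / d\<^sup>2" by (metis Re_divide_of_real)
    then have "P * d\<^sup>2 = Re (2 * u * cnj (u - w)) - d\<^sup>2"
      using d unfolding P_def by (simp add: field_simps)
    also have "\<dots> = R\<^sup>2 - (norm w)\<^sup>2"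
      unfolding assms(1) [symmetric] d_def cmod_power2 by (simp add: power2_eq_square algebra_simps)
    finally show ?thesis .
  qed
  then have P: "P = (R - norm w) * (R + norm w) / d\<^sup>2"
    using d by (simp add: field_simps power2_eq_square)
  have "(R - norm w) * (R + norm w) / d\<^sup>2 \<le> (R - norm w) * (R + norm w) / (R - norm w)\<^sup>2"
    using d assms by (intro divide_left_mono power_mono mult_nonneg_nonneg mult_pos_pos zero_less_power) auto
  also have "\<dots> = (R + norm w) / (R - norm w)" using assms by (simp add: power2_eq_square)
  also have "\<dots> \<le> 2" using assms by (simp add: field_simps)
  finally show "P \<le> 2" by (simp add: P)
  have "1 / 2 \<le> (R - norm w) / (R + norm w)" using assms by (simp add: field_simps add_pos_nonneg)
  also have "\<dots> = (R - norm w) * (R + norm w) / (R + norm w)\<^sup>2"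
    using add_pos_nonneg[OF \<open>R > 0\<close>, of "norm w"] by (simp add: power2_eq_square)
  also have "\<dots> \<le> (R - norm w) * (R + norm w) / d\<^sup>2"
    using d assms by (intro divide_left_mono power_mono mult_nonneg_nonneg mult_pos_pos zero_less_power) auto
  finally show "1 / 2 \<le> P" by (simp add: P)
qed

text \<open>In Poisson's formula the positive part of Re h is weighted by at most 2 and the negative
  part by at least 1/2. Keeping the negative part makes this a bound for its mass, once Re h is
  bounded below at the single point w.\<close>

lemma Re_Poisson_bound:
  assumes "continuous_on (cball 0 R) h" "h holomorphic_on ball 0 R" "R > 0" "norm w \<le> R / 3"
  shows "2 * pi * Re (h w) \<le> 2 * integral {0..2*pi} (\<lambda>t. max 0 (Re (h (of_real R * cis t)))) -
           integral {0..2*pi} (\<lambda>t. max 0 (- Re (h (of_real R * cis t)))) / 2"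
proof -
  define u where "u = (\<lambda>t. of_real R * cis t)"
  have nu: "norm (u t) = R" for t using assms by (simp add: u_def norm_mult)
  have w: "norm w < R" using assms by auto
  have "((\<lambda>t. of_real (Re (h (u t))) * u t / (u t - w) ^ Suc 0) has_integral
            of_real pi * (h w + cnj (h 0))) {0..2*pi}"
    using circle_Schwarz_integral[OF assms(1-3) w, of 0] by (simp add: u_def)
  from has_integral_mult_right[OF has_integral_linear[OF this bounded_linear_Re], of 2]
  have 1: "((\<lambda>t. 2 * Re (of_real (Re (h (u t))) * u t / (u t - w))) has_integral
            2 * Re (of_real pi * (h w + cnj (h 0)))) {0..2*pi}"
    by (simp only: o_def power_Suc power_0 mult_1_right)
  have "((\<lambda>t. of_real (Re (h (u t))) * u t / (u t - 0) ^ Suc 0) has_integral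
            of_real pi * (h 0 + cnj (h 0))) {0..2*pi}"
    using circle_Schwarz_integral[OF assms(1-3), of 0 0] assms by (simp add: u_def)
  from has_integral_linear[OF this bounded_linear_Re]
  have 2: "((\<lambda>t. Re (of_real (Re (h (u t))) * u t / (u t - 0) ^ Suc 0)) has_integral
            Re (of_real pi * (h 0 + cnj (h 0)))) {0..2*pi}"
    by (simp only: o_def)
  have "((\<lambda>t. 2 * Re (of_real (Re (h (u t))) * u t / (u t - w)) - Re (of_real (Re (h (u t))) * u t / (u t - 0) ^ Suc 0)) has_integral
     2 * Re (of_real pi * (h w + cnj (h 0))) - Re (of_real pi * (h 0 + cnj (h 0)))) {0..2*pi}"
    by (rule has_integral_diff[OF 1 2])
  then have "((\<lambda>t. Re (h (u t)) * (Re (2 * u t / (u t - w)) - 1)) has_integral 2 * pi * Re (h w)) {0..2*pi}"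
  proof (rule has_integral_eq_rhs[OF has_integral_eq, rotated])
    fix t
    have "u t \<noteq> 0" using nu[of t] assms by auto
    have "Re (of_real x * v) = x * Re v" for x v by simp
    then have *: "Re (of_real x * a / b) = x * Re (a / b)" for x a b by (metis times_divide_eq_right)
    show "2 * Re (of_real (Re (h (u t))) * u t / (u t - w)) - Re (of_real (Re (h (u t))) * u t / (u t - 0) ^ Suc 0) = Re (h (u t)) * (Re (2 * u t / (u t - w)) - 1)"
      unfolding * using \<open>u t \<noteq> 0\<close> *[of 2 "u t" "u t - w"] by (simp add: algebra_simps)
  qed (simp add: algebra_simps)
  moreover have "((\<lambda>t. 2 * max 0 (Re (h (u t))) - max 0 (- Re (h (u t))) / 2) has_integral
       2 * integral {0..2*pi} (\<lambda>t. max 0 (Re (h (u t)))) - integral {0..2*pi} (\<lambda>t. max 0 (- Re (h (u t)))) / 2) {0..2*pi}"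
    unfolding u_def
    by (intro has_integral_diff has_integral_mult_right has_integral_divide integrable_integral integrable_continuous_real continuous_intros continuous_on_circle assms)
  ultimately have "2 * pi * Re (h w) \<le> 2 * integral {0..2*pi} (\<lambda>t. max 0 (Re (h (u t)))) - integral {0..2*pi} (\<lambda>t. max 0 (- Re (h (u t)))) / 2"
  proof (rule has_integral_le)
    fix t
    have P: "1/2 \<le> Re (2 * u t / (u t - w)) - 1" "Re (2 * u t / (u t - w)) - 1 \<le> 2"
      using Poisson_kernel_bounds[of "u t" R w] nu[of t] assms by auto
    show "Re (h (u t)) * (Re (2 * u t / (u t - w)) - 1) \<le> 2 * max 0 (Re (h (u t))) - max 0 (- Re (h (u t))) / 2"
    proof (cases "Re (h (u t)) \<ge> 0")
      case True
      then show ?thesis using mult_left_mono[OF P(2) True] by simp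
    next
      case False
      then show ?thesis using mult_left_mono_neg[OF P(1), of "Re (h (u t))"] by simp
    qed
  qed
  then show ?thesis by (simp add: u_def)
qed

section \<open>Blaschke factorization and Jensen's formula\<close>

abbreviation (input) blaschke_den :: "real \<Rightarrow> complex \<Rightarrow> complex \<Rightarrow> complex" where
  "blaschke_den R \<rho> w \<equiv> of_real (R\<^sup>2) - cnj \<rho> * w"

definition blaschke :: "real \<Rightarrow> complex \<Rightarrow> complex \<Rightarrow> complex" where
  "blaschke R \<rho> w = of_real R * (w - \<rho>) / (blaschke_den R \<rho> w)"

lemma blaschke_denom_nonzero:
  assumes "norm \<rho> * norm w < R\<^sup>2"
  shows "blaschke_den R \<rho> w \<noteq> 0"
proof
  assume "blaschke_den R \<rho> w = 0"
  then have "norm (of_real (R\<^sup>2) :: complex) = norm (cnj \<rho> * w)" by simp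
  with assms show False by (simp add: norm_mult norm_power)
qed

text \<open>For |\<rho>| < R the right side is nonnegative in the disc and vanishes on the circle,
  which yields \<open>norm_blaschke_le_1\<close> and \<open>norm_blaschke_circle\<close>.\<close>

lemma blaschke_norm_identity:
  "(norm (blaschke_den R \<rho> w))\<^sup>2 - R\<^sup>2 * (norm (w - \<rho>))\<^sup>2 = (R\<^sup>2 - (norm \<rho>)\<^sup>2) * (R\<^sup>2 - (norm w)\<^sup>2)"
  unfolding cmod_power2 by (simp add: power2_eq_square algebra_simps)

lemma norm_blaschke_le_1:
  assumes "norm \<rho> < R" "norm w \<le> R"
  shows "norm (blaschke R \<rho> w) \<le> 1"
proof -
  have R: "R > 0" using assms norm_ge_zero[of \<rho>] by linarith
  have "norm \<rho> * norm w \<le> norm \<rho> * R" using assms by (intro mult_left_mono) auto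
  also have "\<dots> < R\<^sup>2" using assms R by (simp add: power2_eq_square)
  finally have "norm \<rho> * norm w < R\<^sup>2" .
  then have nz: "norm (blaschke_den R \<rho> w) > 0"
    using blaschke_denom_nonzero by (metis zero_less_norm_iff)
  have "(R * norm (w - \<rho>))\<^sup>2 \<le> (norm (blaschke_den R \<rho> w))\<^sup>2"
  proof -
    have "(R\<^sup>2 - (norm \<rho>)\<^sup>2) * (R\<^sup>2 - (norm w)\<^sup>2) \<ge> 0"
      using assms by (intro mult_nonneg_nonneg) (auto intro!: power_mono)
    then show ?thesis using blaschke_norm_identity[of R \<rho> w] by (simp add: power_mult_distrib)
  qed
  then have "R * norm (w - \<rho>) \<le> norm (blaschke_den R \<rho> w)"
    by (rule power2_le_imp_le) simp
  moreover have "R > 0" using assms norm_ge_zero[of \<rho>] by linarith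
  ultimately show ?thesis using nz by (simp add: blaschke_def norm_divide norm_mult)
qed

lemma norm_blaschke_circle:
  assumes "norm \<rho> < R" "norm w = R"
  shows "norm (blaschke R \<rho> w) = 1"
proof -
  have R: "R > 0" using assms norm_ge_zero[of \<rho>] by linarith
  have "norm \<rho> * norm w < R\<^sup>2" using assms R by (simp add: power2_eq_square)
  then have nz: "norm (blaschke_den R \<rho> w) > 0"
    using blaschke_denom_nonzero by (metis zero_less_norm_iff)
  have "(R * norm (w - \<rho>))\<^sup>2 = (norm (blaschke_den R \<rho> w))\<^sup>2"
    using blaschke_norm_identity[of R \<rho> w] assms by (simp add: power_mult_distrib)
  then have "R * norm (w - \<rho>) = norm (blaschke_den R \<rho> w)"
    using R by (metis abs_norm_cancel norm_ge_zero power2_eq_imp_eq mult_nonneg_nonneg less_imp_le)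
  then show ?thesis using nz R by (simp add: blaschke_def norm_divide norm_mult)
qed

lemma norm_blaschke_ge:
  assumes "norm \<rho> < R" "norm w < R" "norm (w - \<rho>) \<ge> d" "d > 0"
  shows "d / (2 * R) \<le> norm (blaschke R \<rho> w)"
proof -
  have R: "R > 0" using assms norm_ge_zero[of \<rho>] by linarith
  have lt: "norm \<rho> * norm w < R\<^sup>2"
    unfolding power2_eq_square using assms by (intro mult_strict_mono') auto
  then have nz: "norm (blaschke_den R \<rho> w) > 0"
    using blaschke_denom_nonzero by (metis zero_less_norm_iff)
  have "norm (blaschke_den R \<rho> w) \<le> norm (of_real (R\<^sup>2) :: complex) + norm (cnj \<rho> * w)" by (rule norm_triangle_ineq4)
  also have "\<dots> \<le> 2 * R\<^sup>2" using lt by (simp add: norm_mult norm_power)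
  finally have le: "norm (blaschke_den R \<rho> w) \<le> 2 * R\<^sup>2" .
  have "d / (2 * R) = R * d / (2 * R\<^sup>2)" using R by (simp add: power2_eq_square)
  also have "\<dots> \<le> R * norm (w - \<rho>) / norm (blaschke_den R \<rho> w)"
    using R assms le nz by (intro frac_le mult_left_mono) auto
  finally show ?thesis using R by (simp add: blaschke_def norm_divide norm_mult)
qed

text \<open>The numerator is at most 3/8 R^2 and the denominator at least 31/32 R^2. A zero of
  modulus below R/4 thereby contributes at least ln 2 per order in
  \<open>Jensen_estimate\<close>.\<close>

lemma norm_blaschke_le_half:
  assumes "norm \<rho> \<le> R / 4" "norm w \<le> R / 8" "R > 0"
  shows "norm (blaschke R \<rho> w) \<le> 1 / 2"
proof -
  have "norm \<rho> * norm w \<le> (R / 4) * (R / 8)" using assms by (intro mult_mono) auto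
  then have m: "norm (cnj \<rho> * w) \<le> R\<^sup>2 / 32" by (simp add: norm_mult power2_eq_square)
  have "norm (blaschke_den R \<rho> w) \<ge> norm (of_real (R\<^sup>2) :: complex) - norm (cnj \<rho> * w)" by (rule norm_triangle_ineq2)
  moreover have "norm (of_real (R\<^sup>2) :: complex) = R\<^sup>2" by (simp add: norm_power)
  ultimately have ge: "norm (blaschke_den R \<rho> w) \<ge> 31 / 32 * R\<^sup>2" using m by simp
  have "norm (w - \<rho>) \<le> 3 / 8 * R" using norm_triangle_ineq4[of w \<rho>] assms by simp
  then have "norm (blaschke R \<rho> w) \<le> R * (3 / 8 * R) / (31 / 32 * R\<^sup>2)"
    unfolding blaschke_def norm_divide norm_mult using assms ge
    by (intro frac_le mult_mono) auto
  also have "\<dots> \<le> 1 / 2" using assms by (simp add: power2_eq_square)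
  finally show ?thesis .
qed

lemma blaschke_eq_0_iff:
  assumes "norm \<rho> * norm w < R\<^sup>2" "R > 0"
  shows "blaschke R \<rho> w = 0 \<longleftrightarrow> w = \<rho>"
  using blaschke_denom_nonzero[OF assms(1)] assms(2) by (simp add: blaschke_def)

lemma has_field_derivative_blaschke:
  assumes "norm \<rho> * norm w < R\<^sup>2" "R > 0"
  shows "(blaschke R \<rho> has_field_derivative
            of_real R * (blaschke_den R \<rho> \<rho>) / (blaschke_den R \<rho> w)\<^sup>2) (at w)"
  unfolding blaschke_def[abs_def] using blaschke_denom_nonzero[OF assms(1)]
  by (auto intro!: derivative_eq_intros simp: field_simps power2_eq_square)

text \<open>The first summand carries the pole at \<rho>; the second has its pole, for \<rho>
  \<noteq> 0, at the reflected point R^2 / cnj \<rho> outside the disc. Splitting off the value of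
  \<open>blaschke\<close> prepares the derivative of a product of powers.\<close>

lemma blaschke_log_deriv:
  assumes "norm \<rho> * norm w < R\<^sup>2" "R > 0" "w \<noteq> \<rho>"
  shows "of_real R * (blaschke_den R \<rho> \<rho>) / (blaschke_den R \<rho> w)\<^sup>2 =
           blaschke R \<rho> w * (1 / (w - \<rho>) + cnj \<rho> / (blaschke_den R \<rho> w))"
proof -
  define D where "D = blaschke_den R \<rho> w"
  have D: "D \<noteq> 0" using blaschke_denom_nonzero[OF assms(1)] by (simp add: D_def)
  have "w - \<rho> \<noteq> 0" using assms by simp
  have num: "blaschke_den R \<rho> \<rho> = D + cnj \<rho> * (w - \<rho>)" by (simp add: D_def algebra_simps)
  show ?thesis
    unfolding blaschke_def D_def [symmetric] num using D \<open>w - \<rho> \<noteq> 0\<close>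
    by (simp add: divide_simps power2_eq_square)
qed

lemma analytic_blaschke:
  assumes "norm \<rho> * norm w < R\<^sup>2"
  shows "blaschke R \<rho> analytic_on {w}"
  unfolding blaschke_def[abs_def] using blaschke_denom_nonzero[OF assms]
  by (intro analytic_intros) auto

lemma zorder_blaschke:
  assumes "norm \<rho> < R" "norm \<rho> * norm w < R\<^sup>2"
  shows "zorder (blaschke R \<rho>) w = (if w = \<rho> then 1 else 0)"
proof (cases "w = \<rho>")
  case True
  have R: "R > 0" using assms norm_ge_zero[of \<rho>] by linarith
  have "zorder (blaschke R \<rho>) \<rho> = 1"
  proof (rule zorder_zero_eqI')
    show "blaschke R \<rho> analytic_on {\<rho>}" using analytic_blaschke assms True by auto
    show "(deriv ^^ i) (blaschke R \<rho>) \<rho> = 0" if "i < nat 1" for i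
      using that by (simp add: blaschke_def)
    have "blaschke_den R \<rho> \<rho> \<noteq> 0" using blaschke_denom_nonzero assms True by auto
    then show "(deriv ^^ nat 1) (blaschke R \<rho>) \<rho> \<noteq> 0"
      using DERIV_imp_deriv[OF has_field_derivative_blaschke[of \<rho> \<rho> R]] assms True R by simp
  qed auto
  with True show ?thesis by simp
next
  case False
  have R: "R > 0" using assms norm_ge_zero[of \<rho>] by linarith
  then have "blaschke R \<rho> w \<noteq> 0" using blaschke_eq_0_iff assms False by blast
  then show ?thesis using zorder_eq_0I[OF analytic_blaschke[OF assms(2)]] False by simp
qed

text \<open>A nicely meromorphic function has the value 0 at its poles. Hence F w = 0 describes
  zeros and poles together, the sign of \<open>zorder F\<close> tells them apart, and
  \<open>F\<close> is analytic wherever it does not vanish.\<close>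

locale nonzero_meromorphic =
  fixes F :: "complex \<Rightarrow> complex"
  assumes mero: "F nicely_meromorphic_on UNIV" and nonzero: "\<exists>w. F w \<noteq> 0"
begin

lemma meromorphic: "F meromorphic_on A"
  using mero meromorphic_on_subset by (auto simp: nicely_meromorphic_on_def)

lemma sparse_zeros: "{w. F w = 0} sparse_in UNIV"
  using nicely_meromorphic_imp_constant_or_avoid[OF mero, of 0] nonzero
  by (auto simp: eventually_cosparse)

lemma eventually_nonzero: "\<forall>\<^sub>F w in at x. F w \<noteq> 0"
  using sparse_zeros by (simp add: eventually_cosparse_imp_eventually_at[OF eventually_cosparse[THEN iffD2]])

lemma finite_zeros: "bounded A \<Longrightarrow> finite (A \<inter> {w. F w = 0})"
proof -
  assume "bounded A"
  then obtain r where "\<And>x. x \<in> A \<Longrightarrow> norm x \<le> r" by (auto simp: bounded_iff)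
  then have "A \<subseteq> cball 0 r" by auto
  moreover have "finite (cball 0 r \<inter> {w. F w = 0})"
    using sparse_in_compact_finite[OF sparse_in_subset[OF sparse_zeros]] by auto
  ultimately show ?thesis by (meson finite_subset Int_mono order_refl)
qed

lemma analytic: "F w \<noteq> 0 \<Longrightarrow> F analytic_on {w}"
  using mero is_pole_zero_at_nicely_mero nicely_meromorphic_on_imp_analytic_at by blast

lemma zorder_eq_0: "F w \<noteq> 0 \<Longrightarrow> zorder F w = 0"
  using zorder_eq_0I analytic by blast

lemma closed_zeros: "closed {w. F w = 0}"
  using sparse_zeros by (rule sparse_in_UNIV_imp_closed)

text \<open>Division by the Blaschke powers removes all zeros and poles from the disc, so the
  quotient has a holomorphic logarithm there. The radius R' > R makes h continuous up to the circle
  |w| = R.\<close>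

lemma blaschke_factorization:
  assumes R: "R > 0" and sphere: "\<And>w. norm w = R \<Longrightarrow> F w \<noteq> 0"
  defines "S \<equiv> ball 0 R \<inter> {w. F w = 0}"
  obtains R' h where "R' > R" "h holomorphic_on ball 0 R'"
    "\<And>\<rho> w :: complex. \<rho> \<in> S \<Longrightarrow> w \<in> ball 0 R' \<Longrightarrow> norm \<rho> * norm w < R\<^sup>2"
    "\<And>w. w \<in> ball 0 R' \<Longrightarrow> F w = 0 \<longleftrightarrow> w \<in> S"
    "\<And>w. w \<in> ball 0 R' \<Longrightarrow> F w \<noteq> 0 \<Longrightarrow> F w = exp (h w) * (\<Prod>\<rho>\<in>S. blaschke R \<rho> w powi zorder F \<rho>)"
proof -
  have fin: "finite S" unfolding S_def by (rule finite_zeros) simp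
  \<comment> \<open>The obstructions to enlarging the disc: the moduli of zeros and poles outside
    it, and the moduli R^2 / |\<rho>| at which a Blaschke denominator vanishes. Capping at R + 1
    keeps \<open>N\<close> finite and nonempty; all its elements exceed R.\<close>
  define N where "N = insert (R + 1) (norm ` (cball 0 (R + 1) \<inter> {w. F w = 0} - ball 0 R) \<union> (\<lambda>\<rho>. R\<^sup>2 / norm \<rho>) ` (S - {0}))"
  have finN: "finite N" "N \<noteq> {}" unfolding N_def using fin finite_zeros[of "cball 0 (R + 1)"] by auto
  define R' where "R' = Min N"
  have R'le: "R' \<le> x" if "x \<in> N" for x using that finN by (simp add: R'_def)
  have R'R: "R' > R"
    unfolding R'_def
  proof (subst Min_gr_iff)
    show "\<forall>a\<in>N. R < a"
    proof
      fix a assume "a \<in> N"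
      then consider "a = R + 1" | w where "a = norm w" "F w = 0" "norm w \<ge> R" | \<rho> where "\<rho> \<in> S" "\<rho> \<noteq> 0" "a = R\<^sup>2 / norm \<rho>"
        by (auto simp: N_def)
      then show "R < a"
      proof cases
        case 2 then show ?thesis using sphere[of w] by fastforce
      next
        case 3
        then have "norm \<rho> < R" "norm \<rho> > 0" by (auto simp: S_def)
        then have "R * norm \<rho> < R * R" using R by simp
        then show ?thesis using 3 \<open>norm \<rho> > 0\<close> by (simp add: pos_less_divide_eq power2_eq_square)
      qed auto
    qed
  qed (use finN in auto)
  define V where "V = ball (0::complex) R'"
  have prod_less: "norm \<rho> * norm w < R\<^sup>2" if "\<rho> \<in> S" "w \<in> V" for \<rho> w
  proof (cases "\<rho> = 0")
    case False
    then have "R' \<le> R\<^sup>2 / norm \<rho>" using that by (intro R'le) (auto simp: N_def)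
    then have "norm w < R\<^sup>2 / norm \<rho>" using that by (auto simp: V_def)
    then show ?thesis using False by (simp add: field_simps)
  qed (use R in auto)
  have zero_iff: "F w = 0 \<longleftrightarrow> w \<in> S" if "w \<in> V" for w
  proof
    assume w: "F w = 0"
    show "w \<in> S"
    proof (rule ccontr)
      assume "w \<notin> S"
      then have "norm w \<ge> R" using w by (auto simp: S_def)
      moreover have "norm w \<le> R + 1" using that R'le[of "R + 1"] by (auto simp: V_def N_def)
      ultimately have "norm w \<in> N" using w by (auto simp: N_def)
      then have "R' \<le> norm w" by (rule R'le)
      with that show False by (auto simp: V_def)
    qed
  qed (auto simp: S_def)
  define Q where "Q = (\<lambda>w. \<Prod>\<rho>\<in>S. blaschke R \<rho> w powi zorder F \<rho>)"
  have Snorm: "norm \<rho> < R" if "\<rho> \<in> S" for \<rho> using that by (auto simp: S_def)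
  have b0: "blaschke R \<rho> w = 0 \<longleftrightarrow> w = \<rho>" if "\<rho> \<in> S" "w \<in> V" for \<rho> w
    using blaschke_eq_0_iff[OF prod_less[OF that] R] .
  have Qnz: "Q w \<noteq> 0" if "w \<in> V" "w \<notin> S" for w
    unfolding Q_def using that b0 fin by (subst prod_zero_iff) (auto simp: power_int_eq_0_iff)
  have "open V" by (simp add: V_def)
  have evS: "\<forall>\<^sub>F u in at w. u \<in> V \<and> u \<notin> S" if "w \<in> V" for w
  proof -
    have "\<forall>\<^sub>F u in at w. u \<in> V" using \<open>open V\<close> that by (rule eventually_at_in_open')
    moreover have "\<forall>\<^sub>F u in at w. u \<notin> S" using eventually_nonzero[of w] by eventually_elim (auto simp: S_def)
    ultimately show ?thesis by eventually_elim auto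
  qed
  have bm: "blaschke R \<rho> meromorphic_on {w}" if "\<rho> \<in> S" "w \<in> V" for \<rho> w
    using analytic_on_imp_meromorphic_on[OF analytic_blaschke[OF prod_less[OF that]]] .
  have Qm: "Q meromorphic_on {w}" if "w \<in> V" for w
    unfolding Q_def by (intro meromorphic_intros bm that)
  have Qan: "Q analytic_on {w}" if "w \<in> V" "w \<notin> S" for w
    unfolding Q_def using that b0 by (intro analytic_intros analytic_blaschke prod_less) auto
  have zQ: "zorder Q w = zorder F w" if w: "w \<in> V" for w
  proof -
    have "zorder Q w = (\<Sum>\<rho>\<in>S. zorder (\<lambda>u. blaschke R \<rho> u powi zorder F \<rho>) w)"
      unfolding Q_def
    proof (rule zorder_prod)
      show "\<forall>\<^sub>F z in at w. (\<Prod>\<rho>\<in>S. blaschke R \<rho> z powi zorder F \<rho>) \<noteq> 0"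
        using evS[OF w] by eventually_elim (use Qnz in \<open>auto simp: Q_def\<close>)
    qed (intro meromorphic_intros bm w)
    also have "\<dots> = (\<Sum>\<rho>\<in>S. zorder F \<rho> * (if w = \<rho> then 1 else 0))"
    proof (rule sum.cong[OF refl])
      fix \<rho> assume \<rho>: "\<rho> \<in> S"
      have "\<forall>\<^sub>F u in at w. blaschke R \<rho> u \<noteq> 0"
        using evS[OF w] by eventually_elim (use b0 \<rho> in auto)
      then have "\<exists>\<^sub>F u in at w. blaschke R \<rho> u \<noteq> 0" by (simp add: eventually_frequently)
      then show "zorder (\<lambda>u. blaschke R \<rho> u powi zorder F \<rho>) w = zorder F \<rho> * (if w = \<rho> then 1 else 0)"
        using zorder_power_int[OF bm[OF \<rho> w]] zorder_blaschke[OF Snorm[OF \<rho>] prod_less[OF \<rho> w]] by simp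
    qed
    also have "\<dots> = zorder F w"
      using zorder_eq_0[of w] zero_iff[OF w] fin by (cases "w \<in> S") (auto simp: if_distrib cong: if_cong)
    finally show ?thesis .
  qed
  define G where "G = (\<lambda>w. F w / Q w)"
  have Gm: "G meromorphic_on {w}" if "w \<in> V" for w
    unfolding G_def by (intro meromorphic_intros meromorphic Qm that)
  have Gev: "\<forall>\<^sub>F u in at w. G u \<noteq> 0" if "w \<in> V" for w
    using evS[OF that] eventually_nonzero[of w] by eventually_elim (use Qnz in \<open>auto simp: G_def\<close>)
  have zG: "zorder G w = 0" if w: "w \<in> V" for w
  proof -
    have "\<forall>\<^sub>F u in at w. Q u \<noteq> 0" using evS[OF w] by eventually_elim (use Qnz in auto)
    then have "zorder G w = zorder F w - zorder Q w"
      unfolding G_def using eventually_nonzero[of w]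
      by (intro zorder_divide meromorphic Qm w) (auto simp: eventually_frequently)
    with zQ[OF w] show ?thesis by simp
  qed
  \<comment> \<open>\<open>G\<close> has order 0 throughout \<open>V\<close>, so it has neither a
    pole nor an isolated zero there, and its removable singularities are filled with nonzero
    values.\<close>
  have g: "remove_sings G analytic_on {w}" "remove_sings G w \<noteq> 0" if w: "w \<in> V" for w
  proof -
    have iso: "isolated_singularity_at G w" and ness: "not_essential G w"
      using Gm[OF w] by (auto simp: meromorphic_at_iff)
    have np: "\<not> is_pole G w" using isolated_pole_imp_neg_zorder[OF iso] zG[OF w] by auto
    have nz: "\<not> isolated_zero G w" using zorder_isolated_zero_pos'[OF _ iso] zG[OF w] by auto
    obtain c where c: "G \<midarrow>w\<rightarrow> c" using ness np by (auto simp: not_essential_def)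
    show "remove_sings G analytic_on {w}" by (rule remove_sings_analytic_at[OF iso c])
    show "remove_sings G w \<noteq> 0"
      using nz np Gev[OF w] ness by (auto simp: remove_sings_eq_0_iff isolated_zero_def)
  qed
  have holg: "remove_sings G holomorphic_on V"
    using g(1) by (meson analytic_imp_holomorphic analytic_on_analytic_at)
  obtain h where h: "h holomorphic_on V" "\<And>x. x \<in> V \<Longrightarrow> exp (h x) = remove_sings G x"
    using holomorphic_logarithm_exists[of V "remove_sings G" 0] holg g(2) R R'R
    by (auto simp: V_def)
  show ?thesis
  proof (rule that[of R' h])
    fix w assume w: "w \<in> ball 0 R'" "F w \<noteq> 0"
    then have w': "w \<in> V" "w \<notin> S" using zero_iff by (auto simp: V_def)
    have "G analytic_on {w}" unfolding G_def
      using w w' Qnz by (intro analytic_intros analytic Qan) auto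
    then have "remove_sings G w = G w" by simp
    then show "F w = exp (h w) * (\<Prod>\<rho>\<in>S. blaschke R \<rho> w powi zorder F \<rho>)"
      using h(2)[OF w'(1)] Qnz[OF w'] by (simp add: G_def Q_def)
  qed (use R'R h prod_less zero_iff in \<open>auto simp: V_def\<close>)
qed

end

text \<open>The form b / (c - b u) is chosen because its derivative is its own square. It covers the
  reflected terms with b = cnj \<rho> and c = R^2, and -1 / (u - \<rho>) with b = -1 and c =
  -\<rho>.\<close>

lemma higher_deriv_fraction:
  fixes b c w :: complex
  assumes "c - b * w \<noteq> 0"
  shows "(deriv ^^ n) (\<lambda>u. b / (c - b * u)) w = fact n * (b / (c - b * w)) ^ Suc n"
  using assms
proof (induction n arbitrary: w)
  case (Suc n)
  have "open {u. c - b * u \<noteq> 0}" by (intro open_Collect_neq continuous_intros)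
  then have "\<forall>\<^sub>F u in nhds w. c - b * u \<noteq> 0" using Suc.prems by (auto dest!: eventually_nhds_in_open)
  then have "\<forall>\<^sub>F u in nhds w. (deriv ^^ n) (\<lambda>u. b / (c - b * u)) u = fact n * (b / (c - b * u)) ^ Suc n"
    by eventually_elim (rule Suc.IH)
  then have "(deriv ^^ Suc n) (\<lambda>u. b / (c - b * u)) w = deriv (\<lambda>u. fact n * (b / (c - b * u)) ^ Suc n) w"
    by (simp add: deriv_cong_ev)
  also have "\<dots> = fact (Suc n) * (b / (c - b * w)) ^ Suc (Suc n)"
  proof (rule DERIV_imp_deriv)
    have "((\<lambda>u. b / (c - b * u)) has_field_derivative (b / (c - b * w))\<^sup>2) (at w)"
      using Suc.prems by (auto intro!: derivative_eq_intros simp: power2_eq_square)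
    from DERIV_cmult[OF DERIV_power[OF this, of "Suc n"], of "fact n"]
    show "((\<lambda>u. fact n * (b / (c - b * u)) ^ Suc n) has_field_derivative
        fact (Suc n) * (b / (c - b * w)) ^ Suc (Suc n)) (at w)"
      by (rule DERIV_cong) (simp add: power2_eq_square algebra_simps)
  qed
  finally show ?case .
qed simp

lemma higher_deriv_sum:
  fixes f :: "'a \<Rightarrow> complex \<Rightarrow> complex"
  assumes "finite A" "open U" "w \<in> U" "\<And>i. i \<in> A \<Longrightarrow> f i holomorphic_on U"
  shows "(deriv ^^ n) (\<lambda>u. \<Sum>i\<in>A. f i u) w = (\<Sum>i\<in>A. (deriv ^^ n) (f i) w)"
  using assms(1,4)
proof (induction A rule: finite_induct)
  case (insert i A)
  have "(deriv ^^ n) (\<lambda>u. f i u + (\<Sum>i\<in>A. f i u)) w = (deriv ^^ n) (f i) w + (deriv ^^ n) (\<lambda>u. \<Sum>i\<in>A. f i u) w"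
    using insert.prems assms by (intro higher_deriv_add[of _ U] holomorphic_on_sum) auto
  then show ?case using insert by simp
qed simp

lemma has_field_derivative_prod_log:
  fixes f :: "'a \<Rightarrow> complex \<Rightarrow> complex"
  assumes "finite A" "\<And>i. i \<in> A \<Longrightarrow> (f i has_field_derivative f i w * d i) (at w)"
  shows "((\<lambda>u. \<Prod>i\<in>A. f i u) has_field_derivative (\<Prod>i\<in>A. f i w) * (\<Sum>i\<in>A. d i)) (at w)"
  using assms
proof (induction A rule: finite_induct)
  case (insert i A)
  have "((\<lambda>u. f i u * (\<Prod>i\<in>A. f i u)) has_field_derivative
     f i w * d i * (\<Prod>i\<in>A. f i w) + ((\<Prod>i\<in>A. f i w) * (\<Sum>i\<in>A. d i)) * f i w) (at w)"
    using insert by (intro DERIV_mult) auto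
  then show ?case using insert.hyps by (simp add: algebra_simps)
qed simp

context nonzero_meromorphic
begin

text \<open>The unintegrated counting functions of Nevanlinna theory for the open disc, with
  multiplicity: poles here, zeros in \<open>mass_pos\<close>.\<close>

definition mass_neg :: "real \<Rightarrow> real" where
  "mass_neg R = (\<Sum>\<rho>\<in>ball 0 R \<inter> {w. F w = 0}. max 0 (- real_of_int (zorder F \<rho>)))"

definition mass_pos :: "real \<Rightarrow> real" where
  "mass_pos R = (\<Sum>\<rho>\<in>ball 0 R \<inter> {w. F w = 0}. max 0 (real_of_int (zorder F \<rho>)))"

text \<open>Up to the factor 2 pi the proximity function of \<open>F\<close>, written as a gauge
  integral to match the circle formulas above.\<close>

definition circle_mass :: "real \<Rightarrow> real" where
  "circle_mass R = integral {0..2*pi} (\<lambda>t. max 0 (ln (norm (F (of_real R * cis t)))))"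

lemma mass_nonneg: "mass_neg R \<ge> 0" "mass_pos R \<ge> 0"
  by (auto simp: mass_neg_def mass_pos_def intro!: sum_nonneg)

lemma mass_mono: "r \<le> R \<Longrightarrow> mass_neg r \<le> mass_neg R" "r \<le> R \<Longrightarrow> mass_pos r \<le> mass_pos R"
  unfolding mass_neg_def mass_pos_def by (intro sum_mono2 finite_zeros; force)+

abbreviation (input) log_deriv_defect :: "nat \<Rightarrow> real \<Rightarrow> complex \<Rightarrow> complex" where
  "log_deriv_defect n R w \<equiv> (deriv ^^ n) (\<lambda>u. deriv F u / F u) w - (-1) ^ n * fact n * (\<Sum>\<rho>\<in>ball 0 R \<inter> {w. F w = 0}. of_int (zorder F \<rho>) / (w - \<rho>) ^ Suc n)"

text \<open>In its use E dominates the mass of |Re h| on the circle and m the number of zeros and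
  poles in the disc: the first summand bounds the derivative of h, the second the reflected terms of
  the Blaschke factors.\<close>

abbreviation (input) defect_bound :: "nat \<Rightarrow> real \<Rightarrow> complex \<Rightarrow> real \<Rightarrow> real \<Rightarrow> real" where
  "defect_bound n R w E m \<equiv>
     fact (Suc n) / pi * R / (R - norm w) ^ Suc (Suc n) * E + fact n * m / (R - norm w) ^ Suc n"

text \<open>
  The comparison point \<open>w0\<close> is not the origin, so that zeros and poles at \<open>0\<close> need no special
  treatment.
\<close>

lemma Jensen_estimate:
  assumes R: "R > 0" and sphere: "\<And>w. norm w = R \<Longrightarrow> F w \<noteq> 0"
    and w0: "F w0 \<noteq> 0" "norm w0 \<le> R / 8" and d: "d > 0" "d \<le> 2 * R"
    and dist: "\<And>\<rho>. F \<rho> = 0 \<Longrightarrow> norm (w0 - \<rho>) \<ge> d"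
  defines "E \<equiv> 5 * circle_mass R + 4 * pi * (\<bar>ln (norm (F w0))\<bar> + mass_neg R * ln (2 * R / d))"
  shows "mass_pos (R / 4) * ln 2 \<le> E"
    and "w \<in> ball 0 R \<Longrightarrow> F w \<noteq> 0 \<Longrightarrow>
      norm (log_deriv_defect n R w)
      \<le> defect_bound n R w E (mass_neg R + mass_pos R)"
proof -
  define S where "S = ball 0 R \<inter> {w. F w = 0}"
  have fin: "finite S" unfolding S_def by (rule finite_zeros) simp
  obtain R' h where R'R: "R' > R" and h: "h holomorphic_on ball 0 R'"
    and prod_less: "\<And>\<rho> w :: complex. \<rho> \<in> S \<Longrightarrow> w \<in> ball 0 R' \<Longrightarrow> norm \<rho> * norm w < R\<^sup>2"
    and zero_iff: "\<And>w. w \<in> ball 0 R' \<Longrightarrow> F w = 0 \<longleftrightarrow> w \<in> S"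
    and F: "\<And>w. w \<in> ball 0 R' \<Longrightarrow> F w \<noteq> 0 \<Longrightarrow> F w = exp (h w) * (\<Prod>\<rho>\<in>S. blaschke R \<rho> w powi zorder F \<rho>)"
    by (rule blaschke_factorization[OF R, folded S_def]) (erule sphere, rule that)
  have hc: "continuous_on (cball 0 R) h"
    using R'R by (intro holomorphic_on_imp_continuous_on holomorphic_on_subset[OF h]) auto
  have hb: "h holomorphic_on ball 0 R"
    using R'R by (intro holomorphic_on_subset[OF h]) auto
  have Snorm: "norm \<rho> < R" if "\<rho> \<in> S" for \<rho> using that by (auto simp: S_def)
  have b0: "blaschke R \<rho> w = 0 \<longleftrightarrow> w = \<rho>" if "\<rho> \<in> S" "w \<in> ball 0 R'" for \<rho> w
    using blaschke_eq_0_iff[OF prod_less[OF that] R] .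
  have lnF: "ln (norm (F w)) = Re (h w) + (\<Sum>\<rho>\<in>S. of_int (zorder F \<rho>) * ln (norm (blaschke R \<rho> w)))"
    if w: "w \<in> ball 0 R'" "F w \<noteq> 0" for w
  proof -
    have bnz: "norm (blaschke R \<rho> w) > 0" if "\<rho> \<in> S" for \<rho>
      using b0[OF that w(1)] w that by (auto simp: S_def)
    have "ln (norm (F w)) = ln (exp (Re (h w)) * (\<Prod>\<rho>\<in>S. norm (blaschke R \<rho> w) powi zorder F \<rho>))"
      by (subst F[OF w]) (simp add: norm_mult prod_norm [symmetric] norm_power_int)
    also have "\<dots> = Re (h w) + ln (\<Prod>\<rho>\<in>S. norm (blaschke R \<rho> w) powi zorder F \<rho>)"
      using bnz fin by (subst ln_mult) (auto intro!: prod_pos simp: zero_less_power_int)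
    also have "ln (\<Prod>\<rho>\<in>S. norm (blaschke R \<rho> w) powi zorder F \<rho>) = (\<Sum>\<rho>\<in>S. ln (norm (blaschke R \<rho> w) powi zorder F \<rho>))"
      using bnz fin by (intro ln_prod) (auto simp: zero_less_power_int)
    also have "\<dots> = (\<Sum>\<rho>\<in>S. of_int (zorder F \<rho>) * ln (norm (blaschke R \<rho> w)))"
      using bnz by (intro sum.cong refl) (auto simp: powr_real_of_int' [symmetric] ln_powr)
    finally show ?thesis .
  qed
  have circ: "Re (h (of_real R * cis t)) = ln (norm (F (of_real R * cis t)))" for t
  proof -
    have n: "norm (of_real R * cis t) = R" using R by (simp add: norm_mult)
    have "ln (norm (F (of_real R * cis t))) = Re (h (of_real R * cis t)) + (\<Sum>\<rho>\<in>S. of_int (zorder F \<rho>) * ln (norm (blaschke R \<rho> (of_real R * cis t))))"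
      using R'R sphere[OF n] n by (intro lnF) auto
    also have "(\<Sum>\<rho>\<in>S. of_int (zorder F \<rho>) * ln (norm (blaschke R \<rho> (of_real R * cis t)))) = 0"
      using norm_blaschke_circle[OF Snorm n] by simp
    finally show ?thesis by simp
  qed
  define H where "H = (\<lambda>t. Re (h (of_real R * cis t)))"
  have Hc: "continuous_on {0..2*pi} H" unfolding H_def
    by (intro continuous_intros continuous_on_circle hc R)
  have int: "(\<lambda>t. max 0 (H t)) integrable_on {0..2*pi}" "(\<lambda>t. max 0 (- H t)) integrable_on {0..2*pi}"
    by (intro integrable_continuous_real continuous_intros Hc)+
  have M: "circle_mass R = integral {0..2*pi} (\<lambda>t. max 0 (H t))"
    unfolding circle_mass_def H_def circ ..
  have Poi: "2 * pi * Re (h w0) \<le> 2 * circle_mass R - integral {0..2*pi} (\<lambda>t. max 0 (- H t)) / 2"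
    using Re_Poisson_bound[OF hc hb R, of w0] w0 R unfolding M H_def by simp
  have Mnn: "circle_mass R \<ge> 0" unfolding M by (intro integral_nonneg int) auto
  have Nnn: "integral {0..2*pi} (\<lambda>t. max 0 (- H t)) \<ge> 0" by (intro integral_nonneg int) auto
  define Pm where "Pm = mass_neg R * ln (2 * R / d)"
  have lnd: "ln (2 * R / d) \<ge> 0" using d R by simp
  have Pnn: "Pm \<ge> 0" unfolding Pm_def using mass_nonneg lnd by simp
  have w0': "w0 \<in> ball 0 R'" "norm w0 < R" using w0 R R'R by auto
  have lnb: "ln (norm (blaschke R \<rho> w0)) \<le> 0" "ln (norm (blaschke R \<rho> w0)) \<ge> - ln (2 * R / d)" if "\<rho> \<in> S" for \<rho>
  proof -
    have 1: "norm (blaschke R \<rho> w0) \<le> 1" using norm_blaschke_le_1[OF Snorm[OF that]] w0' by auto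
    have 2: "d / (2 * R) \<le> norm (blaschke R \<rho> w0)"
      using norm_blaschke_ge[OF Snorm[OF that] w0'(2) _ d(1)] dist that by (auto simp: S_def)
    have 3: "d / (2 * R) > 0" using d R by simp
    have 4: "norm (blaschke R \<rho> w0) > 0" using 2 3 by linarith
    show "ln (norm (blaschke R \<rho> w0)) \<le> 0" using 1 4 by (subst ln_le_zero_iff)
    have "- ln (2 * R / d) = ln (d / (2 * R))" using d R by (simp add: ln_div)
    also have "\<dots> \<le> ln (norm (blaschke R \<rho> w0))" using 2 3 4 by (subst ln_le_cancel_iff)
    finally show "ln (norm (blaschke R \<rho> w0)) \<ge> - ln (2 * R / d)" .
  qed
  \<comment> \<open>The logarithms of the Blaschke factors at \<open>w0\<close> are nonpositive, so
    only poles can make the sum positive, by at most ln (2 R / d) per order.\<close>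
  have lower: "- Re (h w0) \<le> \<bar>ln (norm (F w0))\<bar> + Pm"
  proof -
    have "(\<Sum>\<rho>\<in>S. of_int (zorder F \<rho>) * ln (norm (blaschke R \<rho> w0))) \<le> (\<Sum>\<rho>\<in>S. max 0 (- real_of_int (zorder F \<rho>)) * ln (2 * R / d))"
    proof (rule sum_mono)
      fix \<rho> assume "\<rho> \<in> S"
      note lnb = lnb[OF this]
      show "of_int (zorder F \<rho>) * ln (norm (blaschke R \<rho> w0)) \<le> max 0 (- real_of_int (zorder F \<rho>)) * ln (2 * R / d)"
      proof (cases "zorder F \<rho> \<ge> 0")
        case True
        then show ?thesis using lnb by (simp add: mult_nonneg_nonpos)
      next
        case False
        then show ?thesis using mult_left_mono[OF lnb(2), of "- real_of_int (zorder F \<rho>)"] by simp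
      qed
    qed
    also have "\<dots> = Pm" by (simp add: Pm_def mass_neg_def S_def sum_distrib_right)
    finally show ?thesis using lnF[OF w0'(1) w0(1)] by linarith
  qed
  \<comment> \<open>The same comparison, now retaining the zeros of modulus below R/4, which lower
    the sum by at least ln 2 per order.\<close>
  have upper: "mass_pos (R / 4) * ln 2 \<le> Re (h w0) + \<bar>ln (norm (F w0))\<bar> + Pm"
  proof -
    have "(\<Sum>\<rho>\<in>S. of_int (zorder F \<rho>) * ln (norm (blaschke R \<rho> w0))) \<le>
       (\<Sum>\<rho>\<in>S. max 0 (- real_of_int (zorder F \<rho>)) * ln (2 * R / d) - (if norm \<rho> < R / 4 then max 0 (real_of_int (zorder F \<rho>)) * ln 2 else 0))"
    proof (rule sum_mono)
      fix \<rho> assume \<rho>: "\<rho> \<in> S"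
      note lnb = lnb[OF this]
      show "of_int (zorder F \<rho>) * ln (norm (blaschke R \<rho> w0)) \<le> max 0 (- real_of_int (zorder F \<rho>)) * ln (2 * R / d) -
         (if norm \<rho> < R / 4 then max 0 (real_of_int (zorder F \<rho>)) * ln 2 else 0)"
      proof (cases "zorder F \<rho> \<ge> 0")
        case True
        have "ln (norm (blaschke R \<rho> w0)) \<le> - ln 2" if "norm \<rho> < R / 4"
        proof -
          have "norm (blaschke R \<rho> w0) \<le> 1 / 2" using that w0 R by (intro norm_blaschke_le_half) auto
          moreover have "norm (blaschke R \<rho> w0) > 0" using b0[OF \<rho> w0'(1)] w0 \<rho> by (auto simp: S_def)
          ultimately have "ln (norm (blaschke R \<rho> w0)) \<le> ln (1 / 2)" by simp
          then show ?thesis by (simp add: ln_div)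
        qed
        then have "of_int (zorder F \<rho>) * ln (norm (blaschke R \<rho> w0)) \<le> of_int (zorder F \<rho>) * (if norm \<rho> < R / 4 then - ln 2 else 0)"
          using True lnb by (intro mult_left_mono) auto
        then show ?thesis using True by (auto split: if_splits)
      next
        case False
        then show ?thesis using mult_left_mono[OF lnb(2), of "- real_of_int (zorder F \<rho>)"] by simp
      qed
    qed
    also have "\<dots> = Pm - mass_pos (R / 4) * ln 2"
    proof -
      have "(\<Sum>\<rho>\<in>S. if norm \<rho> < R / 4 then max 0 (real_of_int (zorder F \<rho>)) * ln 2 else 0) = mass_pos (R / 4) * ln 2"
        unfolding mass_pos_def sum_distrib_right
        using R by (intro sum.mono_neutral_cong_right fin) (auto simp: S_def)
      then show ?thesis by (simp add: sum_subtractf Pm_def mass_neg_def S_def sum_distrib_right)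
    qed
    finally show ?thesis using lnF[OF w0'(1) w0(1)] by linarith
  qed
  have E: "E = 5 * circle_mass R + 4 * pi * (\<bar>ln (norm (F w0))\<bar> + Pm)" by (simp add: E_def Pm_def)
  have pi1: "pi \<ge> 1" using pi_gt3 by simp
  show "mass_pos (R / 4) * ln 2 \<le> E"
  proof -
    have "pi * Re (h w0) \<le> circle_mass R" using Poi Nnn by linarith
    have "Re (h w0) \<le> circle_mass R"
    proof (cases "Re (h w0) \<ge> 0")
      case True
      then have "1 * Re (h w0) \<le> pi * Re (h w0)" using pi1 by (intro mult_right_mono) auto
      then show ?thesis using \<open>pi * Re (h w0) \<le> circle_mass R\<close> by simp
    qed (use Mnn in auto)
    moreover define X where "X = \<bar>ln (norm (F w0))\<bar> + Pm"
    moreover have "1 * X \<le> (4 * pi) * X"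
      using pi1 Pnn unfolding X_def by (intro mult_right_mono) auto
    moreover have "mass_pos (R / 4) * ln 2 \<le> Re (h w0) + X" using upper by (simp add: X_def)
    ultimately show ?thesis using Mnn unfolding E X_def [symmetric] by linarith
  qed
  \<comment> \<open>Origin of the constants in \<open>E\<close>: Poisson's inequality bounds the
    negative mass by 4 \<open>circle_mass R\<close> - 4 pi Re (h w0), and adding the positive mass
    turns 4 into 5.\<close>
  have absH: "integral {0..2*pi} (\<lambda>t. \<bar>H t\<bar>) \<le> E"
  proof -
    have "integral {0..2*pi} (\<lambda>t. \<bar>H t\<bar>) = integral {0..2*pi} (\<lambda>t. max 0 (H t) + max 0 (- H t))"
      by (intro integral_cong) auto
    also have "\<dots> = circle_mass R + integral {0..2*pi} (\<lambda>t. max 0 (- H t))"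
      unfolding M by (intro integral_add int)
    also have "integral {0..2*pi} (\<lambda>t. max 0 (- H t)) \<le> 4 * circle_mass R + 4 * pi * (- Re (h w0))"
      using Poi by simp
    also have "4 * pi * (- Re (h w0)) \<le> 4 * pi * (\<bar>ln (norm (F w0))\<bar> + Pm)"
      using lower by (intro mult_left_mono) auto
    finally show ?thesis unfolding E by simp
  qed
  assume w: "w \<in> ball 0 R" "F w \<noteq> 0"
  define U where "U = ball 0 R' - S"
  have U: "open U" "w \<in> U" using w fin R'R by (auto simp: U_def S_def intro!: open_Diff finite_imp_closed)
  have Unz: "F u \<noteq> 0" if "u \<in> U" for u using that zero_iff by (auto simp: U_def)
  \<comment> \<open>Logarithmic derivative of a Blaschke power in the shape required by
    \<open>higher_deriv_fraction\<close>; the double negation encodes 1 / (u - \<rho>).\<close>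
  define lam where "lam = (\<lambda>\<rho> u. of_int (zorder F \<rho>) * (cnj \<rho> / (blaschke_den R \<rho> u) - (-1) / (- \<rho> - (-1) * u)))"
  have logd: "deriv F u / F u = deriv h u + (\<Sum>\<rho>\<in>S. lam \<rho> u)" if u: "u \<in> U" for u
  proof -
    have uR: "u \<in> ball 0 R'" using u by (auto simp: U_def)
    define Q where "Q = (\<lambda>u. \<Prod>\<rho>\<in>S. blaschke R \<rho> u powi zorder F \<rho>)"
    have Qd: "(Q has_field_derivative Q u * (\<Sum>\<rho>\<in>S. lam \<rho> u)) (at u)"
      unfolding Q_def
    proof (rule has_field_derivative_prod_log[OF fin])
      fix \<rho> assume \<rho>: "\<rho> \<in> S"
      have "u \<noteq> \<rho>" using u \<rho> by (auto simp: U_def)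
      have bn: "blaschke R \<rho> u \<noteq> 0" using b0[OF \<rho> uR] \<open>u \<noteq> \<rho>\<close> by simp
      have "(blaschke R \<rho> has_field_derivative blaschke R \<rho> u * (1 / (u - \<rho>) + cnj \<rho> / (blaschke_den R \<rho> u))) (at u)"
        using has_field_derivative_blaschke[OF prod_less[OF \<rho> uR] R] unfolding blaschke_log_deriv[OF prod_less[OF \<rho> uR] R \<open>u \<noteq> \<rho>\<close>] .
      from DERIV_power_int[OF this disjI2[OF bn], of "zorder F \<rho>"]
      show "((\<lambda>u. blaschke R \<rho> u powi zorder F \<rho>) has_field_derivative blaschke R \<rho> u powi zorder F \<rho> * lam \<rho> u) (at u)"
      proof (rule DERIV_cong)
        have bb: "blaschke R \<rho> u powi (zorder F \<rho> - 1) * blaschke R \<rho> u = blaschke R \<rho> u powi zorder F \<rho>"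
          using bn by (simp add: power_int_diff)
        have ll: "lam \<rho> u = of_int (zorder F \<rho>) * (1 / (u - \<rho>) + cnj \<rho> / (blaschke_den R \<rho> u))"
          unfolding lam_def by (simp add: minus_divide_left [symmetric])
        show "of_int (zorder F \<rho>) * blaschke R \<rho> u powi (zorder F \<rho> - 1) *
            (blaschke R \<rho> u * (1 / (u - \<rho>) + cnj \<rho> / (blaschke_den R \<rho> u))) = blaschke R \<rho> u powi zorder F \<rho> * lam \<rho> u"
          unfolding ll bb [symmetric] by (simp only: mult_ac)
      qed
    qed
    have ed: "((\<lambda>u. exp (h u)) has_field_derivative exp (h u) * deriv h u) (at u)"
      using holomorphic_derivI[OF h open_ball uR] by (auto intro!: derivative_eq_intros)
    have D: "((\<lambda>u. exp (h u) * Q u) has_field_derivative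
        exp (h u) * Q u * (deriv h u + (\<Sum>\<rho>\<in>S. lam \<rho> u))) (at u)"
      by (rule DERIV_cong[OF DERIV_mult[OF ed Qd]]) (simp add: algebra_simps)
    have "(F has_field_derivative exp (h u) * Q u * (deriv h u + (\<Sum>\<rho>\<in>S. lam \<rho> u))) (at u)"
      using F Unz by (intro has_field_derivative_transform_within_open[OF D U(1) u]) (auto simp: Q_def U_def)
    then have "deriv F u = exp (h u) * Q u * (deriv h u + (\<Sum>\<rho>\<in>S. lam \<rho> u))" by (rule DERIV_imp_deriv)
    moreover have "F u = exp (h u) * Q u" using F uR Unz[OF u] by (simp add: Q_def)
    ultimately show ?thesis using Unz[OF u] by simp
  qed
  have denom: "blaschke_den R \<rho> u \<noteq> 0" "- \<rho> - (-1) * u \<noteq> 0" if "\<rho> \<in> S" "u \<in> U" for \<rho> u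
    using blaschke_denom_nonzero[OF prod_less, of \<rho> u] that by (auto simp: U_def)
  have hol1: "(\<lambda>u. cnj \<rho> / (blaschke_den R \<rho> u)) holomorphic_on U" "(\<lambda>u. (-1) / (- \<rho> - (-1) * u)) holomorphic_on U" if "\<rho> \<in> S" for \<rho>
    using denom[OF that] by (auto intro!: holomorphic_intros)
  have lamh: "lam \<rho> holomorphic_on U" if "\<rho> \<in> S" for \<rho>
    unfolding lam_def by (intro holomorphic_on_mult holomorphic_on_diff hol1 that holomorphic_on_const)
  have hU: "deriv h holomorphic_on U"
    by (intro holomorphic_on_subset[OF holomorphic_deriv[OF h]]) (auto simp: U_def)
  have "(deriv ^^ n) (\<lambda>u. deriv F u / F u) w = (deriv ^^ n) (\<lambda>u. deriv h u + (\<Sum>\<rho>\<in>S. lam \<rho> u)) w"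
    using eventually_nhds_in_open[OF U] by (intro higher_deriv_cong_ev refl) (auto elim!: eventually_mono simp: logd)
  also have "\<dots> = (deriv ^^ n) (deriv h) w + (\<Sum>\<rho>\<in>S. (deriv ^^ n) (lam \<rho>) w)"
    using U lamh fin hU
    by (subst higher_deriv_add[of _ U]) (auto intro!: holomorphic_on_sum higher_deriv_sum[of _ U])
  also have "(deriv ^^ n) (deriv h) w = (deriv ^^ Suc n) h w"
    by (simp add: funpow_Suc_right del: funpow.simps)
  also have "(\<Sum>\<rho>\<in>S. (deriv ^^ n) (lam \<rho>) w) =
      (\<Sum>\<rho>\<in>S. (-1) ^ n * fact n * (of_int (zorder F \<rho>) / (w - \<rho>) ^ Suc n) + of_int (zorder F \<rho>) * (fact n * (cnj \<rho> / (blaschke_den R \<rho> w)) ^ Suc n))"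
  proof (rule sum.cong[OF refl])
    fix \<rho> assume \<rho>: "\<rho> \<in> S"
    have "(deriv ^^ n) (lam \<rho>) w = of_int (zorder F \<rho>) * (deriv ^^ n) (\<lambda>u. cnj \<rho> / (blaschke_den R \<rho> u) - (-1) / (- \<rho> - (-1) * u)) w"
      unfolding lam_def by (rule higher_deriv_cmult[of _ U]) (intro holomorphic_on_diff hol1 \<rho> U)+
    also have "(deriv ^^ n) (\<lambda>u. cnj \<rho> / (blaschke_den R \<rho> u) - (-1) / (- \<rho> - (-1) * u)) w =
        fact n * (cnj \<rho> / (blaschke_den R \<rho> w)) ^ Suc n - fact n * ((-1) / (- \<rho> - (-1) * w)) ^ Suc n"
      unfolding higher_deriv_diff[OF hol1(1)[OF \<rho>] hol1(2)[OF \<rho>] U]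
        higher_deriv_fraction[OF denom(1)[OF \<rho> U(2)]] higher_deriv_fraction[OF denom(2)[OF \<rho> U(2)]] ..
    also have "((-1) / (- \<rho> - (-1) * w)) ^ Suc n = - ((-1) ^ n / (w - \<rho>) ^ Suc n)"
      using power_divide[of "-1" "w - \<rho>" "Suc n"] by simp
    finally show "(deriv ^^ n) (lam \<rho>) w = (-1) ^ n * fact n * (of_int (zorder F \<rho>) / (w - \<rho>) ^ Suc n) + of_int (zorder F \<rho>) * (fact n * (cnj \<rho> / (blaschke_den R \<rho> w)) ^ Suc n)"
      by (simp add: algebra_simps)
  qed
  finally have eq0: "(deriv ^^ n) (\<lambda>u. deriv F u / F u) w = (deriv ^^ Suc n) h w +
      ((-1) ^ n * fact n * (\<Sum>\<rho>\<in>S. of_int (zorder F \<rho>) / (w - \<rho>) ^ Suc n) +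
       (\<Sum>\<rho>\<in>S. of_int (zorder F \<rho>) * (fact n * (cnj \<rho> / (blaschke_den R \<rho> w)) ^ Suc n)))"
    by (simp only: sum.distrib sum_distrib_left)
  have cancel: "a + (b + c) - b = a + c" for a b c :: complex by simp
  have eq: "(deriv ^^ n) (\<lambda>u. deriv F u / F u) w - (-1) ^ n * fact n * (\<Sum>\<rho>\<in>S. of_int (zorder F \<rho>) / (w - \<rho>) ^ Suc n) =
      (deriv ^^ Suc n) h w + (\<Sum>\<rho>\<in>S. of_int (zorder F \<rho>) * (fact n * (cnj \<rho> / (blaschke_den R \<rho> w)) ^ Suc n))"
    unfolding eq0 by (rule cancel)
  have Rw: "R - norm w > 0" using w by auto
  have 1: "norm ((deriv ^^ Suc n) h w) \<le> fact (Suc n) / pi * R / (R - norm w) ^ (Suc (Suc n)) * E"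
  proof -
    have "norm ((deriv ^^ Suc n) h w) \<le> fact (Suc n) / pi * R / (R - norm w) ^ Suc (Suc n) * integral {0..2*pi} (\<lambda>t. \<bar>H t\<bar>)"
      using higher_deriv_bound_Re[OF hc hb R, of w "Suc n"] w unfolding H_def by simp
    also have "\<dots> \<le> fact (Suc n) / pi * R / (R - norm w) ^ Suc (Suc n) * E"
      using absH R Rw by (intro mult_left_mono) auto
    finally show ?thesis .
  qed
  have 2: "norm (\<Sum>\<rho>\<in>S. of_int (zorder F \<rho>) * (fact n * (cnj \<rho> / (blaschke_den R \<rho> w)) ^ Suc n)) \<le>
      fact n * (mass_neg R + mass_pos R) / (R - norm w) ^ Suc n"
  proof -
    have "norm (of_int (zorder F \<rho>) * (fact n * (cnj \<rho> / (blaschke_den R \<rho> w)) ^ Suc n)) \<le>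
        (max 0 (- real_of_int (zorder F \<rho>)) + max 0 (real_of_int (zorder F \<rho>))) * (fact n / (R - norm w) ^ Suc n)"
      if \<rho>: "\<rho> \<in> S" for \<rho>
    proof -
      \<comment> \<open>This lower bound is independent of \<rho>, so the sum of the reflected terms
        costs only the total number of zeros and poles.\<close>
      have "R * (R - norm w) \<le> norm (of_real (R\<^sup>2) :: complex) - norm (cnj \<rho> * w)"
        using Snorm[OF \<rho>] mult_right_mono[of "norm \<rho>" R "norm w"] by (simp add: norm_mult norm_power power2_eq_square algebra_simps)
      also have "\<dots> \<le> norm (blaschke_den R \<rho> w)" by (rule norm_triangle_ineq2)
      finally have ge: "R * (R - norm w) \<le> norm (blaschke_den R \<rho> w)" .
      have "norm (cnj \<rho> / (blaschke_den R \<rho> w)) \<le> R / (R * (R - norm w))"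
        unfolding norm_divide using ge Rw R Snorm[OF \<rho>] by (intro frac_le) auto
      also have "\<dots> = 1 / (R - norm w)" using R by simp
      finally have "norm (cnj \<rho> / (blaschke_den R \<rho> w)) ^ Suc n \<le> (1 / (R - norm w)) ^ Suc n"
        by (intro power_mono) auto
      then have "fact n * norm (cnj \<rho> / (blaschke_den R \<rho> w)) ^ Suc n \<le> fact n * (1 / (R - norm w)) ^ Suc n"
        by (rule mult_left_mono) simp
      also have "\<dots> = fact n / (R - norm w) ^ Suc n" by (simp add: power_one_over divide_inverse power_inverse)
      finally have "fact n * norm (cnj \<rho> / (blaschke_den R \<rho> w)) ^ Suc n \<le> fact n / (R - norm w) ^ Suc n" .
      moreover have "\<bar>real_of_int (zorder F \<rho>)\<bar> = max 0 (- real_of_int (zorder F \<rho>)) + max 0 (real_of_int (zorder F \<rho>))" by auto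
      ultimately show ?thesis
        unfolding norm_mult norm_power norm_of_int norm_fact by (intro mult_mono) (auto simp del: power_Suc)
    qed
    then have "norm (\<Sum>\<rho>\<in>S. of_int (zorder F \<rho>) * (fact n * (cnj \<rho> / (blaschke_den R \<rho> w)) ^ Suc n)) \<le>
      (\<Sum>\<rho>\<in>S. (max 0 (- real_of_int (zorder F \<rho>)) + max 0 (real_of_int (zorder F \<rho>))) * (fact n / (R - norm w) ^ Suc n))"
      by (rule sum_norm_le)
    also have "\<dots> = (mass_neg R + mass_pos R) * (fact n / (R - norm w) ^ Suc n)"
      unfolding mass_neg_def mass_pos_def S_def [symmetric] by (simp only: sum_distrib_right [symmetric] sum.distrib)
    finally show ?thesis by (simp add: mult.commute)
  qed
  show "norm (log_deriv_defect n R w)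
      \<le> defect_bound n R w E (mass_neg R + mass_pos R)"
    unfolding S_def [symmetric] eq using 1 2 by (intro norm_triangle_mono)
qed

end

section \<open>Growth of the zeros and the logarithmic derivative\<close>

definition sphere_free :: "complex set \<Rightarrow> real \<Rightarrow> bool" where
  "sphere_free J R \<longleftrightarrow> (\<forall>w. norm w = R \<longrightarrow> w \<notin> J)"

lemma sphere_free_exists:
  assumes "a < b" "countable J"
  obtains R where "a < R" "R < b" "sphere_free J R"
proof -
  have "countable (norm ` J)" using assms by simp
  then obtain R where "a < R" "R < b" "R \<notin> norm ` J"
    using real_interval_avoid_countable_set[OF assms(1)] by (metis greaterThanLessThan_iff)
  then show ?thesis using that by (auto simp: sphere_free_def)
qed

context nonzero_meromorphic
begin

lemma countable_zeros: "countable {w. F w = 0}"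
  using sparse_imp_countable[OF open_UNIV sparse_zeros] by simp

lemma zeros_dist:
  assumes "F w0 \<noteq> 0"
  obtains d where "d > 0" "d \<le> 1" "\<And>\<rho>. F \<rho> = 0 \<Longrightarrow> norm (w0 - \<rho>) \<ge> d"
proof -
  have "open (- {w. F w = 0})" using closed_zeros by auto
  moreover have "w0 \<in> - {w. F w = 0}" using assms by simp
  ultimately obtain e where e: "e > 0" "ball w0 e \<subseteq> - {w. F w = 0}"
    by (rule openE)
  have "norm (w0 - \<rho>) \<ge> min e 1" if "F \<rho> = 0" for \<rho>
  proof -
    have "\<rho> \<notin> ball w0 e" using e that by auto
    then show ?thesis by (auto simp: dist_norm)
  qed
  then show ?thesis using \<open>e > 0\<close> by (intro that[of "min e 1"]) auto
qed

end

text \<open>\<open>J\<close> may exceed the zero set, in order to leave out circles on which the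
  given function and its normalization \<open>F\<close> differ. The circle bound is therefore asked
  only for radii that are free of \<open>J\<close>, the bound for the poles at every large
  radius.\<close>

locale growth_meromorphic = nonzero_meromorphic +
  fixes \<kappa> :: real and J :: "complex set"
  assumes \<kappa>: "\<kappa> \<ge> 0" and J: "countable J" "\<And>w. F w = 0 \<Longrightarrow> w \<in> J"
    and growth: "\<And>\<alpha>. \<alpha> > \<kappa> \<Longrightarrow> \<exists>C R0. \<forall>R\<ge>R0. (sphere_free J R \<longrightarrow> circle_mass R \<le> C * R powr \<alpha>) \<and> mass_neg R \<le> C * R powr \<alpha>"
begin

text \<open>The hypothesis controls the poles and the positive part of log |F|.
  \<open>Jensen_estimate\<close> at a fixed \<open>w0\<close> carries this over to the zeros and to
  the defect, at the price of a logarithm of R.\<close>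

lemma growth_estimate:
  assumes "\<alpha> > \<kappa>"
  obtains C R1 where "C > 0" "R1 \<ge> 1"
    "\<And>R. R \<ge> R1 \<Longrightarrow> mass_neg R + mass_pos R \<le> C * R powr \<alpha>"
    "\<And>R w n. R \<ge> R1 \<Longrightarrow> sphere_free J R \<Longrightarrow> w \<in> ball 0 R \<Longrightarrow> F w \<noteq> 0 \<Longrightarrow>
      norm (log_deriv_defect n R w)
      \<le> defect_bound n R w (C * R powr \<alpha>) (C * R powr \<alpha>)"
proof -
  obtain w0 where w0: "F w0 \<noteq> 0" using nonzero by auto
  obtain d where d: "d > 0" "d \<le> 1" "\<And>\<rho>. F \<rho> = 0 \<Longrightarrow> norm (w0 - \<rho>) \<ge> d"
    using zeros_dist[OF w0] by metis
  \<comment> \<open>An exponent strictly between \<kappa> and \<alpha> leaves room for the power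
    R^\<eta> that absorbs ln (2 R / d).\<close>
  define \<beta> where "\<beta> = (\<kappa> + \<alpha>) / 2"
  have \<beta>: "\<beta> > \<kappa>" "\<beta> < \<alpha>" "\<alpha> > 0" "\<beta> > 0" using assms \<kappa> by (auto simp: \<beta>_def)
  define \<eta> where "\<eta> = \<alpha> - \<beta>"
  have \<eta>: "\<eta> > 0" using \<beta> by (simp add: \<eta>_def)
  obtain C R0 where C: "\<And>R. R \<ge> R0 \<Longrightarrow> sphere_free J R \<Longrightarrow> circle_mass R \<le> C * R powr \<beta>"
    "\<And>R. R \<ge> R0 \<Longrightarrow> mass_neg R \<le> C * R powr \<beta>"
    using growth[OF \<beta>(1)] by metis
  define C0 where "C0 = max C 0"
  define A where "A = \<bar>ln (norm (F w0))\<bar>"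
  define E where "E = (\<lambda>R. 5 * circle_mass R + 4 * pi * (A + mass_neg R * ln (2 * R / d)))"
  define K where "K = 5 * C0 + 4 * pi * (A + C0 * ((2 / d) powr \<eta> / \<eta>))"
  define R1 where "R1 = max (max R0 1) (8 * norm w0)"
  have R1: "R1 \<ge> 1" "R1 \<ge> R0" "R1 \<ge> 8 * norm w0" by (auto simp: R1_def)
  have Knn: "K \<ge> 0" unfolding K_def C0_def A_def using \<eta> by (intro add_nonneg_nonneg mult_nonneg_nonneg) auto
  have pa: "R powr \<beta> \<le> R powr \<alpha>" "1 \<le> R powr \<alpha>" if "R \<ge> 1" for R
    using that \<beta> by (auto intro: powr_mono ge_one_powr_ge_zero)
  have C': "circle_mass R \<le> C0 * R powr \<beta>" if "R \<ge> R1" "sphere_free J R" for R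
    using that R1 by (intro order_trans[OF C(1)] mult_right_mono) (auto simp: C0_def)
  have C'': "mass_neg R \<le> C0 * R powr \<beta>" if "R \<ge> R1" for R
    using that R1 by (intro order_trans[OF C(2)] mult_right_mono) (auto simp: C0_def)
  have E: "E R \<le> K * R powr \<alpha>" if R: "R \<ge> R1" "sphere_free J R" for R
  proof -
    have R': "R \<ge> 1" "R > 0" using R R1 by auto
    have "1 \<le> 2 * R / d" using d R' by (simp add: field_simps)
    then have "ln (2 * R / d) \<le> (2 * R / d) powr \<eta> / \<eta>" by (rule ln_powr_bound) fact
    also have "\<dots> = (2 / d) powr \<eta> / \<eta> * R powr \<eta>"
      using d R' powr_mult[of "2 / d" R \<eta>] by simp
    finally have l: "ln (2 * R / d) \<le> (2 / d) powr \<eta> / \<eta> * R powr \<eta>" .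
    have "mass_neg R * ln (2 * R / d) \<le> (C0 * R powr \<beta>) * ((2 / d) powr \<eta> / \<eta> * R powr \<eta>)"
      using l C''[OF R(1)] mass_nonneg \<open>1 \<le> 2 * R / d\<close> by (intro mult_mono) (auto simp: C0_def)
    also have "\<dots> = C0 * ((2 / d) powr \<eta> / \<eta>) * (R powr \<beta> * R powr \<eta>)" by simp
    also have "R powr \<beta> * R powr \<eta> = R powr \<alpha>" by (simp add: powr_add [symmetric] \<eta>_def)
    finally have 1: "mass_neg R * ln (2 * R / d) \<le> C0 * ((2 / d) powr \<eta> / \<eta>) * R powr \<alpha>" .
    have "circle_mass R \<le> C0 * R powr \<alpha>"
      using C'[OF R] mult_left_mono[OF pa(1)[OF R'(1)], of C0] by (simp add: C0_def)
    moreover have "A \<le> A * R powr \<alpha>" using pa(2)[OF R'(1)] mult_left_mono[of 1 "R powr \<alpha>" A] by (simp add: A_def)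
    then have "A + mass_neg R * ln (2 * R / d) \<le> (A + C0 * ((2 / d) powr \<eta> / \<eta>)) * R powr \<alpha>"
      using 1 by (simp add: algebra_simps)
    then have "4 * pi * (A + mass_neg R * ln (2 * R / d)) \<le> 4 * pi * ((A + C0 * ((2 / d) powr \<eta> / \<eta>)) * R powr \<alpha>)"
      by (intro mult_left_mono) auto
    ultimately have "E R \<le> 5 * (C0 * R powr \<alpha>) + 4 * pi * ((A + C0 * ((2 / d) powr \<eta> / \<eta>)) * R powr \<alpha>)"
      unfolding E_def by linarith
    then show ?thesis by (simp add: K_def algebra_simps)
  qed
  have Jen: "mass_pos (R / 4) * ln 2 \<le> E R"
    "\<And>w n. w \<in> ball 0 R \<Longrightarrow> F w \<noteq> 0 \<Longrightarrow>
      norm (log_deriv_defect n R w)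
      \<le> defect_bound n R w (E R) (mass_neg R + mass_pos R)"
    if R: "R \<ge> R1" "sphere_free J R" for R
  proof -
    have pre: "R > 0" "norm w0 \<le> R / 8" "d \<le> 2 * R" using R R1 d by auto
    have free: "F w \<noteq> 0" if "norm w = R" for w
      using R(2) J(2)[of w] that unfolding sphere_free_def by blast
    note est = Jensen_estimate[OF pre(1) free w0 pre(2) d(1) pre(3) d(3), folded A_def]
    show "mass_pos (R / 4) * ln 2 \<le> E R" unfolding E_def by (rule est(1))
    fix w n assume "w \<in> ball 0 R" "F w \<noteq> 0"
    then show "norm (log_deriv_defect n R w)
      \<le> defect_bound n R w (E R) (mass_neg R + mass_pos R)"
      unfolding E_def by (intro est(2))
  qed
  have pos: "mass_pos r \<le> K / ln 2 * 8 powr \<alpha> * r powr \<alpha>" if r: "r \<ge> R1" for r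
  proof -
    \<comment> \<open>R > 4 r brings the zeros of modulus below r into the disc of radius R/4, and R
      < 8 r produces the factor 8^\<alpha>.\<close>
    have "4 * r < 8 * r" using r R1 by simp
    then obtain R where R: "4 * r < R" "R < 8 * r" "sphere_free J R" using sphere_free_exists J(1) by metis
    have RR: "R \<ge> R1" using R r R1 by linarith
    have "mass_pos r * ln 2 \<le> mass_pos (R / 4) * ln 2" using R by (intro mult_right_mono mass_mono) auto
    also have "\<dots> \<le> K * R powr \<alpha>" using Jen(1)[OF RR R(3)] E[OF RR R(3)] by linarith
    also have "\<dots> \<le> K * (8 * r) powr \<alpha>" using R RR R1 \<beta> Knn by (intro mult_left_mono powr_mono2) auto
    also have "\<dots> = K * (8 powr \<alpha> * r powr \<alpha>)" using r R1 by (simp add: powr_mult)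
    finally show ?thesis by (simp add: field_simps)
  qed
  define C2 where "C2 = K + C0 + K / ln 2 * 8 powr \<alpha> + 1"
  have C2: "K \<le> C2" "C0 + K / ln 2 * 8 powr \<alpha> \<le> C2" "C2 > 0"
    using Knn by (auto simp: C2_def C0_def intro!: add_nonneg_pos add_nonneg_nonneg divide_nonneg_nonneg mult_nonneg_nonneg)
  have mass: "mass_neg R + mass_pos R \<le> C2 * R powr \<alpha>" if "R \<ge> R1" for R
  proof -
    have "mass_neg R \<le> C0 * R powr \<alpha>"
      using C''[OF that] mult_left_mono[OF pa(1), of R C0] that R1 by (simp add: C0_def)
    with pos[OF that] have "mass_neg R + mass_pos R \<le> (C0 + K / ln 2 * 8 powr \<alpha>) * R powr \<alpha>"
      by (simp add: algebra_simps)
    also have "\<dots> \<le> C2 * R powr \<alpha>" using C2 by (intro mult_right_mono) auto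
    finally show ?thesis .
  qed
  show ?thesis
  proof (rule that[OF C2(3) R1(1) mass])
    fix R w n assume R: "R \<ge> R1" "sphere_free J R" and w: "w \<in> ball 0 R" "F w \<noteq> 0"
    have Rw: "R - norm w > 0" "R > 0" using w R R1 by auto
    note Jen(2)[OF R w, of n]
    also have "defect_bound n R w (E R) (mass_neg R + mass_pos R)
      \<le> defect_bound n R w (C2 * R powr \<alpha>) (C2 * R powr \<alpha>)"
    proof (intro add_mono mult_left_mono divide_right_mono mass R)
      show "E R \<le> C2 * R powr \<alpha>"
        using E[OF R] mult_right_mono[OF C2(1), of "R powr \<alpha>"] by simp
    qed (use Rw in auto)
    finally show "norm (log_deriv_defect n R w)
      \<le> defect_bound n R w (C2 * R powr \<alpha>) (C2 * R powr \<alpha>)" .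
  qed
qed

text \<open>For \<kappa> < \<alpha> < n + 1 both terms of \<open>defect_bound\<close> are of order
  R^(\<alpha> - n - 1): the first is R R^\<alpha> / R^(n + 2), the second R^\<alpha> / R^(n + 1). So
  the defect tends to 0 and no entire part survives.\<close>

lemma log_deriv_limit:
  assumes n: "real n + 1 > \<kappa>" and w: "F w \<noteq> 0"
    and R: "\<And>j. sphere_free J (R j)" "filterlim R at_top sequentially"
  shows "(\<lambda>j. \<Sum>\<rho>\<in>ball 0 (R j) \<inter> {w. F w = 0}. of_int (zorder F \<rho>) / (w - \<rho>) ^ Suc n) \<longlonglongrightarrow>
           (-1) ^ n / fact n * (deriv ^^ n) (\<lambda>u. deriv F u / F u) w"
proof -
  define \<alpha> where "\<alpha> = (\<kappa> + (real n + 1)) / 2"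
  have \<alpha>: "\<alpha> > \<kappa>" "\<alpha> < real n + 1" using n by (auto simp: \<alpha>_def)
  obtain C R1 where C: "C > 0" "R1 \<ge> 1"
    "\<And>R. R \<ge> R1 \<Longrightarrow> mass_neg R + mass_pos R \<le> C * R powr \<alpha>"
    "\<And>R w n. R \<ge> R1 \<Longrightarrow> sphere_free J R \<Longrightarrow> w \<in> ball 0 R \<Longrightarrow> F w \<noteq> 0 \<Longrightarrow>
      norm (log_deriv_defect n R w)
      \<le> defect_bound n R w (C * R powr \<alpha>) (C * R powr \<alpha>)"
    by (rule growth_estimate[OF \<alpha>(1)]) (rule that)
  define L where "L = (deriv ^^ n) (\<lambda>u. deriv F u / F u) w"
  define T where "T = (\<lambda>R. \<Sum>\<rho>\<in>ball 0 R \<inter> {w. F w = 0}. of_int (zorder F \<rho>) / (w - \<rho>) ^ Suc n)"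
  define err where "err = (\<lambda>R. defect_bound n R w (C * R powr \<alpha>) (C * R powr \<alpha>))"
  define B where "B = fact (Suc n) / pi * 2 ^ (n + 2) * C + fact n * C * 2 ^ (n + 1)"
  \<comment> \<open>R \<ge> 2 |w| gives R - |w| \<ge> R/2, the source of the powers of 2 in
    \<open>B\<close>.\<close>
  have err_le: "err R \<le> B * R powr (\<alpha> - (real n + 1))" if R: "R \<ge> 1" "R \<ge> 2 * norm w" for R
  proof -
    have pw: "1 / (R - norm w) ^ k \<le> 2 ^ k * R powr (- real k)" for k
    proof -
      have "(R / 2) ^ k \<le> (R - norm w) ^ k" using R by (intro power_mono) auto
      then have "1 / (R - norm w) ^ k \<le> 1 / (R / 2) ^ k" using R by (intro divide_left_mono mult_pos_pos zero_less_power) auto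
      also have "\<dots> = 2 ^ k * R powr (- real k)"
      proof -
        have "R > 0" using R by simp
        have "R powr (- real k) = 1 / R ^ k"
          unfolding powr_minus powr_realpow[OF \<open>R > 0\<close>] by (rule inverse_eq_divide)
        then show ?thesis by (simp add: power_divide)
      qed
      finally show ?thesis .
    qed
    have "err R = fact (Suc n) / pi * C * (R * R powr \<alpha> * (1 / (R - norm w) ^ (n + 2))) + fact n * C * (R powr \<alpha> * (1 / (R - norm w) ^ (n + 1)))"
      by (simp add: err_def mult_ac)
    also have "\<dots> \<le> fact (Suc n) / pi * C * (R * R powr \<alpha> * (2 ^ (n + 2) * R powr (- real (n + 2)))) + fact n * C * (R powr \<alpha> * (2 ^ (n + 1) * R powr (- real (n + 1))))"
      using C R by (intro add_mono mult_left_mono pw) auto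
    also have "\<dots> = B * R powr (\<alpha> - (real n + 1))"
    proof -
      have "R * R powr \<alpha> * R powr (- real (n + 2)) = R powr 1 * R powr \<alpha> * R powr (- real (n + 2))" using R by simp
      also have "\<dots> = R powr (\<alpha> - (real n + 1))" by (simp only: powr_add [symmetric]) (simp add: algebra_simps)
      finally have 1: "R * R powr \<alpha> * R powr (- real (n + 2)) = R powr (\<alpha> - (real n + 1))" .
      have 2: "R powr \<alpha> * R powr (- real (n + 1)) = R powr (\<alpha> - (real n + 1))"
        by (simp only: powr_add [symmetric]) (simp add: algebra_simps)
      have "fact (Suc n) / pi * C * (R * R powr \<alpha> * (2 ^ (n + 2) * R powr (- real (n + 2)))) + fact n * C * (R powr \<alpha> * (2 ^ (n + 1) * R powr (- real (n + 1))))
        = fact (Suc n) / pi * C * 2 ^ (n + 2) * (R * R powr \<alpha> * R powr (- real (n + 2))) + fact n * C * 2 ^ (n + 1) * (R powr \<alpha> * R powr (- real (n + 1)))"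
        by (simp only: mult_ac)
      then show ?thesis unfolding 1 2 B_def by (simp add: algebra_simps)
    qed
    finally show ?thesis .
  qed
  have "(\<lambda>j. B * R j powr (\<alpha> - (real n + 1))) \<longlonglongrightarrow> B * 0"
    using \<alpha> by (intro tendsto_intros tendsto_neg_powr R) auto
  then have "(\<lambda>j. B * R j powr (\<alpha> - (real n + 1))) \<longlonglongrightarrow> 0" by simp
  moreover have "\<forall>\<^sub>F j in sequentially. R j \<ge> max R1 (2 * norm w + 1)"
    using R(2) unfolding filterlim_at_top by blast
  then have "\<forall>\<^sub>F j in sequentially. norm (L - (-1) ^ n * fact n * T (R j)) \<le> B * R j powr (\<alpha> - (real n + 1))"
  proof eventually_elim
    case (elim j)
    have "2 * norm w + 1 \<le> R j" using elim by simp
    then have "norm w < R j" using norm_ge_zero[of w] by linarith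
    then have "norm (L - (-1) ^ n * fact n * T (R j)) \<le> err (R j)"
      unfolding L_def T_def err_def using elim by (intro C(4) R w) auto
    also have "\<dots> \<le> B * R j powr (\<alpha> - (real n + 1))" using elim C by (intro err_le) auto
    finally show ?case .
  qed
  ultimately have "(\<lambda>j. L - (-1) ^ n * fact n * T (R j)) \<longlonglongrightarrow> 0"
    by (rule Lim_null_comparison[rotated])
  from tendsto_mult_left[OF tendsto_diff[OF tendsto_const this, of L], of "(-1) ^ n / fact n"]
  have "(\<lambda>j. (-1) ^ n / fact n * (L - (L - (-1) ^ n * fact n * T (R j)))) \<longlonglongrightarrow> (-1) ^ n / fact n * (L - 0)" .
  moreover have "(-1) ^ n / fact n * (L - (L - (-1) ^ n * fact n * T x)) = T x" for x
    by (simp add: power_mult_distrib [symmetric])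
  ultimately show ?thesis by (simp add: L_def T_def)
qed

end

section \<open>From the Nevanlinna characteristic to the growth hypotheses\<close>

lemma log_plus_nonneg [simp]: "log_plus x \<ge> 0"
  by (simp add: log_plus_def)

lemma proximity_nonneg: "proximity f r \<ge> 0"
  unfolding proximity_def set_lebesgue_integral_def
  by (intro mult_nonneg_nonneg integral_nonneg) (auto simp: indicator_def)

locale meromorphic_plane =
  fixes f :: "complex \<Rightarrow> complex"
  assumes merof: "f meromorphic_on UNIV" and nonzerof: "\<exists>w. remove_sings f w \<noteq> 0"
begin

definition F :: "complex \<Rightarrow> complex" where "F = remove_sings f"

sublocale nonzero_meromorphic F
  using merof nonzerof by unfold_locales (auto simp: F_def remove_sings_nicely_meromorphic)

text \<open>Off this set \<open>f\<close> and \<open>F\<close> agree and \<open>F\<close> is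
  analytic and nonzero, so on circles that avoid it the proximity function of \<open>f\<close> can
  be computed from \<open>F\<close>.\<close>

abbreviation (input) exceptional :: "complex set" where
  "exceptional \<equiv> {w. F w = 0} \<union> {w. \<not> f analytic_on {w}}"

lemma iso: "isolated_singularity_at f w"
  using merof meromorphic_on_isolated_singularity meromorphic_on_subset by blast

lemma is_pole_F [simp]: "is_pole F w \<longleftrightarrow> is_pole f w"
  and isolated_zero_F [simp]: "isolated_zero F w \<longleftrightarrow> isolated_zero f w"
  and zorder_F: "zorder F w = zorder f w"
  using iso[of w] by (auto simp: F_def)

lemma zeros_F: "{w. F w = 0} = zeros_of f \<union> poles_of f"
proof -
  have "F w = 0 \<longleftrightarrow> isolated_zero f w \<or> is_pole f w" for w
    using zero_or_pole[OF mero _ _ eventually_nonzero, of w] zero_isolated_zero_nicely_meromorphic[of F w]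
      is_pole_zero_at_nicely_mero[OF mero, of w] nicely_meromorphic_on_subset[OF mero, of "{w}"] by auto
  then show ?thesis by (auto simp: zeros_of_def poles_of_def)
qed

lemma zeros_poles_disjoint: "zeros_of f \<inter> poles_of f = {}"
  by (auto simp: zeros_of_def poles_of_def dest: pole_is_not_zero)

lemma zorder_zeros: "\<rho> \<in> zeros_of f \<Longrightarrow> zorder f \<rho> > 0"
  using zorder_isolated_zero_pos' iso by (auto simp: zeros_of_def)

lemma zorder_poles: "\<rho> \<in> poles_of f \<Longrightarrow> zorder f \<rho> < 0"
  using isolated_pole_imp_neg_zorder iso by (auto simp: poles_of_def)

lemma finite_poles: "bounded A \<Longrightarrow> finite (poles_of f \<inter> A)"
  using finite_zeros[of A] unfolding zeros_F by (rule rev_finite_subset) auto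

lemma pole_count_mono: "r \<le> R \<Longrightarrow> pole_count f r \<le> pole_count f R"
  unfolding pole_count_def by (intro sum_mono2 finite_poles) auto

lemma mass_neg_le: "mass_neg R \<le> real (pole_count f R)"
proof -
  have "mass_neg R = (\<Sum>\<rho>\<in>poles_of f \<inter> ball 0 R. real (ord_at f \<rho>))"
    unfolding mass_neg_def zorder_F
  proof (rule sum.mono_neutral_cong_right)
    show "finite (ball 0 R \<inter> {w. F w = 0})" by (rule finite_zeros) simp
    show "poles_of f \<inter> ball 0 R \<subseteq> ball 0 R \<inter> {w. F w = 0}" unfolding zeros_F by auto
    show "\<forall>i\<in>ball 0 R \<inter> {w. F w = 0} - poles_of f \<inter> ball 0 R. max 0 (- real_of_int (zorder f i)) = 0"
      unfolding zeros_F using zorder_zeros by force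
    show "max 0 (- real_of_int (zorder f \<rho>)) = real (ord_at f \<rho>)" if "\<rho> \<in> poles_of f \<inter> ball 0 R" for \<rho>
      using zorder_poles[of \<rho>] that by (auto simp: ord_at_def)
  qed
  also have "\<dots> \<le> (\<Sum>\<rho>\<in>poles_of f \<inter> cball 0 R. real (ord_at f \<rho>))"
    by (intro sum_mono2 finite_poles) auto
  finally show ?thesis by (simp add: pole_count_def)
qed

text \<open>Integrating only over [r, 2 r], where the count is at least n(r), yields (n(r) - n(0))
  ln 2. The separate term n(0) ln (2 r) restores n(0) ln 2, as r \<ge> 1.\<close>

lemma integrated_pole_count_ge:
  assumes r: "r \<ge> 1"
  shows "real (pole_count f r) * ln 2 \<le> integrated_pole_count f (2 * r)"
proof -
  define g where "g = (\<lambda>t. (real (pole_count f t) - real (pole_count f 0)) / t)"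
  define c where "c = real (pole_count f r) - real (pole_count f 0)"
  have c: "c \<ge> 0" using pole_count_mono[of 0 r] r by (simp add: c_def)
  \<comment> \<open>No pole other than possibly 0 has modulus below \<delta>, so the integrand
    vanishes for 0 < t < \<delta> and the division by t does no harm to integrability.\<close>
  obtain \<delta> where \<delta>: "\<delta> > 0" "\<And>x. x \<noteq> 0 \<Longrightarrow> dist x 0 < \<delta> \<Longrightarrow> F x \<noteq> 0"
    using eventually_nonzero[of 0] unfolding eventually_at by auto
  have small: "pole_count f t = pole_count f 0" if "0 \<le> t" "t < \<delta>" for t
  proof -
    have "poles_of f \<inter> cball 0 t = poles_of f \<inter> cball 0 0"
      using \<delta>(2) that zeros_F by force
    then show ?thesis by (simp add: pole_count_def)
  qed
  have [measurable]: "(\<lambda>t. real (pole_count f t)) \<in> borel_measurable borel"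
    by (rule borel_measurable_mono) (auto intro!: monoI pole_count_mono)
  have gm [measurable]: "g \<in> borel_measurable borel" unfolding g_def by measurable
  have gnn: "g t \<ge> 0" if "t > 0" for t
    using pole_count_mono[of 0 t] that by (simp add: g_def)
  have gle: "g t \<le> real (pole_count f (2 * r)) / \<delta>" if "t > 0" "t \<le> 2 * r" for t
  proof (cases "t < \<delta>")
    case True
    then show ?thesis using small[of t] that \<delta> by (simp add: g_def)
  next
    case False
    then show ?thesis unfolding g_def using pole_count_mono[of t "2 * r"] that \<delta> by (intro frac_le) auto
  qed
  have int: "set_integrable lborel {0<..2*r} g"
  proof (rule set_integrable_bound)
    show "set_integrable lborel {0<..2*r} (\<lambda>_. real (pole_count f (2 * r)) / \<delta>)"
      unfolding set_integrable_def using r by (intro integrable_real_indicator integrable_scaleR_left) (auto simp: emeasure_lborel_Ioc)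
    show "AE x in lborel. x \<in> {0<..2*r} \<longrightarrow> norm (g x) \<le> norm (real (pole_count f (2 * r)) / \<delta>)"
      using gnn gle \<delta> by (intro AE_I2) (auto simp: abs_of_nonneg)
  qed (auto simp: set_borel_measurable_def)
  have FTC: "integrable lborel (\<lambda>t. indicator {r..2*r} t *\<^sub>R (c / t))" "(\<integral>t. indicator {r..2*r} t *\<^sub>R (c / t) \<partial>lborel) = c * ln (2 * r) - c * ln r"
  proof -
    have "continuous_on {r..2*r} (\<lambda>t. c / t)" using r by (intro continuous_intros) auto
    moreover have "((\<lambda>t. c * ln t) has_vector_derivative c / t) (at t within {r..2*r})" if "r \<le> t" "t \<le> 2*r" for t
      using that r by (auto intro!: derivative_eq_intros simp: has_real_derivative_iff_has_vector_derivative [symmetric])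
    ultimately have "has_bochner_integral lborel (\<lambda>t. indicator {r..2*r} t *\<^sub>R (c / t)) (c * ln (2 * r) - c * ln r)"
      using r by (intro has_bochner_integral_FTC_Icc) auto
    then show "integrable lborel (\<lambda>t. indicator {r..2*r} t *\<^sub>R (c / t))" "(\<integral>t. indicator {r..2*r} t *\<^sub>R (c / t) \<partial>lborel) = c * ln (2 * r) - c * ln r"
      by (auto simp: has_bochner_integral_iff)
  qed
  have "c * ln 2 = c * ln (2 * r) - c * ln r" using r by (simp add: ln_mult algebra_simps)
  also have "\<dots> = (\<integral>t. indicator {r..2*r} t *\<^sub>R (c / t) \<partial>lborel)" using FTC by simp
  also have "\<dots> \<le> (LBINT t:{0<..2*r}. g t)"
    unfolding set_lebesgue_integral_def
  proof (rule integral_mono)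
    show "integrable lborel (\<lambda>t. indicator {0<..2*r} t *\<^sub>R g t)" using int by (simp add: set_integrable_def)
    fix t
    show "indicator {r..2*r} t *\<^sub>R (c / t) \<le> indicator {0<..2*r} t *\<^sub>R g t"
    proof (cases "t \<in> {r..2*r}")
      case True
      then have "c / t \<le> g t" unfolding c_def g_def using pole_count_mono[of r t] r by (intro divide_right_mono) auto
      then show ?thesis using True r by simp
    qed (use gnn in \<open>auto simp: indicator_def\<close>)
  qed (rule FTC)
  finally have 1: "c * ln 2 \<le> (LBINT t:{0<..2*r}. g t)" .
  have "real (pole_count f 0) * ln 2 \<le> real (pole_count f 0) * ln (2 * r)"
    using r by (intro mult_left_mono) auto
  with 1 show ?thesis
    unfolding integrated_pole_count_def g_def c_def by (simp add: algebra_simps)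
qed

lemma nevanlinna_bounds:
  assumes "r \<ge> 1"
  shows "proximity f (2 * r) \<le> nevanlinna_char f (2 * r)" "real (pole_count f r) * ln 2 \<le> nevanlinna_char f (2 * r)"
proof -
  have "0 \<le> real (pole_count f r) * ln 2" by simp
  also note integrated_pole_count_ge[OF assms]
  finally show "proximity f (2 * r) \<le> nevanlinna_char f (2 * r)" by (simp add: nevanlinna_char_def)
  show "real (pole_count f r) * ln 2 \<le> nevanlinna_char f (2 * r)"
    using integrated_pole_count_ge[OF assms] proximity_nonneg[of f "2 * r"] by (simp add: nevanlinna_char_def)
qed

lemma circle_mass_eq:
  assumes "sphere_free exceptional r" "r > 0"
  shows "circle_mass r = 2 * pi * proximity f r"
proof -
  have *: "f (of_real r * cis t) = F (of_real r * cis t)" "F (of_real r * cis t) \<noteq> 0" "F analytic_on {of_real r * cis t}" for t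
  proof -
    have "norm (of_real r * cis t) = r" using assms by (simp add: norm_mult)
    then have "F (of_real r * cis t) \<noteq> 0" "f analytic_on {of_real r * cis t}"
      using assms(1) unfolding sphere_free_def by blast+
    then show "f (of_real r * cis t) = F (of_real r * cis t)" "F (of_real r * cis t) \<noteq> 0" "F analytic_on {of_real r * cis t}"
      using analytic by (auto simp: F_def)
  qed
  have "isCont F (of_real r * cis t)" for t
    using *(3) by (rule analytic_at_imp_isCont)
  then have "continuous_on ((\<lambda>t. of_real r * cis t) ` {0..2*pi}) F"
    by (intro continuous_at_imp_continuous_on) auto
  then have contF: "continuous_on {0..2*pi} (\<lambda>t. F (of_real r * cis t))"
    by (rule continuous_on_compose2) (auto intro!: continuous_intros)
  have cont: "continuous_on {0..2*pi} (\<lambda>t. max 0 (ln (norm (F (of_real r * cis t)))))"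
    by (intro continuous_on_max continuous_on_const continuous_on_ln continuous_on_norm contF) (simp add: *(2))
  have "(LBINT t:{0..2*pi}. log_plus (norm (f (of_real r * cis t)))) = (LBINT t:{0..2*pi}. max 0 (ln (norm (F (of_real r * cis t)))))"
    by (simp only: *(1) log_plus_def)
  also have "\<dots> = circle_mass r"
    unfolding circle_mass_def using cont borel_integrable_atLeastAtMost'
    by (intro set_borel_integral_eq_integral(2)) auto
  finally show ?thesis by (simp add: proximity_def)
qed

lemma nevanlinna_growth:
  assumes order: "meromorphic_order f = ereal \<kappa>" and "\<alpha> > \<kappa>"
  shows "\<forall>\<^sub>F r in at_top. nevanlinna_char f r \<le> r powr \<alpha>"
proof -
  have "Limsup at_top (\<lambda>r. ereal (log_plus (nevanlinna_char f r) / ln r)) < ereal \<alpha>"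
    using assms by (simp add: meromorphic_order_def)
  then have "\<forall>\<^sub>F r in at_top. ereal (log_plus (nevanlinna_char f r) / ln r) < ereal \<alpha>"
    by (rule Limsup_lessD)
  moreover have "\<forall>\<^sub>F r in at_top. r > (1::real)" by (rule eventually_gt_at_top)
  ultimately show ?thesis
  proof eventually_elim
    case (elim r)
    show ?case
    proof (cases "nevanlinna_char f r > 0")
      case True
      have "log_plus (nevanlinna_char f r) < \<alpha> * ln r" using elim by (simp add: field_simps)
      then have "ln (nevanlinna_char f r) \<le> \<alpha> * ln r" by (simp add: log_plus_def)
      then have "exp (ln (nevanlinna_char f r)) \<le> exp (\<alpha> * ln r)" by simp
      then show ?thesis using True elim by (simp add: powr_def)
    qed (use elim powr_ge_zero[of r \<alpha>] in linarith)
  qed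
qed

lemma order_nonneg:
  assumes "meromorphic_order f = ereal \<kappa>"
  shows "\<kappa> \<ge> 0"
proof -
  have "\<forall>\<^sub>F r in at_top. r > (1::real)" by (rule eventually_gt_at_top)
  then have "\<forall>\<^sub>F r in at_top. ereal 0 \<le> ereal (log_plus (nevanlinna_char f r) / ln r)"
    by eventually_elim auto
  then have "ereal 0 \<le> Liminf at_top (\<lambda>r. ereal (log_plus (nevanlinna_char f r) / ln r))"
    by (rule Liminf_bounded)
  also have "\<dots> \<le> Limsup at_top (\<lambda>r. ereal (log_plus (nevanlinna_char f r) / ln r))"
    by (rule Liminf_le_Limsup) simp
  finally show ?thesis using assms by (simp add: meromorphic_order_def)
qed

lemma growth_meromorphic_F:
  assumes order: "meromorphic_order f = ereal \<kappa>"
  shows "growth_meromorphic F \<kappa> exceptional"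
proof unfold_locales
  show "\<kappa> \<ge> 0" by (rule order_nonneg[OF order])
  have "{w. \<not> f analytic_on {w}} sparse_in UNIV"
    using meromorphic_on_imp_sparse_singularities[OF merof] .
  from sparse_imp_countable[OF open_UNIV this] show "countable exceptional"
    using countable_zeros by simp
  fix \<alpha> assume "\<alpha> > \<kappa>"
  from nevanlinna_growth[OF order this] obtain R0 where R0: "\<And>r. r \<ge> R0 \<Longrightarrow> nevanlinna_char f r \<le> r powr \<alpha>"
    by (auto simp: eventually_at_top_linorder)
  \<comment> \<open>2 pi comes from the normalization of \<open>proximity\<close>, and 2^\<alpha> /
    ln 2 from bounding the count at R by the characteristic at 2 R. The threshold 2 for R below
    makes \<open>nevanlinna_bounds\<close> applicable at R/2.\<close>
  define C where "C = max (2 * pi) (2 powr \<alpha> / ln 2)"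
  show "\<exists>C R0. \<forall>R\<ge>R0. (sphere_free exceptional R \<longrightarrow> circle_mass R \<le> C * R powr \<alpha>) \<and> mass_neg R \<le> C * R powr \<alpha>"
  proof (rule exI[of _ C], rule exI[of _ "max R0 2"], intro allI impI conjI)
    fix R assume R: "R \<ge> max R0 2"
    show "mass_neg R \<le> C * R powr \<alpha>"
    proof -
      have "real (pole_count f R) * ln 2 \<le> (2 * R) powr \<alpha>"
        using nevanlinna_bounds(2)[of R] R0[of "2 * R"] R by simp
      then have "real (pole_count f R) \<le> 2 powr \<alpha> / ln 2 * R powr \<alpha>" using R by (simp add: powr_mult field_simps)
      also have "\<dots> \<le> C * R powr \<alpha>" by (intro mult_right_mono) (auto simp: C_def)
      finally show ?thesis using mass_neg_le[of R] by linarith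
    qed
    assume free: "sphere_free exceptional R"
    have "circle_mass R = 2 * pi * proximity f R" using R by (intro circle_mass_eq free) auto
    also have "\<dots> \<le> 2 * pi * R powr \<alpha>"
      using nevanlinna_bounds(1)[of "R / 2"] R0[of R] R by (intro mult_left_mono) auto
    also have "\<dots> \<le> C * R powr \<alpha>" by (intro mult_right_mono) (auto simp: C_def)
    finally show "circle_mass R \<le> C * R powr \<alpha>" .
  qed
qed auto

end

section \<open>Continuation of Mellin transforms of rapidly decreasing functions\<close>

text \<open>All derivatives are bounded near 0 and decay faster than every power, so convergence at
  infinity holds for every s, and only the singularity of y^(n - s) at 0 restricts s.\<close>

locale smooth_rapid_decay =
  fixes D :: "nat \<Rightarrow> real \<Rightarrow> complex"
  assumes deriv: "\<And>n y. y > 0 \<Longrightarrow> (D n has_vector_derivative D (Suc n) y) (at y)"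
    and decay: "\<And>n k. \<exists>C. \<forall>y>0. norm (D n y) \<le> C * pow_bound 0 (- real k) y"
begin

text \<open>The Mellin transform of \<open>D n\<close> in the usual normalization, taken at n + 1 -
  s.\<close>

definition Mellin :: "nat \<Rightarrow> complex \<Rightarrow> complex" where
  "Mellin n s = (LBINT y:{0<..}. D n y * of_real y powr (of_nat n - s))"

lemma isCont_D: "y > 0 \<Longrightarrow> isCont (D n) y"
  by (meson deriv has_vector_derivative_continuous)

lemma continuous_integrand: "continuous_on {0<..} (\<lambda>y. D n y * of_real y powr w)"
proof (rule continuous_on_mult)
  show "continuous_on {0<..} (D n)"
    using isCont_D by (intro continuous_at_imp_continuous_on) auto
  show "continuous_on {0<..} (\<lambda>y. complex_of_real y powr w)"
    by (intro continuous_intros) auto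
qed

lemma integrand_bound:
  obtains C where "C \<ge> 0" "\<And>y w. y > 0 \<Longrightarrow> norm (D n y * of_real y powr w) \<le> C * pow_bound (Re w) (Re w - real k) y"
proof -
  obtain C where C: "\<And>y. y > 0 \<Longrightarrow> norm (D n y) \<le> C * pow_bound 0 (- real k) y" using decay by blast
  have "C \<ge> 0" using order_trans[OF norm_ge_zero C[of 1]] by (simp add: pow_bound_def)
  moreover have "norm (D n y * of_real y powr w) \<le> C * pow_bound (Re w) (Re w - real k) y" if "y > 0" for y w
  proof -
    have "norm (D n y * of_real y powr w) = norm (D n y) * y powr Re w"
      using that by (simp add: norm_mult norm_powr_real_powr)
    also have "\<dots> \<le> C * pow_bound 0 (- real k) y * y powr Re w"
      using C[OF that] by (rule mult_right_mono) simp
    also have "\<dots> = C * pow_bound (Re w) (Re w - real k) y"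
      using that by (simp add: pow_bound_def powr_diff powr_minus divide_inverse)
    finally show ?thesis .
  qed
  ultimately show ?thesis by (rule that)
qed

lemma integrable_integrand:
  assumes "Re w > -1"
  shows "set_integrable lborel {0<..} (\<lambda>y. D n y * of_real y powr w)"
proof -
  define k where "k = nat \<lceil>Re w + 2\<rceil>"
  have k: "Re w - real k < -1" unfolding k_def by linarith
  obtain C where "\<And>y w. y > 0 \<Longrightarrow> norm (D n y * of_real y powr w) \<le> C * pow_bound (Re w) (Re w - real k) y"
    using integrand_bound[of n k] by metis
  from set_integrable_pow_boundI[OF continuous_integrand this assms k] show ?thesis by simp
qed

lemma Mellin_holomorphic: "Mellin n holomorphic_on {s. Re s < real n + 1}"
  unfolding Mellin_def[abs_def]
proof (rule holomorphic_on_set_integral_pow_bound)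
  show "open {s. Re s < real n + 1}" by (rule open_halfspace_Re_lt)
  show "(\<lambda>s. D n y * of_real y powr (of_nat n - s)) holomorphic_on {s. Re s < real n + 1}" for y
    by (intro holomorphic_intros)
  fix s0 :: complex assume s0: "s0 \<in> {s. Re s < real n + 1}"
  define r where "r = (real n + 1 - Re s0) / 2"
  have r: "r > 0" "Re s0 + r < real n + 1" using s0 by (auto simp: r_def field_simps)
  have re: "Re s0 - r \<le> Re s \<and> Re s \<le> Re s0 + r" if "s \<in> cball s0 r" for s
    using that abs_Re_le_cmod[of "s0 - s"] by (auto simp: dist_norm)
  define k where "k = nat \<lceil>real n - Re s0 + r + 2\<rceil>"
  have k: "real n - Re s0 + r - real k < -1" unfolding k_def by linarith
  obtain C where C: "C \<ge> 0" "\<And>y w. y > 0 \<Longrightarrow> norm (D n y * of_real y powr w) \<le> C * pow_bound (Re w) (Re w - real k) y"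
    using integrand_bound[of n k] by metis
  show "\<exists>r>0. \<exists>C. \<exists>a>-1. \<exists>b< -1. cball s0 r \<subseteq> {s. Re s < real n + 1} \<and>
     (\<forall>s\<in>cball s0 r. \<forall>y>0. norm (D n y * of_real y powr (of_nat n - s)) \<le> C * pow_bound a b y)"
  proof (intro exI conjI ballI allI impI)
    show "real n - (Re s0 + r) > -1" "real n - Re s0 + r - real k < -1" using r k by auto
    show "cball s0 r \<subseteq> {s. Re s < real n + 1}" using re r by fastforce
    fix s y assume s: "s \<in> cball s0 r" and y: "y > (0::real)"
    have "norm (D n y * of_real y powr (of_nat n - s)) \<le> C * pow_bound (real n - Re s) (real n - Re s - real k) y"
      using C(2)[OF y, of "of_nat n - s"] by simp
    also have "\<dots> \<le> C * pow_bound (real n - (Re s0 + r)) (real n - Re s0 + r - real k) y"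
      using re[OF s] C y by (intro mult_left_mono pow_bound_mono) auto
    finally show "norm (D n y * of_real y powr (of_nat n - s)) \<le> C * pow_bound (real n - (Re s0 + r)) (real n - Re s0 + r - real k) y" .
  qed (use r in auto)
qed (rule continuous_integrand)

lemma integrand_tendsto_0:
  assumes "Re w > 0"
  shows "((\<lambda>y. D n y * of_real y powr w) \<longlongrightarrow> 0) (at_right 0)" "((\<lambda>y. D n y * of_real y powr w) \<longlongrightarrow> 0) at_top"
proof -
  define k where "k = nat \<lceil>Re w + 1\<rceil>"
  have k: "Re w - real k < 0" unfolding k_def by linarith
  obtain C where C: "C \<ge> 0" "\<And>y w. y > 0 \<Longrightarrow> norm (D n y * of_real y powr w) \<le> C * pow_bound (Re w) (Re w - real k) y"
    using integrand_bound[of n k] by metis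
  have "((\<lambda>y::real. y powr Re w) \<longlongrightarrow> 0 powr Re w) (at_right 0)"
    using assms by (intro tendsto_powr' tendsto_ident_at tendsto_const) (auto simp: eventually_at_filter)
  then have "((\<lambda>y::real. y powr Re w) \<longlongrightarrow> 0) (at_right 0)" using assms by simp
  from tendsto_mult[OF tendsto_const[of C] this] have "((\<lambda>y. C * y powr Re w) \<longlongrightarrow> 0) (at_right 0)" by simp
  moreover have "\<forall>\<^sub>F y in at_right 0. norm (D n y * of_real y powr w) \<le> C * y powr Re w"
  proof (rule eventually_mono[OF eventually_at_right_real[of 0 1]])
    fix y :: real assume "y \<in> {0<..<1}"
    then show "norm (D n y * of_real y powr w) \<le> C * y powr Re w" using C(2)[of y w] by (simp add: pow_bound_def)
  qed simp
  ultimately show "((\<lambda>y. D n y * of_real y powr w) \<longlongrightarrow> 0) (at_right 0)" by (rule Lim_null_comparison[rotated])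
  have "((\<lambda>y. y powr (Re w - real k)) \<longlongrightarrow> 0) at_top"
    using tendsto_neg_powr[OF k filterlim_ident] by simp
  from tendsto_mult[OF tendsto_const[of C] this] have "((\<lambda>y. C * y powr (Re w - real k)) \<longlongrightarrow> 0) at_top" by simp
  moreover have "\<forall>\<^sub>F y in at_top. norm (D n y * of_real y powr w) \<le> C * y powr (Re w - real k)"
  proof (rule eventually_mono[OF eventually_ge_at_top[of 1]])
    fix y :: real assume "1 \<le> y"
    then show "norm (D n y * of_real y powr w) \<le> C * y powr (Re w - real k)" using C(2)[of y w] by (simp add: pow_bound_def)
  qed
  ultimately show "((\<lambda>y. D n y * of_real y powr w) \<longlongrightarrow> 0) at_top" by (rule Lim_null_comparison[rotated])
qed

text \<open>Partial integration with w = n + 1 - s. The boundary term vanishes at 0 because Re w >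
  0, and at infinity by the rapid decay.\<close>

lemma Mellin_Suc:
  assumes s: "Re s < real n + 1"
  shows "Mellin (Suc n) s = (s - of_nat (Suc n)) * Mellin n s"
proof -
  define w where "w = of_nat (Suc n) - s"
  have w: "Re w > 0" using s by (simp add: w_def)
  define G where "G = (\<lambda>y. D n y * of_real y powr w)"
  define g where "g = (\<lambda>y. D (Suc n) y * of_real y powr w + w * (D n y * of_real y powr (w - 1)))"
  have int1: "set_integrable lborel {0<..} (\<lambda>y. D (Suc n) y * of_real y powr w)"
    using w by (intro integrable_integrand) auto
  have int2: "set_integrable lborel {0<..} (\<lambda>y. w * (D n y * of_real y powr (w - 1)))"
    using w by (intro set_integrable_mult_right integrable_integrand) auto
  have "(LBINT y=0..\<infinity>. g y) = 0 - 0"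
  proof (rule interval_integral_FTC_integrable)
    show "(G has_vector_derivative g y) (at y)" if "0 < ereal y" for y
    proof -
      have y: "y > 0" using that by simp
      have "((\<lambda>y. of_real y powr w) has_vector_derivative w * of_real y powr (w - 1)) (at y)"
      proof -
        have "((\<lambda>u. u powr w) has_field_derivative w * of_real y powr (w - 1)) (at (of_real y))"
          using y by (auto intro!: derivative_eq_intros)
        then show ?thesis by (rule has_vector_derivative_real_field)
      qed
      from has_vector_derivative_mult[OF deriv[OF y, of n] this] show ?thesis
        unfolding G_def g_def by (rule has_vector_derivative_eq_rhs) (simp add: algebra_simps)
    qed
    show "isCont g y" if "0 < ereal y" for y
    proof -
      have "continuous_on {0<..} g" unfolding g_def
        by (intro continuous_on_add continuous_on_mult_left continuous_integrand)
      then show ?thesis using that by (auto simp: continuous_on_eq_continuous_at)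
    qed
    have "{0<..} = einterval 0 \<infinity>" by (auto simp: einterval_def)
    then show "set_integrable lborel (einterval 0 \<infinity>) g"
      unfolding g_def using set_integral_add(1)[OF int1 int2] by simp
    show "((G \<circ> real_of_ereal) \<longlongrightarrow> 0) (at_right 0)"
      using integrand_tendsto_0(1)[OF w, of n] unfolding G_def zero_ereal_def ereal_tendsto_simps .
    show "((G \<circ> real_of_ereal) \<longlongrightarrow> 0) (at_left \<infinity>)"
      using integrand_tendsto_0(2)[OF w, of n] unfolding G_def ereal_tendsto_simps .
  qed auto
  moreover have "(LBINT y=0..\<infinity>. g y) = (LBINT y:{0<..}. g y)"
    by (simp add: interval_lebesgue_integral_def zero_ereal_def einterval_def greaterThan_def)
  moreover have "(LBINT y:{0<..}. g y) = Mellin (Suc n) s + w * Mellin n s"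
  proof -
    have "w - 1 = of_nat n - s" by (simp add: w_def)
    then show ?thesis
      unfolding g_def set_integral_add(2)[OF int1 int2] by (simp add: Mellin_def w_def)
  qed
  ultimately have "Mellin (Suc n) s = - w * Mellin n s" by (simp add: add_eq_0_iff2)
  then show ?thesis by (simp add: w_def algebra_simps)
qed

text \<open>\<open>rGamma\<close> is entire, whereas \<open>1 / Gamma\<close> would need an argument at the poles of \<open>Gamma\<close>.\<close>

definition Mellin_norm :: "nat \<Rightarrow> complex \<Rightarrow> complex" where
  "Mellin_norm n s = (-1) ^ n * rGamma (of_nat n + 1 - s) * rGamma s * Mellin n s"

text \<open>The factor s - n - 1 from \<open>Mellin_Suc\<close> is minus the factor n + 1 - s in the
  functional equation of \<open>rGamma\<close>; (-1)^n absorbs the sign.\<close>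

lemma Mellin_norm_Suc:
  assumes "Re s < real n + 1"
  shows "Mellin_norm (Suc n) s = Mellin_norm n s"
proof -
  have eq: "rGamma (of_nat n + 1 - s) = (of_nat n + 1 - s) * rGamma (of_nat (Suc n) + 1 - s)"
    using rGamma_plus1[of "of_nat n + 1 - s"] by (simp add: algebra_simps)
  show ?thesis unfolding Mellin_norm_def Mellin_Suc[OF assms] eq by (simp add: algebra_simps)
qed

lemma Mellin_norm_add:
  assumes "Re s < real n + 1"
  shows "Mellin_norm (n + k) s = Mellin_norm n s"
proof (induction k)
  case (Suc k)
  then show ?case using assms Mellin_norm_Suc[of s "n + k"] by simp
qed simp

text \<open>Any n with Re s < n + 1 gives the same value (\<open>Z_eq\<close>); the ceiling is one
  admissible choice. On each half-plane Re s < n + 1 this is therefore a single holomorphic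
  function, and these half-planes exhaust the plane.\<close>

definition Z :: "complex \<Rightarrow> complex" where
  "Z s = Mellin_norm (nat \<lceil>Re s\<rceil>) s"

lemma Z_eq:
  assumes "Re s < real n + 1"
  shows "Z s = Mellin_norm n s"
proof -
  have "Re s < real (nat \<lceil>Re s\<rceil>) + 1" by linarith
  then show ?thesis
    unfolding Z_def using Mellin_norm_add[of s] assms
    by (metis le_add_diff_inverse nat_le_linear)
qed

lemma Z_holomorphic: "Z holomorphic_on UNIV"
proof -
  have "Z analytic_on {s}" for s
  proof -
    define n where "n = nat \<lceil>Re s\<rceil>"
    have s: "s \<in> {s. Re s < real n + 1}" unfolding n_def by simp linarith
    have "Mellin_norm n holomorphic_on {s. Re s < real n + 1}"
      unfolding Mellin_norm_def[abs_def] by (intro holomorphic_intros Mellin_holomorphic)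
    then have "Z holomorphic_on {s. Re s < real n + 1}"
      by (rule holomorphic_transform) (simp add: Z_eq)
    then show ?thesis using s open_halfspace_Re_lt[of "real n + 1"] analytic_at by blast
  qed
  then show ?thesis using analytic_imp_holomorphic analytic_on_analytic_at by blast
qed

text \<open>The case n = 0, where the reflection formula evaluates the two factors
  \<open>rGamma\<close>.\<close>

lemma Z_integral:
  assumes "Re s < 1"
  shows "Z s = sin (of_real pi * s) / of_real pi * (LBINT y:{0<..}. D 0 y * of_real y powr (- s))"
  using Z_eq[of s 0] assms rGamma_reflection_complex[of s]
  by (simp add: Mellin_norm_def Mellin_def mult_ac)

lemma eventually_sin_nonzero: "\<forall>\<^sub>F u in at s. sin (of_real pi * u) \<noteq> (0::complex)"
proof -
  have "(\<lambda>u. sin (of_real pi * u)) analytic_on (UNIV::complex set)" by (intro analytic_intros)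
  then have "(\<lambda>u. sin (of_real pi * u)) nicely_meromorphic_on (UNIV::complex set)"
    by (rule analytic_on_imp_nicely_meromorphic_on)
  then consider "\<forall>u\<in>UNIV. sin (of_real pi * u) = (0::complex)" | "\<forall>\<^sub>\<approx>u\<in>UNIV. sin (of_real pi * u) \<noteq> (0::complex)"
    using nicely_meromorphic_imp_constant_or_avoid by blast
  then show ?thesis
  proof cases
    case 1
    then have "sin (of_real pi * (1/2)) = (0::complex)" by blast
    moreover have "of_real pi * (1/2) = complex_of_real (pi / 2)" by simp
    then have "sin (of_real pi * (1/2)) = complex_of_real (sin (pi / 2))"
      by (simp only: sin_of_real)
    ultimately show ?thesis by simp
  qed (auto intro: eventually_cosparse_imp_eventually_at)
qed

text \<open>
  If \<open>D 0\<close> vanishes at \<open>0\<close>, the integral converges beyond \<open>Re s < 1\<close>. Its value there is reached as a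
  limit from the left.
\<close>

lemma integral_continuation:
  assumes s0: "set_integrable lborel {0<..} (\<lambda>y. D 0 y * of_real y powr (- s0))"
  defines "J \<equiv> \<lambda>s. LBINT y:{0<..}. D 0 y * of_real y powr (- s)"
  shows "\<And>s. Re s < Re s0 \<Longrightarrow> Z s = sin (of_real pi * s) / of_real pi * J s"
    and "(\<lambda>j. J (s0 - of_real (1 / real (Suc j)))) \<longlonglongrightarrow> J s0"
proof -
  \<comment> \<open>For Re s \<le> Re s0 the integrand at \<open>s0\<close> dominates on (0, 1). On
    [1, \<infinity>) the rapid decay does, uniformly as long as Re s is bounded below.\<close>
  let ?B = "\<lambda>C y. norm (D 0 y * of_real y powr (- s0)) + C * pow_bound 0 (-2) y"
  have bound: "\<exists>C. \<forall>y s. y > 0 \<longrightarrow> Re s \<le> Re s0 \<longrightarrow> - Re s \<le> A \<longrightarrow>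
      norm (D 0 y * of_real y powr (- s)) \<le> ?B C y" for A
  proof -
    define k where "k = nat \<lceil>A + 2\<rceil>"
    have k: "A - real k \<le> -2" unfolding k_def by linarith
    obtain C where C: "C \<ge> 0" "\<And>y w. y > 0 \<Longrightarrow> norm (D 0 y * of_real y powr w) \<le> C * pow_bound (Re w) (Re w - real k) y"
      using integrand_bound[of 0 k] by metis
    have "norm (D 0 y * of_real y powr (- s)) \<le> ?B C y"
      if y: "y > 0" and s: "Re s \<le> Re s0" "- Re s \<le> A" for y s
    proof (cases "y < 1")
      case True
      have "norm (D 0 y * of_real y powr (- s)) \<le> norm (D 0 y * of_real y powr (- s0))"
        using True y s by (auto simp: norm_mult norm_powr_real_powr intro!: mult_left_mono powr_mono')
      then show ?thesis using C pow_bound_nonneg[of 0 "-2" y] by (simp add: add_increasing2)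
    next
      case False
      have "norm (D 0 y * of_real y powr (- s)) \<le> C * pow_bound (- Re s) (- Re s - real k) y" using C(2)[OF y, of "- s"] by simp
      also have "\<dots> = C * y powr (- Re s - real k)" using False by (simp add: pow_bound_def)
      also have "\<dots> \<le> C * y powr (-2)" using False C s k by (intro mult_left_mono powr_mono) auto
      finally have "norm (D 0 y * of_real y powr (- s)) \<le> C * pow_bound 0 (-2) y" using False by (simp add: pow_bound_def)
      then show ?thesis by (rule order_trans) simp
    qed
    then show ?thesis by blast
  qed
  have int: "integrable lborel (\<lambda>y. indicator {0<..} y *\<^sub>R ?B C y)" for C
  proof -
    have 1: "set_integrable lborel {0<..} (\<lambda>y. norm (D 0 y * of_real y powr (- s0)))"
      using set_integrable_norm[OF s0] .
    have 2: "set_integrable lborel {0<..} (\<lambda>y. C * pow_bound 0 (-2) y)"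
      by (intro set_integrable_mult_right set_integrable_pow_bound) auto
    show ?thesis using set_integral_add(1)[OF 1 2] by (simp add: set_integrable_def)
  qed
  have meas: "(\<lambda>y. indicator {0<..} y *\<^sub>R (D 0 y * of_real y powr w)) \<in> borel_measurable lborel" for w
    using borel_measurable_continuous_on_indicator[OF _ continuous_integrand[of 0 w]] by simp
  have Jhol: "J holomorphic_on {s. Re s < Re s0}"
    unfolding J_def set_lebesgue_integral_def
  proof (rule holomorphic_on_integral_param)
    show "open {s. Re s < Re s0}" by (rule open_halfspace_Re_lt)
    fix y :: real
    show "(\<lambda>s. indicat_real {0<..} y *\<^sub>R (D 0 y * complex_of_real y powr - s)) holomorphic_on {s. Re s < Re s0}"
      unfolding scaleR_conv_of_real by (intro holomorphic_intros)
  next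
    fix s assume s: "s \<in> {s. Re s < Re s0}"
    define r where "r = (Re s0 - Re s) / 2"
    have r: "r > 0" "Re s + r < Re s0" using s by (auto simp: r_def field_simps)
    have re: "Re s - r \<le> Re u \<and> Re u \<le> Re s + r" if "u \<in> cball s r" for u
      using that abs_Re_le_cmod[of "s - u"] by (auto simp: dist_norm)
    obtain C where C: "\<And>y u. y > 0 \<Longrightarrow> Re u \<le> Re s0 \<Longrightarrow> - Re u \<le> - (Re s - r) \<Longrightarrow>
        norm (D 0 y * of_real y powr (- u)) \<le> ?B C y"
      using bound by blast
    show "\<exists>r>0. \<exists>G. integrable lborel G \<and> cball s r \<subseteq> {s. Re s < Re s0} \<and>
         (\<forall>u\<in>cball s r. \<forall>y\<in>space lborel. norm (indicat_real {0<..} y *\<^sub>R (D 0 y * complex_of_real y powr - u)) \<le> G y)"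
    proof (intro exI conjI ballI)
      show "cball s r \<subseteq> {s. Re s < Re s0}" using re r by fastforce
      show "integrable lborel (\<lambda>y. indicator {0<..} y *\<^sub>R ?B C y)" by (rule int)
      fix u :: complex and y :: real assume u: "u \<in> cball s r"
      show "norm (indicat_real {0<..} y *\<^sub>R (D 0 y * complex_of_real y powr - u)) \<le>
        indicator {0<..} y *\<^sub>R ?B C y"
        using C[of y u] re[OF u] r by (auto simp: indicator_def)
    qed (rule r)
  qed (rule meas)
  show "Z s = sin (of_real pi * s) / of_real pi * J s" if "Re s < Re s0" for s
  \<comment> \<open>On Re s < min 1 (Re s0) the formula is \<open>Z_integral\<close>; as
    \<open>J\<close> is holomorphic on all of Re s < Re s0, the identity theorem extends it.\<close>
  proof (rule analytic_continuation_open[of "{s. Re s < min 1 (Re s0)}" "{s. Re s < Re s0}" Z])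
    show "{s. Re s < min 1 (Re s0)} \<noteq> {}"
      by (auto intro!: exI[of _ "of_real (min 1 (Re s0) - 1)"])
    show "connected {s. Re s < Re s0}" by (intro convex_connected convex_halfspace_Re_lt)
    show "Z holomorphic_on {s. Re s < Re s0}" using Z_holomorphic holomorphic_on_subset by blast
    show "(\<lambda>s. sin (of_real pi * s) / of_real pi * J s) holomorphic_on {s. Re s < Re s0}"
      by (intro holomorphic_intros Jhol) auto
    show "z \<in> {s. Re s < min 1 (Re s0)} \<Longrightarrow> Z z = sin (of_real pi * z) / of_real pi * J z" for z
      unfolding J_def by (intro Z_integral) auto
  qed (use that open_halfspace_Re_lt[of "min 1 (Re s0)"] open_halfspace_Re_lt[of "Re s0"] in auto)
  obtain C where C: "\<And>y u. y > 0 \<Longrightarrow> Re u \<le> Re s0 \<Longrightarrow> - Re u \<le> - Re s0 + 1 \<Longrightarrow>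
        norm (D 0 y * of_real y powr (- u)) \<le> ?B C y"
    using bound[of "- Re s0 + 1"] by blast
  show "(\<lambda>j. J (s0 - of_real (1 / real (Suc j)))) \<longlonglongrightarrow> J s0"
    unfolding J_def set_lebesgue_integral_def
  proof (rule integral_dominated_convergence)
    show "AE y in lborel. (\<lambda>j. indicat_real {0<..} y *\<^sub>R (D 0 y * complex_of_real y powr - (s0 - of_real (1 / real (Suc j))))) \<longlonglongrightarrow> indicat_real {0<..} y *\<^sub>R (D 0 y * complex_of_real y powr - s0)"
    proof (rule AE_I2)
      fix y :: real
      have "(\<lambda>j. complex_of_real (1 / real (Suc j))) \<longlonglongrightarrow> complex_of_real 0"
        by (intro tendsto_of_real) (use LIMSEQ_inverse_real_of_nat in \<open>simp add: inverse_eq_divide\<close>)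
      then have l: "(\<lambda>j. - (s0 - complex_of_real (1 / real (Suc j)))) \<longlonglongrightarrow> - (s0 - of_real 0)"
        by (intro tendsto_minus tendsto_diff tendsto_const)
      have "isCont (\<lambda>w. complex_of_real y powr w) (- s0)" if "y > 0"
        using DERIV_isCont[OF has_field_derivative_powr_right[of "of_real y" "- s0"]] that by simp
      then show "(\<lambda>j. indicat_real {0<..} y *\<^sub>R (D 0 y * complex_of_real y powr - (s0 - of_real (1 / real (Suc j))))) \<longlonglongrightarrow> indicat_real {0<..} y *\<^sub>R (D 0 y * complex_of_real y powr - s0)"
        using l by (cases "y > 0") (auto intro!: tendsto_mult_left isCont_tendsto_compose[of "- s0" "\<lambda>w. complex_of_real y powr w"])
    qed
    show "AE y in lborel. norm (indicat_real {0<..} y *\<^sub>R (D 0 y * complex_of_real y powr - (s0 - of_real (1 / real (Suc j))))) \<le>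
        indicator {0<..} y *\<^sub>R ?B C y" for j
    proof (rule AE_I2)
      fix y :: real
      have "0 \<le> 1 / real (Suc j)" "1 / real (Suc j) \<le> 1" by auto
      then have "Re (s0 - of_real (1 / real (Suc j))) \<le> Re s0" "- Re (s0 - of_real (1 / real (Suc j))) \<le> - Re s0 + 1"
        by (simp_all del: of_nat_Suc of_real_divide)
      from C[OF _ this] show "norm (indicat_real {0<..} y *\<^sub>R (D 0 y * complex_of_real y powr - (s0 - of_real (1 / real (Suc j))))) \<le>
        indicator {0<..} y *\<^sub>R ?B C y"
        by (cases "y > 0") (simp_all del: of_nat_Suc of_real_divide)
    qed
  qed (rule meas int)+
qed

text \<open>\<open>I\<close> is pi Z / sin (pi s) with removable singularities filled in, and the
  product formula extends by continuity to every point that is not a pole. Where the integral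
  converges, perhaps at a zero of the sine, it is the limit of \<open>I\<close> along a sequence
  from the left, which excludes a pole and identifies the value.\<close>

lemma meromorphic_continuation:
  obtains I where "I nicely_meromorphic_on UNIV"
    "\<And>s. set_integrable lborel {0<..} (\<lambda>y. D 0 y * of_real y powr (- s)) \<Longrightarrow>
       I s = (LBINT y:{0<..}. D 0 y * of_real y powr (- s))"
    "\<And>s. \<not> is_pole I s \<Longrightarrow> Z s = sin (of_real pi * s) / of_real pi * I s"
proof -
  define q where "q = (\<lambda>s. Z s * of_real pi / sin (of_real pi * s))"
  have Zan: "Z analytic_on A" for A
    using Z_holomorphic analytic_on_open analytic_on_subset open_UNIV by blast
  have qm: "q meromorphic_on UNIV"
    unfolding q_def by (intro meromorphic_intros analytic_on_imp_meromorphic_on Zan) (intro analytic_intros)+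
  define I where "I = remove_sings q"
  have I: "I nicely_meromorphic_on UNIV" unfolding I_def by (rule remove_sings_nicely_meromorphic[OF qm])
  have Iq: "I s = q s" if "sin (of_real pi * s) \<noteq> 0" for s
    unfolding I_def using that by (intro remove_sings_at_analytic) (auto simp: q_def intro!: analytic_intros Zan)
  have Ilim: "I \<midarrow>s\<rightarrow> I s" if "\<not> is_pole I s" for s
    using I that by (auto simp: nicely_meromorphic_on_def)
  show ?thesis
  proof (rule that[OF I])
    fix s assume np: "\<not> is_pole I s"
    have "(\<lambda>u. sin (of_real pi * u) / of_real pi * I u) \<midarrow>s\<rightarrow> sin (of_real pi * s) / of_real pi * I s"
      by (intro tendsto_intros Ilim np) auto
    moreover have "\<forall>\<^sub>F u in at s. sin (of_real pi * u) / of_real pi * I u = Z u"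
      using eventually_sin_nonzero[of s] by eventually_elim (simp add: Iq q_def)
    ultimately have "Z \<midarrow>s\<rightarrow> sin (of_real pi * s) / of_real pi * I s"
      by (rule Lim_transform_eventually)
    moreover have "Z \<midarrow>s\<rightarrow> Z s" using analytic_at_imp_isCont[OF Zan] by (simp add: isCont_def)
    ultimately show "Z s = sin (of_real pi * s) / of_real pi * I s" by (metis LIM_unique)
  next
    fix s assume s: "set_integrable lborel {0<..} (\<lambda>y. D 0 y * of_real y powr (- s))"
    define J where "J = (\<lambda>s. LBINT y:{0<..}. D 0 y * of_real y powr (- s))"
    define u where "u = (\<lambda>j. s - of_real (1 / real (Suc j)))"
    have ulim: "filterlim u (at s) sequentially"
      unfolding filterlim_at
    proof
      show "\<forall>\<^sub>F x in sequentially. u x \<in> UNIV \<and> u x \<noteq> s" by (simp add: u_def del: of_nat_Suc of_real_divide)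
      have "(\<lambda>j. complex_of_real (1 / real (Suc j))) \<longlonglongrightarrow> complex_of_real 0"
        by (intro tendsto_of_real) (use LIMSEQ_inverse_real_of_nat in \<open>simp add: inverse_eq_divide\<close>)
      from tendsto_diff[OF tendsto_const this, of s] show "u \<longlonglongrightarrow> s" by (simp add: u_def)
    qed
    have "\<forall>\<^sub>F j in sequentially. J (u j) = I (u j)"
      using filterlim_iff[THEN iffD1, OF ulim, rule_format, OF eventually_sin_nonzero]
    proof eventually_elim
      case (elim j)
      have "Re (u j) < Re s" by (simp add: u_def)
      then have "Z (u j) = sin (of_real pi * u j) / of_real pi * J (u j)"
        unfolding J_def by (rule integral_continuation(1)[OF s])
      then show ?case using elim by (simp add: Iq q_def)
    qed
    moreover have "(\<lambda>j. J (u j)) \<longlonglongrightarrow> J s"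
      unfolding J_def u_def by (rule integral_continuation(2)[OF s])
    ultimately have Iu: "(\<lambda>j. I (u j)) \<longlonglongrightarrow> J s" by (rule Lim_transform_eventually[rotated])
    have "\<not> is_pole I s"
    proof
      assume "is_pole I s"
      then have "filterlim (\<lambda>j. I (u j)) at_infinity sequentially"
        unfolding is_pole_def by (rule filterlim_compose[OF _ ulim])
      then show False using Iu not_tendsto_and_filterlim_at_infinity[OF _ Iu] by simp
    qed
    then have "(\<lambda>j. I (u j)) \<longlonglongrightarrow> I s" by (rule filterlim_compose[OF Ilim ulim])
    then show "I s = (LBINT y:{0<..}. D 0 y * of_real y powr (- s))"
      using Iu LIMSEQ_unique unfolding J_def by blast
  qed
qed

end

section \<open>Functions of zeta type\<close>

text \<open>Dyadic shells: with r_k = R 2^k the k-th shell has mass at most C r_(k+1)^\<alpha> and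
  weights at most r_k^(-\<sigma>), so the shell sums are dominated by a geometric series of ratio
  2^(\<alpha> - \<sigma>) < 1.\<close>

lemma summable_on_powr_counting:
  fixes m d :: "'a \<Rightarrow> real"
  assumes fin: "\<And>r. finite {x\<in>A. d x < r}" and m: "\<And>x. x \<in> A \<Longrightarrow> m x \<ge> 0" and R: "R > 0"
    and count: "\<And>r. r \<ge> R \<Longrightarrow> (\<Sum>x\<in>{x\<in>A. d x < r}. m x) \<le> C * r powr \<alpha>"
    and \<sigma>: "\<alpha> < \<sigma>" "0 \<le> \<sigma>"
  shows "(\<lambda>x. m x * d x powr (-\<sigma>)) summable_on A"
proof (rule nonneg_bdd_above_summable_on)
  show nn: "m x * d x powr (-\<sigma>) \<ge> 0" if "x \<in> A" for x using m[OF that] by simp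
  define r where "r = (\<lambda>k::nat. R * 2 ^ k)"
  have r: "r k \<ge> R" "r k > 0" "r k \<le> r (Suc k)" for k
    using R mult_left_mono[of 1 "2 ^ k" R] by (auto simp: r_def)
  define T where "T = (\<lambda>k. \<Sum>x\<in>{x\<in>A. d x < r k}. m x * d x powr (-\<sigma>))"
  define q where "q = 2 powr (\<alpha> - \<sigma>)"
  have q: "0 < q" "q < 1" using \<sigma> by (auto simp: q_def powr_less_one)
  define K where "K = C * 2 powr \<alpha> * R powr (\<alpha> - \<sigma>)"
  have "0 \<le> C * R powr \<alpha>" by (rule order_trans[OF sum_nonneg count[OF order_refl]]) (use m in auto)
  then have "C \<ge> 0" using R by (simp add: zero_le_mult_iff)
  then have K: "K \<ge> 0" by (simp add: K_def)
  have step: "T (Suc k) \<le> T k + K * q ^ k" for k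
  proof -
    define B where "B = {x\<in>A. d x < r (Suc k)} - {x\<in>A. d x < r k}"
    have "T (Suc k) = T k + (\<Sum>x\<in>B. m x * d x powr (-\<sigma>))"
      unfolding T_def B_def using r(3)[of k] by (subst sum.subset_diff[OF _ fin, of "{x\<in>A. d x < r k}"]) auto
    also have "(\<Sum>x\<in>B. m x * d x powr (-\<sigma>)) \<le> (\<Sum>x\<in>B. m x * r k powr (-\<sigma>))"
      using r(2)[of k] \<sigma> m by (intro sum_mono mult_left_mono powr_mono2') (auto simp: B_def)
    also have "\<dots> = (\<Sum>x\<in>B. m x) * r k powr (-\<sigma>)" by (simp add: sum_distrib_right)
    also have "(\<Sum>x\<in>B. m x) \<le> (\<Sum>x\<in>{x\<in>A. d x < r (Suc k)}. m x)"
      using m by (intro sum_mono2 fin) (auto simp: B_def)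
    also have "\<dots> \<le> C * r (Suc k) powr \<alpha>" by (rule count) (rule r)
    also have "C * r (Suc k) powr \<alpha> * r k powr (-\<sigma>) = K * q ^ k"
    proof -
      have "r (Suc k) = 2 * r k" by (simp add: r_def)
      then have "r (Suc k) powr \<alpha> * r k powr (-\<sigma>) = 2 powr \<alpha> * (r k powr \<alpha> * r k powr (-\<sigma>))"
        using r(2)[of k] by (simp add: powr_mult)
      also have "r k powr \<alpha> * r k powr (-\<sigma>) = r k powr (\<alpha> - \<sigma>)" by (simp add: powr_add [symmetric])
      also have "\<dots> = R powr (\<alpha> - \<sigma>) * (2 ^ k) powr (\<alpha> - \<sigma>)" using R by (simp add: r_def powr_mult)
      also have "(2 ^ k) powr (\<alpha> - \<sigma>) = q ^ k"
        unfolding q_def by (simp add: powr_realpow [symmetric] powr_powr mult.commute)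
      finally show ?thesis by (simp add: K_def)
    qed
    finally show ?thesis by (simp add: mult_right_mono)
  qed
  have T: "T k \<le> T 0 + K * (1 / (1 - q))" for k
  proof -
    have "T k \<le> T 0 + K * (\<Sum>i<k. q ^ i)"
    proof (induction k)
      case (Suc k)
      then show ?case using step[of k] by (simp add: algebra_simps)
    qed simp
    also have "(\<Sum>i<k. q ^ i) \<le> 1 / (1 - q)"
      using q by (simp add: sum_gp_strict divide_right_mono)
    finally show ?thesis using K by (simp add: mult_left_mono)
  qed
  show "bdd_above (sum (\<lambda>x. m x * d x powr (-\<sigma>)) ` {F. F \<subseteq> A \<and> finite F})"
  proof (rule bdd_aboveI2)
    fix F assume F: "F \<in> {F. F \<subseteq> A \<and> finite F}"
    obtain k where k: "\<And>x. x \<in> F \<Longrightarrow> d x < r k"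
    proof -
      define M where "M = Max (insert 0 (d ` F))"
      obtain k where k: "M / R < 2 ^ k" using real_arch_pow[of 2 "M / R"] by auto
      have "d x < r k" if "x \<in> F" for x
      proof -
        have "d x \<le> M" unfolding M_def using F that by (intro Max_ge) auto
        also have "M < r k" using k R by (simp add: r_def field_simps)
        finally show ?thesis .
      qed
      then show thesis by (rule that)
    qed
    have "sum (\<lambda>x. m x * d x powr (-\<sigma>)) F \<le> T k"
      unfolding T_def using F k nn by (intro sum_mono2 fin) auto
    with T[of k] show "sum (\<lambda>x. m x * d x powr (-\<sigma>)) F \<le> T 0 + K * (1 / (1 - q))" by linarith
  qed
qed

text \<open>Since q_n \<ge> q_0 > 1, passing from \<sigma> + 1 to w multiplies the modulus of each
  term by at most q_0^(\<sigma> + 1 - Re w). Absolute convergence at \<sigma> + 1 then gives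
  exponential decay.\<close>

lemma zeta_type_half_plane:
  assumes "zeta_type f"
  obtains \<Phi> :: "complex \<Rightarrow> complex" and q0 \<sigma> M :: real
  where "q0 > 1" "\<Phi> holomorphic_on {w. Re w > \<sigma>}" "\<And>w. Re w > \<sigma> \<Longrightarrow> f w = exp (\<Phi> w)"
    "\<And>w. Re w \<ge> \<sigma> + 1 \<Longrightarrow> norm (\<Phi> w) \<le> M * q0 powr (- Re w)"
proof -
  from assms[unfolded zeta_type_def] obtain q :: "nat \<Rightarrow> real" and c :: "nat \<Rightarrow> complex" and \<sigma> :: real where
    q: "1 < q 0" "strict_mono q" and
    H: "\<forall>\<epsilon>>0. (\<forall>z. Re z \<ge> \<sigma> + \<epsilon> \<longrightarrow>
              summable (\<lambda>n. norm (c n / of_real (q n) powr z)) \<and>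
              f z = exp (\<Sum>n. c n / of_real (q n) powr z)) \<and>
           uniformly_convergent_on {z. Re z \<ge> \<sigma> + \<epsilon>}
             (\<lambda>N z. \<Sum>n<N. c n / of_real (q n) powr z)"
    by (elim exE conjE) (rule that)
  have summ: "summable (\<lambda>n. norm (c n / of_real (q n) powr z))" if "\<epsilon> > 0" "Re z \<ge> \<sigma> + \<epsilon>" for \<epsilon> z
    using H that by blast
  have f: "f z = exp (\<Sum>n. c n / of_real (q n) powr z)" if "\<epsilon> > 0" "Re z \<ge> \<sigma> + \<epsilon>" for \<epsilon> z
    using H that by blast
  have unif: "uniformly_convergent_on {z. Re z \<ge> \<sigma> + \<epsilon>} (\<lambda>N z. \<Sum>n<N. c n / of_real (q n) powr z)" if "\<epsilon> > 0" for \<epsilon>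
    using H that by blast
  have qn: "q n \<ge> q 0" "q n > 1" for n
    using q strict_mono_less_eq[OF q(2), of 0 n] by auto
  have qnz: "q n \<noteq> 0" for n using qn(2)[of n] by linarith
  define \<Phi> where "\<Phi> = (\<lambda>z. \<Sum>n. c n / of_real (q n) powr z)"
  define B where "B = (\<Sum>n. norm (c n / of_real (q n) powr of_real (\<sigma> + 1)))"
  show ?thesis
  proof (rule that[of "q 0" \<Phi> \<sigma> "B * q 0 powr (\<sigma> + 1)"])
    show "\<Phi> holomorphic_on {w. Re w > \<sigma>}"
    proof (rule holomorphic_uniform_sequence)
      show "open {w. Re w > \<sigma>}" by (rule open_halfspace_Re_gt)
      show "(\<lambda>z. \<Sum>n<N. c n / of_real (q n) powr z) holomorphic_on {w. Re w > \<sigma>}" for N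
        by (intro holomorphic_intros) (simp add: qnz)
      fix x assume x: "x \<in> {w. Re w > \<sigma>}"
      define d where "d = (Re x - \<sigma>) / 2"
      have d: "d > 0" using x by (simp add: d_def)
      have re: "Re u \<ge> \<sigma> + d" if "u \<in> cball x d" for u
        using that abs_Re_le_cmod[of "x - u"] by (auto simp: dist_norm d_def field_simps)
      have "uniform_limit {z. Re z \<ge> \<sigma> + d} (\<lambda>N z. \<Sum>n<N. c n / of_real (q n) powr z) \<Phi> sequentially"
        using unif[OF d] unfolding uniformly_convergent_uniform_limit_iff \<Phi>_def suminf_eq_lim .
      then have "uniform_limit (cball x d) (\<lambda>N z. \<Sum>n<N. c n / of_real (q n) powr z) \<Phi> sequentially"
        by (rule uniform_limit_on_subset) (use re in auto)
      moreover have "cball x d \<subseteq> {w. Re w > \<sigma>}" using re d by force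
      ultimately show "\<exists>d>0. cball x d \<subseteq> {w. Re w > \<sigma>} \<and> uniform_limit (cball x d) (\<lambda>N z. \<Sum>n<N. c n / of_real (q n) powr z) \<Phi> sequentially"
        using d by blast
    qed
    show "f w = exp (\<Phi> w)" if "Re w > \<sigma>" for w
      unfolding \<Phi>_def using f[of "Re w - \<sigma>" w] that by simp
    fix w assume w: "Re w \<ge> \<sigma> + 1"
    have term_le: "norm (c n / of_real (q n) powr w) \<le> norm (c n / of_real (q n) powr of_real (\<sigma> + 1)) * q 0 powr (\<sigma> + 1 - Re w)" for n
    proof -
      have "norm (c n / of_real (q n) powr w) = norm (c n) * q n powr (- Re w)"
        using qn[of n] by (simp add: norm_divide norm_powr_real_powr powr_minus_divide)
      also have "\<dots> = norm (c n) * (q n powr (- (\<sigma> + 1)) * q n powr (\<sigma> + 1 - Re w))"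
        by (simp add: powr_add [symmetric])
      also have "\<dots> \<le> norm (c n) * (q n powr (- (\<sigma> + 1)) * q 0 powr (\<sigma> + 1 - Re w))"
        using w qn[of n] q by (intro mult_left_mono powr_mono2') auto
      also have "\<dots> = norm (c n / of_real (q n) powr of_real (\<sigma> + 1)) * q 0 powr (\<sigma> + 1 - Re w)"
        unfolding powr_minus_divide using qn[of n] by (simp add: norm_divide norm_powr_real_powr)
      finally show ?thesis .
    qed
    have s1: "summable (\<lambda>n. norm (c n / of_real (q n) powr of_real (\<sigma> + 1)))" by (rule summ[of 1]) auto
    have "norm (\<Phi> w) \<le> (\<Sum>n. norm (c n / of_real (q n) powr of_real (\<sigma> + 1)) * q 0 powr (\<sigma> + 1 - Re w))"
      unfolding \<Phi>_def by (intro norm_suminf_le term_le summable_mult2 s1)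
    also have "\<dots> = B * q 0 powr (\<sigma> + 1 - Re w)"
      unfolding B_def by (rule suminf_mult2 [symmetric]) (rule s1)
    also have "\<dots> = B * q 0 powr (\<sigma> + 1) * q 0 powr (- Re w)" by (simp add: powr_diff powr_minus divide_inverse)
    finally show "norm (\<Phi> w) \<le> B * q 0 powr (\<sigma> + 1) * q 0 powr (- Re w)" .
  qed (use q in auto)
qed

text \<open>Here Re a \<ge> -|a| / 4, so a keeps a fixed angle from the negative axis. In contrast
  to \<open>norm_add_nonneg_ge\<close>, the constant does not depend on a.\<close>

lemma norm_add_far:
  fixes a :: complex
  assumes "Re a \<ge> -A" "norm a \<ge> 4 * A" "y \<ge> 0"
  shows "norm (a + of_real y) \<ge> 1 / 2 * (norm a + y)"
proof -
  have "(norm a + y)\<^sup>2 \<le> (2 * norm (a + of_real y))\<^sup>2"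
  proof -
    have "(norm (a + of_real y))\<^sup>2 = (norm a)\<^sup>2 + 2 * y * Re a + y\<^sup>2"
      unfolding cmod_power2 by (simp add: power2_eq_square algebra_simps)
    moreover have "2 * y * Re a \<ge> 2 * y * (- (norm a / 4))" using assms by (intro mult_left_mono) auto
    ultimately have "4 * (norm (a + of_real y))\<^sup>2 \<ge> 4 * (norm a)\<^sup>2 - 2 * y * norm a + 4 * y\<^sup>2" by simp
    moreover have "4 * (norm a)\<^sup>2 - 2 * y * norm a + 4 * y\<^sup>2 - (norm a + y)\<^sup>2 = 2 * (norm a - y)\<^sup>2 + (norm a)\<^sup>2 + y\<^sup>2"
      by (simp add: power2_eq_square algebra_simps)
    moreover have "2 * (norm a - y)\<^sup>2 + (norm a)\<^sup>2 + y\<^sup>2 \<ge> 0" by simp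
    ultimately have "(norm a + y)\<^sup>2 \<le> 4 * (norm (a + of_real y))\<^sup>2" by linarith
    then show ?thesis by (simp add: power_mult_distrib)
  qed
  then have "norm a + y \<le> 2 * norm (a + of_real y)" by (rule power2_le_imp_le) simp
  then show ?thesis by simp
qed

section \<open>The logarithmic derivative along the ray and the superzeta function\<close>

locale superzeta_setup =
  fixes f :: "complex \<Rightarrow> complex" and \<kappa> :: real and z :: complex
  assumes merof: "f meromorphic_on UNIV" and order: "meromorphic_order f = ereal \<kappa>"
    and zeta: "zeta_type f" and z: "z \<in> superzeta_domain f"

sublocale superzeta_setup \<subseteq> meromorphic_plane f
proof
  show "f meromorphic_on UNIV" by (rule merof)
  obtain \<Phi> q0 \<sigma> M where \<Phi>: "\<Phi> holomorphic_on {w. Re w > \<sigma>}" "\<And>w. Re w > \<sigma> \<Longrightarrow> f w = exp (\<Phi> w)"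
    using zeta_type_half_plane[OF zeta] by metis
  have "f holomorphic_on {w. Re w > \<sigma>}"
    using holomorphic_on_exp' [OF \<Phi>(1)] by (rule holomorphic_transform) (simp add: \<Phi>(2))
  then have "f analytic_on {of_real (\<sigma> + 1)}"
    using open_halfspace_Re_gt[of \<sigma>] by (subst analytic_at) force
  then have "remove_sings f (of_real (\<sigma> + 1)) = exp (\<Phi> (of_real (\<sigma> + 1)))" using \<Phi>(2) by simp
  then show "\<exists>w. remove_sings f w \<noteq> 0" by (metis exp_not_eq_zero)
qed

sublocale superzeta_setup \<subseteq> growth_meromorphic F \<kappa> exceptional
  by (rule growth_meromorphic_F[OF order])


context superzeta_setup
begin

abbreviation L :: "complex \<Rightarrow> complex" where "L u \<equiv> deriv F u / F u"

text \<open>Membership of z in \<open>superzeta_domain f\<close> means that the horizontal ray from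
  z to the right meets no zero or pole.\<close>

lemma F_nonzero_ray: "y \<ge> 0 \<Longrightarrow> F (z + of_real y) \<noteq> 0"
proof
  assume y: "y \<ge> 0" and "F (z + of_real y) = 0"
  then have "z + of_real y \<in> zeros_of f \<union> poles_of f" using zeros_F by blast
  then have "z - (z + of_real y) \<notin> \<real>\<^sub>\<le>\<^sub>0" using z unfolding superzeta_domain_def by blast
  moreover have "z - (z + of_real y) = of_real (- y)" by simp
  ultimately show False using y by (metis nonpos_Reals_of_real_iff neg_le_0_iff_le)
qed

lemma slotted: "F \<rho> = 0 \<Longrightarrow> z - \<rho> \<notin> \<real>\<^sub>\<le>\<^sub>0"
  using z zeros_F unfolding superzeta_domain_def by blast

lemma L_holomorphic: "L holomorphic_on {w. F w \<noteq> 0}"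
proof -
  have Fh: "F holomorphic_on {w. F w \<noteq> 0}"
    by (rule analytic_imp_holomorphic, subst analytic_on_analytic_at) (auto intro: analytic)
  have "open {w. F w \<noteq> 0}" using closed_zeros by (simp add: closed_def Compl_eq)
  then show ?thesis using Fh by (intro holomorphic_on_divide holomorphic_deriv) auto
qed

lemma open_nonzero: "open {w. F w \<noteq> 0}"
  using closed_zeros by (simp add: closed_def Compl_eq)

definition DL :: "nat \<Rightarrow> real \<Rightarrow> complex" where
  "DL n y = (deriv ^^ n) L (z + of_real y)"

lemma DL_deriv:
  assumes "y \<ge> 0"
  shows "(DL n has_vector_derivative DL (Suc n) y) (at y)"
proof -
  have "((deriv ^^ n) L has_field_derivative (deriv ^^ Suc n) L (z + of_real y)) (at (z + of_real y))"
    using F_nonzero_ray[OF assms] by (intro has_field_derivative_higher_deriv[OF L_holomorphic open_nonzero]) simp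
  moreover have "((\<lambda>y. z + of_real y) has_vector_derivative 1) (at y)"
    by (auto intro!: derivative_eq_intros has_vector_derivative_of_real)
  ultimately have "((deriv ^^ n) L \<circ> (\<lambda>y. z + of_real y) has_vector_derivative 1 * (deriv ^^ Suc n) L (z + of_real y)) (at y)"
    by (intro field_vector_diff_chain_at)
  then show ?thesis by (simp add: DL_def[abs_def] o_def)
qed

lemma half_plane:
  obtains \<Phi> q0 \<sigma> M where "q0 > 1" "\<Phi> holomorphic_on {w. Re w > \<sigma>}"
    "\<And>w. Re w > \<sigma> \<Longrightarrow> F w \<noteq> 0" "\<And>w. Re w > \<sigma> \<Longrightarrow> L w = deriv \<Phi> w"
    "\<And>w. Re w \<ge> \<sigma> + 1 \<Longrightarrow> norm (\<Phi> w) \<le> M * q0 powr (- Re w)"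
proof -
  obtain \<Phi> q0 \<sigma> M where q0: "q0 > 1" and \<Phi>: "\<Phi> holomorphic_on {w. Re w > \<sigma>}"
    and f: "\<And>w. Re w > \<sigma> \<Longrightarrow> f w = exp (\<Phi> w)"
    and bound: "\<And>w. Re w \<ge> \<sigma> + 1 \<Longrightarrow> norm (\<Phi> w) \<le> M * q0 powr (- Re w)"
    by (rule zeta_type_half_plane[OF zeta]) (rule that)
  have op: "open {w. Re w > \<sigma>}" by (rule open_halfspace_Re_gt)
  have "f holomorphic_on {w. Re w > \<sigma>}"
    using holomorphic_on_exp' [OF \<Phi>] by (rule holomorphic_transform) (simp add: f)
  then have an: "f analytic_on {w}" if "Re w > \<sigma>" for w
    using op that by (auto simp: analytic_at)
  have F: "F w = exp (\<Phi> w)" if "Re w > \<sigma>" for w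
    using an[OF that] f[OF that] by (simp add: F_def)
  have L: "L w = deriv \<Phi> w" if "Re w > \<sigma>" for w
  proof -
    have "(\<Phi> has_field_derivative deriv \<Phi> w) (at w)" using holomorphic_derivI[OF \<Phi> op] that by auto
    then have "((\<lambda>w. exp (\<Phi> w)) has_field_derivative exp (\<Phi> w) * deriv \<Phi> w) (at w)" by (rule DERIV_fun_exp)
    then have "(F has_field_derivative exp (\<Phi> w) * deriv \<Phi> w) (at w)"
      by (rule has_field_derivative_transform_within_open[OF _ op]) (use that F in auto)
    then show ?thesis using F[OF that] by (simp add: DERIV_imp_deriv)
  qed
  show ?thesis by (rule that[of q0 \<Phi> \<sigma> M]) (use q0 \<Phi> F L bound in auto)
qed

text \<open>Cauchy's inequality on unit discs transfers the exponential decay of \<Phi> to its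
  derivatives, hence to those of \<open>L\<close>. The remaining part of the ray, with y = 0
  included, is compact.\<close>

lemma DL_decay: "\<exists>C. \<forall>y>0. norm (DL n y) \<le> C * pow_bound 0 (- real k) y"
proof -
  obtain \<Phi> q0 \<sigma> M where q0: "q0 > 1" and \<Phi>: "\<Phi> holomorphic_on {w. Re w > \<sigma>}"
    and L: "\<And>w. Re w > \<sigma> \<Longrightarrow> L w = deriv \<Phi> w"
    and bound: "\<And>w. Re w \<ge> \<sigma> + 1 \<Longrightarrow> norm (\<Phi> w) \<le> M * q0 powr (- Re w)"
    by (rule half_plane) (rule that)
  have op: "open {w. Re w > \<sigma>}" by (rule open_halfspace_Re_gt)
  define K where "K = fact (Suc n) * \<bar>M\<bar> * q0 powr (1 - Re z)"
  \<comment> \<open>Re w \<ge> \<sigma> + 2 keeps the closed unit disc about w in the half-plane Re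
    u \<ge> \<sigma> + 1 where \<open>bound\<close> applies.\<close>
  have far: "norm (DL n y) \<le> K * q0 powr (- y)" if y: "Re z + y \<ge> \<sigma> + 2" for y
  proof -
    define w where "w = z + of_real y"
    have w: "Re w \<ge> \<sigma> + 2" using y by (simp add: w_def)
    have "\<forall>\<^sub>F u in nhds w. L u = deriv \<Phi> u"
      using eventually_nhds_in_open[OF op, of w] w by (auto elim!: eventually_mono simp: L)
    then have "DL n y = (deriv ^^ n) (deriv \<Phi>) w"
      unfolding DL_def w_def [symmetric] by (rule higher_deriv_cong_ev) simp
    also have "\<dots> = (deriv ^^ Suc n) \<Phi> w" by (simp add: funpow_Suc_right del: funpow.simps)
    also have "norm \<dots> \<le> fact (Suc n) * (\<bar>M\<bar> * q0 powr (1 - Re w)) / 1 ^ Suc n"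
    proof (rule Cauchy_inequality)
      have re: "Re u \<ge> Re w - 1" if "u \<in> cball w 1" for u
        using that abs_Re_le_cmod[of "w - u"] by (auto simp: dist_norm)
      have sub: "cball w 1 \<subseteq> {w. Re w > \<sigma>}" using re w by force
      show "\<Phi> holomorphic_on ball w 1" by (rule holomorphic_on_subset[OF \<Phi> order_trans[OF ball_subset_cball sub]])
      show "continuous_on (cball w 1) \<Phi>" using sub \<Phi> by (meson holomorphic_on_imp_continuous_on holomorphic_on_subset)
      fix u assume "norm (w - u) = 1"
      then have u: "u \<in> cball w 1" by (simp add: dist_norm)
      have "norm (\<Phi> u) \<le> M * q0 powr (- Re u)" using re[OF u] w by (intro bound) auto
      also have "\<dots> \<le> \<bar>M\<bar> * q0 powr (- Re u)" by (intro mult_right_mono) auto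
      also have "\<dots> \<le> \<bar>M\<bar> * q0 powr (1 - Re w)" using re[OF u] q0 by (intro mult_left_mono powr_mono) auto
      finally show "norm (\<Phi> u) \<le> \<bar>M\<bar> * q0 powr (1 - Re w)" .
    qed simp
    also have "q0 powr (1 - Re w) = q0 powr (1 - Re z) * q0 powr (- y)"
      by (simp add: powr_add [symmetric] w_def diff_diff_eq)
    finally show ?thesis by (simp add: K_def mult.assoc)
  qed
  have K: "K \<ge> 0" by (simp add: K_def)
  define Y where "Y = max 1 (\<sigma> + 2 - Re z)"
  have "continuous_on {0..Y} (DL n)"
    by (intro continuous_at_imp_continuous_on ballI has_vector_derivative_continuous[OF DL_deriv]) simp
  then have "bounded (DL n ` {0..Y})" by (intro compact_imp_bounded compact_continuous_image) auto
  then obtain B where "\<forall>v\<in>DL n ` {0..Y}. norm v \<le> B" unfolding bounded_iff by blast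
  then have B: "norm (DL n y) \<le> B" if "0 \<le> y" "y \<le> Y" for y using that by simp
  have "B \<ge> 0" using order_trans[OF norm_ge_zero B[of 0]] by (simp add: Y_def)
  \<comment> \<open>Since k \<delta> \<le> ln q0, the k-th power of \<delta> y \<le> exp (\<delta>
    y) stays below q0^y. The summand 1 in the denominator covers k = 0.\<close>
  define \<delta> where "\<delta> = ln q0 / (real k + 1)"
  have \<delta>: "\<delta> > 0" using q0 by (simp add: \<delta>_def)
  have expo: "q0 powr (- y) \<le> (1 / \<delta>) ^ k * y powr (- real k)" if y: "y \<ge> 1" for y
  proof -
    have "\<delta> * y \<le> exp (\<delta> * y)" using exp_ge_add_one_self[of "\<delta> * y"] by linarith
    then have "(\<delta> * y) ^ k \<le> exp (\<delta> * y) ^ k"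
      using \<delta> y by (intro power_mono) auto
    also have "\<dots> = exp (real k * (\<delta> * y))" by (simp add: exp_of_nat_mult)
    also have "\<dots> \<le> exp (ln q0 * y)"
    proof -
      have "real k * \<delta> \<le> ln q0" using q0 by (simp add: \<delta>_def field_simps)
      then show ?thesis using y mult_right_mono[of "real k * \<delta>" "ln q0" y] by (simp add: mult.assoc)
    qed
    finally have "(\<delta> * y) ^ k \<le> exp (ln q0 * y)" .
    then have "inverse (exp (ln q0 * y)) \<le> inverse ((\<delta> * y) ^ k)"
      using \<delta> y by (intro le_imp_inverse_le) auto
    moreover have "inverse (exp (ln q0 * y)) = q0 powr (- y)"
      using q0 by (simp add: powr_def exp_minus mult.commute)
    moreover have "inverse ((\<delta> * y) ^ k) = (1 / \<delta>) ^ k * y powr (- real k)"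
    proof -
      have "y > 0" using y by simp
      then have "y powr (- real k) = inverse (y ^ k)" by (simp only: powr_minus powr_realpow)
      then show ?thesis by (simp add: power_mult_distrib power_one_over inverse_eq_divide)
    qed
    ultimately show ?thesis by simp
  qed
  \<comment> \<open>The three summands serve y < 1, 1 \<le> y \<le> Y and y > Y in turn.\<close>
  define C where "C = B + B * Y ^ k + K * (1 / \<delta>) ^ k"
  have Y1: "Y \<ge> 1" by (simp add: Y_def)
  have parts: "B \<ge> 0" "B * Y ^ k \<ge> 0" "K * (1 / \<delta>) ^ k \<ge> 0" using \<open>B \<ge> 0\<close> K \<delta> Y1 by auto
  have "norm (DL n y) \<le> C * pow_bound 0 (- real k) y" if y: "y > 0" for y
  proof -
    consider "y < 1" | "1 \<le> y" "y \<le> Y" | "y > Y" by linarith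
    then show ?thesis
    proof cases
      case 1
      then have "norm (DL n y) \<le> B" using y Y1 by (intro B) auto
      also have "B \<le> C" using parts by (simp add: C_def)
      finally show ?thesis using 1 y by (simp add: pow_bound_def)
    next
      case 2
      have "norm (DL n y) \<le> B" using 2 by (intro B) auto
      also have "B = B * (y powr real k * y powr (- real k))" using y by (simp add: powr_add [symmetric])
      also have "\<dots> \<le> B * (Y ^ k * y powr (- real k))"
        using 2 y parts Y1 by (intro mult_left_mono mult_right_mono) (auto simp: powr_realpow power_mono)
      also have "\<dots> \<le> C * y powr (- real k)"
        using parts by (simp add: C_def mult.assoc [symmetric] mult_right_mono)
      finally show ?thesis using 2 by (simp add: pow_bound_def)
    next
      case 3
      have "norm (DL n y) \<le> K * q0 powr (- y)" using 3 by (intro far) (simp add: Y_def)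
      also have "\<dots> \<le> K * ((1 / \<delta>) ^ k * y powr (- real k))" using 3 Y1 K by (intro mult_left_mono expo) auto
      also have "\<dots> \<le> C * y powr (- real k)"
        using parts by (simp add: C_def mult.assoc [symmetric] mult_right_mono)
      finally show ?thesis using 3 Y1 by (simp add: pow_bound_def)
    qed
  qed
  then show ?thesis by blast
qed

sublocale DL: smooth_rapid_decay DL
  by unfold_locales (use DL_deriv DL_decay in auto)

text \<open>
  The zeros and poles lie in a left half-plane, hence the arguments of \<open>z - \<rho>\<close> stay away from
  \<open>\<plusminus>\<pi>\<close>.
\<close>

lemma ray_distance:
  obtains c where "c > 0" "\<And>\<rho> y. F \<rho> = 0 \<Longrightarrow> y \<ge> 0 \<Longrightarrow> norm (z - \<rho> + of_real y) \<ge> c * (norm (z - \<rho>) + y)"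
proof -
  obtain \<Phi> q0 \<sigma> M where nz: "\<And>w. Re w > \<sigma> \<Longrightarrow> F w \<noteq> 0"
    by (rule half_plane) (rule that)
  \<comment> \<open>All zeros and poles have real part at most \<sigma>, so Re (z - \<rho>) \<ge>
    -A. \<open>norm_add_far\<close> treats the distant ones with the constant 1/2; the finitely many
    in \<open>S0\<close> bring in constants of their own.\<close>
  define A where "A = max 1 (\<sigma> - Re z)"
  define S0 where "S0 = ball z (4 * A) \<inter> {w. F w = 0}"
  have fin: "finite S0" unfolding S0_def by (rule finite_zeros) simp
  define N where "N = insert (1/2) ((\<lambda>\<rho>. norm (1 + sgn (z - \<rho>)) / 2) ` S0)"
  define c where "c = Min N"
  have "finite N" "N \<noteq> {}" using fin by (auto simp: N_def)
  have "c > 0" unfolding c_def using \<open>finite N\<close> \<open>N \<noteq> {}\<close>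
    by (subst Min_gr_iff) (auto simp: N_def S0_def simp del: zero_less_norm_iff intro!: one_plus_sgn_pos slotted)
  moreover have "norm (z - \<rho> + of_real y) \<ge> c * (norm (z - \<rho>) + y)" if \<rho>: "F \<rho> = 0" and y: "y \<ge> 0" for \<rho> y
  proof -
    have "\<exists>c'\<in>N. norm (z - \<rho> + of_real y) \<ge> c' * (norm (z - \<rho>) + y)"
    proof (cases "\<rho> \<in> S0")
      case True
      moreover have "z - \<rho> \<noteq> 0" using slotted[OF \<rho>] by auto
      ultimately show ?thesis using norm_add_nonneg_ge[of "z - \<rho>" y] y by (auto simp: N_def)
    next
      case False
      then have "norm (z - \<rho>) \<ge> 4 * A" using \<rho> by (auto simp: S0_def dist_norm)
      moreover have "Re (z - \<rho>) \<ge> - A" using nz[of \<rho>] \<rho> by (force simp: A_def)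
      ultimately show ?thesis using norm_add_far[of A "z - \<rho>" y] y by (auto simp: N_def)
    qed
    then obtain c' where c': "c' \<in> N" "norm (z - \<rho> + of_real y) \<ge> c' * (norm (z - \<rho>) + y)" by blast
    have "c \<le> c'" unfolding c_def using c' \<open>finite N\<close> by simp
    then have "c * (norm (z - \<rho>) + y) \<le> c' * (norm (z - \<rho>) + y)" using y by (intro mult_right_mono) auto
    with c'(2) show ?thesis by linarith
  qed
  ultimately show ?thesis by (rule that)
qed

lemma summable_distances:
  assumes "\<sigma> > \<kappa>"
  shows "(\<lambda>\<rho>. \<bar>real_of_int (zorder F \<rho>)\<bar> * norm (z - \<rho>) powr (-\<sigma>)) summable_on {w. F w = 0}"
proof -
  define \<alpha> where "\<alpha> = (\<kappa> + \<sigma>) / 2"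
  have \<alpha>: "\<alpha> > \<kappa>" "\<alpha> < \<sigma>" using assms by (auto simp: \<alpha>_def)
  obtain C R1 where C: "C > 0" "R1 \<ge> 1" "\<And>R. R \<ge> R1 \<Longrightarrow> mass_neg R + mass_pos R \<le> C * R powr \<alpha>"
    by (rule growth_estimate[OF \<alpha>(1)]) (rule that)
  show ?thesis
  \<comment> \<open>For r \<ge> |z| the disc of radius r about z lies in the disc of radius 2 r
    about 0, whence the factor 2^\<alpha>.\<close>
  proof (rule summable_on_powr_counting[where R = "max R1 (norm z)" and C = "C * 2 powr \<alpha>" and \<alpha> = \<alpha>])
    have eq: "{x \<in> {w. F w = 0}. norm (z - x) < r} = ball z r \<inter> {w. F w = 0}" for r
      by (auto simp: dist_norm)
    show "finite {x \<in> {w. F w = 0}. norm (z - x) < r}" for r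
      unfolding eq by (rule finite_zeros) simp
    fix r assume r: "r \<ge> max R1 (norm z)"
    have "(\<Sum>x\<in>{x \<in> {w. F w = 0}. norm (z - x) < r}. \<bar>real_of_int (zorder F x)\<bar>) \<le>
      (\<Sum>x\<in>ball 0 (2 * r) \<inter> {w. F w = 0}. \<bar>real_of_int (zorder F x)\<bar>)"
    proof (intro sum_mono2 finite_zeros)
      show "{x \<in> {w. F w = 0}. norm (z - x) < r} \<subseteq> ball 0 (2 * r) \<inter> {w. F w = 0}"
      proof
        fix x assume x: "x \<in> {x \<in> {w. F w = 0}. norm (z - x) < r}"
        have "norm x \<le> norm z + norm (z - x)" using norm_triangle_ineq4[of z "z - x"] by simp
        then show "x \<in> ball 0 (2 * r) \<inter> {w. F w = 0}" using x r by auto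
      qed
    qed auto
    also have "\<dots> = mass_neg (2 * r) + mass_pos (2 * r)"
      unfolding mass_neg_def mass_pos_def sum.distrib [symmetric] by (intro sum.cong) auto
    also have "\<dots> \<le> C * (2 * r) powr \<alpha>" using r C(2) by (intro C(3)) auto
    also have "\<dots> = C * 2 powr \<alpha> * r powr \<alpha>" using r C(2) by (simp add: powr_mult)
    finally show "(\<Sum>x\<in>{x \<in> {w. F w = 0}. norm (z - x) < r}. \<bar>real_of_int (zorder F x)\<bar>) \<le> C * 2 powr \<alpha> * r powr \<alpha>" .
  qed (use \<alpha> \<kappa> C(2) in auto)
qed

end

text \<open>For w \<noteq> 0 the modulus is |w|^(Re s) exp (- Im s arg w), and |arg w| \<le> pi. The
  exponential factor is free of w, so absolute summability over \<rho> becomes a matter of Re s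
  alone.\<close>

lemma norm_powr_le:
  fixes w s :: complex
  shows "norm (w powr s) \<le> norm w powr Re s * exp (pi * \<bar>Im s\<bar>)"
proof (cases "w = 0")
  case False
  have "- (Im s * Im (Ln w)) \<le> \<bar>Im s\<bar> * \<bar>Im (Ln w)\<bar>" by (simp add: abs_mult [symmetric])
  also have "\<dots> \<le> \<bar>Im s\<bar> * pi"
    using False mpi_less_Im_Ln[of w] Im_Ln_le_pi[of w] by (intro mult_left_mono) auto
  finally have "Re s * ln (norm w) - Im s * Im (Ln w) \<le> Re s * ln (norm w) + pi * \<bar>Im s\<bar>"
    by (simp add: mult.commute)
  then have "exp (Re (s * Ln w)) \<le> exp (Re s * ln (norm w) + pi * \<bar>Im s\<bar>)"
    using False by simp
  then show ?thesis using False by (simp add: powr_def exp_add)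
qed simp

context superzeta_setup
begin

lemma norm_summable:
  assumes "Re s > \<kappa>"
  shows "(\<lambda>\<rho>. norm (of_int (zorder F \<rho>) * (z - \<rho>) powr (- s))) summable_on {w. F w = 0}"
proof (rule summable_on_comparison_test)
  show "(\<lambda>\<rho>. exp (pi * \<bar>Im s\<bar>) * (\<bar>real_of_int (zorder F \<rho>)\<bar> * norm (z - \<rho>) powr (- Re s))) summable_on {w. F w = 0}"
    by (intro summable_on_cmult_right summable_distances assms)
  fix \<rho>
  show "norm (of_int (zorder F \<rho>) * (z - \<rho>) powr (- s)) \<le> exp (pi * \<bar>Im s\<bar>) * (\<bar>real_of_int (zorder F \<rho>)\<bar> * norm (z - \<rho>) powr (- Re s))"
    using mult_left_mono[OF norm_powr_le[of "z - \<rho>" "- s"], of "\<bar>real_of_int (zorder F \<rho>)\<bar>"]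
    by (simp add: norm_mult mult_ac)
qed auto

lemma ord_at_zeros: "\<rho> \<in> zeros_of f \<Longrightarrow> of_nat (ord_at f \<rho>) = (of_int (zorder F \<rho>) :: complex)"
  using zorder_zeros[of \<rho>] by (simp add: ord_at_def zorder_F)

lemma ord_at_poles: "\<rho> \<in> poles_of f \<Longrightarrow> of_nat (ord_at f \<rho>) = - (of_int (zorder F \<rho>) :: complex)"
  using zorder_poles[of \<rho>] by (simp add: ord_at_def zorder_F)

lemma norm_summable_zeros_poles:
  assumes "Re s > \<kappa>"
  shows "(\<lambda>\<rho>. norm (of_nat (ord_at f \<rho>) * (z - \<rho>) powr (- s))) summable_on zeros_of f"
    and "(\<lambda>\<rho>. norm (of_nat (ord_at f \<rho>) * (z - \<rho>) powr (- s))) summable_on poles_of f"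
proof -
  have 1: "(\<lambda>\<rho>. norm (of_int (zorder F \<rho>) * (z - \<rho>) powr (- s))) summable_on A"
    if "A \<subseteq> zeros_of f \<union> poles_of f" for A
    using summable_on_subset_banach[OF norm_summable[OF assms]] that by (simp add: zeros_F)
  show "(\<lambda>\<rho>. norm (of_nat (ord_at f \<rho>) * (z - \<rho>) powr (- s))) summable_on zeros_of f"
    using 1[of "zeros_of f"] by (subst summable_on_cong[of _ _ "\<lambda>\<rho>. norm (of_int (zorder F \<rho>) * (z - \<rho>) powr (- s))"]) (auto simp: ord_at_zeros)
  show "(\<lambda>\<rho>. norm (of_nat (ord_at f \<rho>) * (z - \<rho>) powr (- s))) summable_on poles_of f"
    using 1[of "poles_of f"] by (subst summable_on_cong[of _ _ "\<lambda>\<rho>. norm (of_int (zorder F \<rho>) * (z - \<rho>) powr (- s))"]) (auto simp: ord_at_poles norm_mult)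
qed

text \<open>The two series merge into one unordered sum over F w = 0, because
  \<open>zorder F\<close> is negative at the poles and supplies the minus sign.\<close>

lemma superzeta_has_sum:
  assumes "Re s > \<kappa>"
  shows "((\<lambda>\<rho>. of_int (zorder F \<rho>) * (z - \<rho>) powr (- s)) has_sum superzeta f s z) {w. F w = 0}"
proof -
  have Z: "((\<lambda>\<rho>. of_int (zorder F \<rho>) * (z - \<rho>) powr (- s)) has_sum (\<Sum>\<^sub>\<infinity>\<rho>\<in>zeros_of f. of_nat (ord_at f \<rho>) * (z - \<rho>) powr (- s))) (zeros_of f)"
    using has_sum_infsum[OF abs_summable_summable[OF norm_summable_zeros_poles(1)[OF assms]]]
    by (subst has_sum_cong[of _ _ "\<lambda>\<rho>. of_nat (ord_at f \<rho>) * (z - \<rho>) powr (- s)"]) (auto simp: ord_at_zeros)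
  have P: "((\<lambda>\<rho>. of_int (zorder F \<rho>) * (z - \<rho>) powr (- s)) has_sum - (\<Sum>\<^sub>\<infinity>\<rho>\<in>poles_of f. of_nat (ord_at f \<rho>) * (z - \<rho>) powr (- s))) (poles_of f)"
    using has_sum_infsum[OF abs_summable_summable[OF norm_summable_zeros_poles(2)[OF assms]]]
    by (subst has_sum_cong[of _ _ "\<lambda>\<rho>. - (of_nat (ord_at f \<rho>) * (z - \<rho>) powr (- s))"]) (auto simp: ord_at_poles has_sum_uminus)
  show ?thesis
    unfolding zeros_F superzeta_def using has_sum_Un_disjoint[OF Z P zeros_poles_disjoint] by simp
qed

text \<open>The discs eventually contain every finite set of zeros and poles, so the unordered sum
  is also a limit over discs, the kind of limit that \<open>log_deriv_limit\<close>
  provides.\<close>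

lemma has_sum_exhaustion:
  fixes g :: "complex \<Rightarrow> complex"
  assumes "(g has_sum a) {w. F w = 0}" and R: "filterlim R at_top sequentially"
  shows "(\<lambda>j. \<Sum>\<rho>\<in>ball 0 (R j) \<inter> {w. F w = 0}. g \<rho>) \<longlonglongrightarrow> a"
proof -
  have "filterlim (\<lambda>j. ball 0 (R j) \<inter> {w. F w = 0}) (finite_subsets_at_top {w. F w = 0}) sequentially"
    unfolding filterlim_finite_subsets_at_top
  proof (intro allI impI)
    fix X :: "complex set" assume X: "finite X \<and> X \<subseteq> {w. F w = 0}"
    then obtain B where B: "\<And>x. x \<in> X \<Longrightarrow> norm x \<le> B"
      using finite_imp_bounded bounded_iff by metis
    have "\<forall>\<^sub>F j in sequentially. R j \<ge> B + 1" using R unfolding filterlim_at_top by blast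
    then show "\<forall>\<^sub>F j in sequentially. finite (ball 0 (R j) \<inter> {w. F w = 0}) \<and> X \<subseteq> ball 0 (R j) \<inter> {w. F w = 0} \<and> ball 0 (R j) \<inter> {w. F w = 0} \<subseteq> {w. F w = 0}"
    proof eventually_elim
      case (elim j)
      have "X \<subseteq> ball 0 (R j)" using B elim by force
      then show ?case using X finite_zeros[of "ball 0 (R j)"] by auto
    qed
  qed
  with assms(1) show ?thesis unfolding has_sum_def by (rule filterlim_compose)
qed

lemma good_radii:
  obtains R where "\<And>j. sphere_free exceptional (R j)" "filterlim R at_top sequentially"
proof -
  have "\<exists>r. real j < r \<and> sphere_free exceptional r" for j
    using sphere_free_exists[OF _ J(1), of "real j" "real j + 1"] by auto
  then obtain R where R: "\<And>j. real j < R j" "\<And>j. sphere_free exceptional (R j)"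
    by metis
  have "filterlim R at_top sequentially"
    by (rule filterlim_at_top_mono[OF filterlim_real_sequentially]) (use R(1) in \<open>auto intro!: always_eventually less_imp_le\<close>)
  with R(2) show ?thesis by (rule that)
qed

text \<open>Both sides arise, up to n!, as limits of the same finite sums over discs: integrating
  termwise by \<open>Mellin_integral\<close> leads to the series, integrating the limit of
  \<open>log_deriv_limit\<close> to the Mellin transform. Dominated convergence requires a majorant
  that can be summed over all \<rho>.\<close>

lemma superzeta_Mellin:
  assumes s: "Re s > \<kappa>" "Re s < real n + 1"
  shows "superzeta f s z * (Gamma (of_nat n + 1 - s) * Gamma s) = (-1) ^ n * DL.Mellin n s"
proof -
  obtain R where R: "\<And>j. sphere_free exceptional (R j)" "filterlim R at_top sequentially"
    by (rule good_radii) (rule that)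
  obtain c where c: "c > 0" "\<And>\<rho> y. F \<rho> = 0 \<Longrightarrow> y \<ge> 0 \<Longrightarrow> norm (z - \<rho> + of_real y) \<ge> c * (norm (z - \<rho>) + y)"
    by (rule ray_distance) (rule that)
  have s0: "Re s > 0" using s \<kappa> by simp
  define S where "S = (\<lambda>j. ball 0 (R j) \<inter> {w. F w = 0})"
  have finS: "finite (S j)" for j unfolding S_def by (rule finite_zeros) simp
  define t where "t = (\<lambda>\<rho> y. of_int (zorder F \<rho>) * (Mellin_kernel n s (z - \<rho>) y))"
  \<comment> \<open>The exponent Re s + \<eta> is used for y < 1 and Re s - \<eta> for y \<ge> 1.
    Both exceed \<kappa>, so the weights \<open>wt\<close> are summable, and both are below n + 1.
    The powers \<eta> - 1 and -\<eta> - 1 of y are integrable at 0 and at infinity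
    respectively.\<close>
  define \<eta> where "\<eta> = min (Re s - \<kappa>) (real n + 1 - Re s) / 2"
  have \<eta>: "\<eta> > 0" "Re s - \<eta> > \<kappa>" "Re s + \<eta> < real n + 1" using s by (auto simp: \<eta>_def min_def field_simps)
  have dist_pos: "norm (z - \<rho>) > 0" if "F \<rho> = 0" for \<rho> using slotted[OF that] by auto
  define wt where "wt = (\<lambda>\<rho>. \<bar>real_of_int (zorder F \<rho>)\<bar> * (norm (z - \<rho>) powr (- (Re s + \<eta>)) + norm (z - \<rho>) powr (- (Re s - \<eta>))))"
  have wts: "wt summable_on {w. F w = 0}"
    unfolding wt_def distrib_left using \<eta> by (intro summable_on_add summable_distances) auto
  have wtnn: "wt \<rho> \<ge> 0" for \<rho> by (simp add: wt_def)
  define W where "W = (\<Sum>\<^sub>\<infinity>\<rho>\<in>{w. F w = 0}. wt \<rho>)"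
  define dom where "dom = (\<lambda>y. W / c ^ (n + 1) * pow_bound (\<eta> - 1) (- \<eta> - 1) y)"
  have t_le: "norm (t \<rho> y) \<le> wt \<rho> / c ^ (n + 1) * pow_bound (\<eta> - 1) (- \<eta> - 1) y" if \<rho>: "F \<rho> = 0" and y: "y > 0" for \<rho> y
  proof -
    have "norm (Mellin_kernel n s (z - \<rho>) y) \<le>
      (norm (z - \<rho>) powr (- (Re s + \<eta>)) + norm (z - \<rho>) powr (- (Re s - \<eta>))) / c ^ (n + 1) * pow_bound (Re s + \<eta> - 1 - Re s) (Re s - \<eta> - 1 - Re s) y"
      using c dist_pos[OF \<rho>] \<rho> y \<eta> \<kappa> by (intro Mellin_integrand_bound) auto
    from mult_left_mono[OF this, of "\<bar>real_of_int (zorder F \<rho>)\<bar>"]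
    have "norm (t \<rho> y) \<le> \<bar>real_of_int (zorder F \<rho>)\<bar> * ((norm (z - \<rho>) powr (- (Re s + \<eta>)) + norm (z - \<rho>) powr (- (Re s - \<eta>))) / c ^ (n + 1) * pow_bound (Re s + \<eta> - 1 - Re s) (Re s - \<eta> - 1 - Re s) y)"
      unfolding t_def norm_mult norm_of_int by simp
    also have "\<dots> = wt \<rho> / c ^ (n + 1) * pow_bound (\<eta> - 1) (- \<eta> - 1) y"
      by (simp add: wt_def)
    finally show ?thesis .
  qed
  have sum_le: "norm (\<Sum>\<rho>\<in>S j. t \<rho> y) \<le> dom y" if y: "y > 0" for j y
  proof -
    have "norm (\<Sum>\<rho>\<in>S j. t \<rho> y) \<le> (\<Sum>\<rho>\<in>S j. wt \<rho> / c ^ (n + 1) * pow_bound (\<eta> - 1) (- \<eta> - 1) y)"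
      using y by (intro sum_norm_le t_le) (auto simp: S_def)
    also have "\<dots> = (\<Sum>\<rho>\<in>S j. wt \<rho>) / c ^ (n + 1) * pow_bound (\<eta> - 1) (- \<eta> - 1) y"
      by (simp add: sum_distrib_right sum_divide_distrib)
    also have "\<dots> \<le> dom y"
      unfolding dom_def W_def using c wts wtnn pow_bound_nonneg
      by (intro mult_right_mono divide_right_mono finite_sum_le_infsum finS) (auto simp: S_def)
    finally show ?thesis .
  qed
  have int_t: "set_integrable lborel {0<..} (t \<rho>)" if "F \<rho> = 0" for \<rho>
    unfolding t_def by (intro set_integrable_mult_right Mellin_integrable_strip slotted that s0 s)
  have val_t: "(LBINT y:{0<..}. t \<rho> y) = of_int (zorder F \<rho>) * (z - \<rho>) powr (- s) * (Gamma (of_nat n + 1 - s) * Gamma s / fact n)" if "F \<rho> = 0" for \<rho>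
    unfolding t_def set_integral_mult_right Mellin_integral[OF slotted[OF that] s0 s(2)] by simp
  have lim: "(\<lambda>j. \<Sum>\<rho>\<in>S j. t \<rho> y) \<longlonglongrightarrow> (-1) ^ n / fact n * (DL n y * of_real y powr (of_nat n - s))" if y: "y > 0" for y
  proof -
    have "(\<lambda>j. \<Sum>\<rho>\<in>S j. of_int (zorder F \<rho>) / (z + of_real y - \<rho>) ^ Suc n) \<longlonglongrightarrow> (-1) ^ n / fact n * DL n y"
      unfolding S_def DL_def using s F_nonzero_ray[of y] y by (intro log_deriv_limit R) auto
    from tendsto_mult_right[OF this, of "of_real y powr (of_nat n - s)"]
    have "(\<lambda>j. (\<Sum>\<rho>\<in>S j. of_int (zorder F \<rho>) / (z + of_real y - \<rho>) ^ Suc n) * of_real y powr (of_nat n - s)) \<longlonglongrightarrow> (-1) ^ n / fact n * DL n y * of_real y powr (of_nat n - s)" .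
    moreover have "(\<Sum>\<rho>\<in>S j. of_int (zorder F \<rho>) / (z + of_real y - \<rho>) ^ Suc n) * of_real y powr (of_nat n - s) = (\<Sum>\<rho>\<in>S j. t \<rho> y)" for j
      unfolding sum_distrib_right t_def by (intro sum.cong refl) (simp add: add_diff_eq diff_add_eq)
    ultimately show ?thesis by (simp add: mult.assoc)
  qed
  have "(\<lambda>j. LBINT y:{0<..}. (\<Sum>\<rho>\<in>S j. t \<rho> y)) \<longlonglongrightarrow> (LBINT y:{0<..}. (-1) ^ n / fact n * (DL n y * of_real y powr (of_nat n - s)))"
    unfolding set_lebesgue_integral_def
  proof (rule integral_dominated_convergence)
    show "(\<lambda>y. indicat_real {0<..} y *\<^sub>R ((-1) ^ n / fact n * (DL n y * of_real y powr (of_nat n - s)))) \<in> borel_measurable lborel"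
      unfolding measurable_lborel2
      by (intro borel_measurable_continuous_on_indicator continuous_on_mult_left DL.continuous_integrand) simp
    show "(\<lambda>y. indicat_real {0<..} y *\<^sub>R (\<Sum>\<rho>\<in>S j. t \<rho> y)) \<in> borel_measurable lborel" for j
      unfolding scaleR_sum_right
      using int_t by (intro borel_measurable_sum) (auto simp: S_def set_integrable_def intro: borel_measurable_integrable)
    show "integrable lborel (\<lambda>y. indicator {0<..} y *\<^sub>R dom y)"
      using set_integrable_mult_right[OF set_integrable_pow_bound[of "\<eta> - 1" "- \<eta> - 1"], of "W / c ^ (n + 1)"] \<eta>
      by (simp add: set_integrable_def dom_def)
    show "AE y in lborel. (\<lambda>j. indicat_real {0<..} y *\<^sub>R (\<Sum>\<rho>\<in>S j. t \<rho> y)) \<longlonglongrightarrow> indicat_real {0<..} y *\<^sub>R ((-1) ^ n / fact n * (DL n y * of_real y powr (of_nat n - s)))"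
      using lim by (intro AE_I2) (auto simp: indicator_def)
    show "AE y in lborel. norm (indicat_real {0<..} y *\<^sub>R (\<Sum>\<rho>\<in>S j. t \<rho> y)) \<le> indicator {0<..} y *\<^sub>R dom y" for j
      using sum_le by (intro AE_I2) (auto simp: indicator_def)
  qed
  moreover have "(LBINT y:{0<..}. (-1) ^ n / fact n * (DL n y * of_real y powr (of_nat n - s))) = (-1) ^ n / fact n * DL.Mellin n s"
    by (simp add: DL.Mellin_def)
  moreover have "(LBINT y:{0<..}. (\<Sum>\<rho>\<in>S j. t \<rho> y)) = (\<Sum>\<rho>\<in>S j. of_int (zorder F \<rho>) * (z - \<rho>) powr (- s)) * (Gamma (of_nat n + 1 - s) * Gamma s / fact n)" for j
  proof -
    have "(LBINT y:{0<..}. (\<Sum>\<rho>\<in>S j. t \<rho> y)) = (\<Sum>\<rho>\<in>S j. LBINT y:{0<..}. t \<rho> y)"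
      unfolding set_lebesgue_integral_def scaleR_sum_right
      using int_t by (intro Bochner_Integration.integral_sum) (auto simp: S_def set_integrable_def)
    also have "\<dots> = (\<Sum>\<rho>\<in>S j. of_int (zorder F \<rho>) * (z - \<rho>) powr (- s) * (Gamma (of_nat n + 1 - s) * Gamma s / fact n))"
      by (intro sum.cong refl val_t) (auto simp: S_def)
    finally show ?thesis by (simp only: sum_distrib_right)
  qed
  ultimately have 1: "(\<lambda>j. (\<Sum>\<rho>\<in>S j. of_int (zorder F \<rho>) * (z - \<rho>) powr (- s)) * (Gamma (of_nat n + 1 - s) * Gamma s / fact n)) \<longlonglongrightarrow> (-1) ^ n / fact n * DL.Mellin n s"
    by simp
  have 2: "(\<lambda>j. (\<Sum>\<rho>\<in>S j. of_int (zorder F \<rho>) * (z - \<rho>) powr (- s)) * (Gamma (of_nat n + 1 - s) * Gamma s / fact n)) \<longlonglongrightarrow> superzeta f s z * (Gamma (of_nat n + 1 - s) * Gamma s / fact n)"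
    unfolding S_def by (intro tendsto_mult_right has_sum_exhaustion superzeta_has_sum s R)
  from LIMSEQ_unique[OF 2 1] show ?thesis by simp
qed

lemma superzeta_eq_Z:
  assumes s: "Re s > \<kappa>"
  shows "DL.Z s = superzeta f s z"
proof -
  define n where "n = nat \<lceil>Re s\<rceil>"
  have n: "Re s < real n + 1" unfolding n_def by linarith
  \<comment> \<open>As \<kappa> \<ge> 0, both arguments have positive real part and avoid the poles
    of \<open>Gamma\<close>, so the Gamma factors can be cancelled.\<close>
  have "s \<notin> \<int>\<^sub>\<le>\<^sub>0" "of_nat n + 1 - s \<notin> \<int>\<^sub>\<le>\<^sub>0"
    using s \<kappa> n by (auto elim!: nonpos_Ints_cases simp: complex_eq_iff)
  then have g: "Gamma s * rGamma s = 1" "Gamma (of_nat n + 1 - s) * rGamma (of_nat n + 1 - s) = 1"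
    by (simp_all add: Gamma_def rGamma_eq_zero_iff)
  have "DL.Z s = DL.Mellin_norm n s" by (rule DL.Z_eq[OF n])
  also have "\<dots> = rGamma (of_nat n + 1 - s) * rGamma s * ((-1) ^ n * DL.Mellin n s)"
    by (simp add: DL.Mellin_norm_def mult_ac)
  also have "\<dots> = superzeta f s z * (Gamma s * rGamma s) * (Gamma (of_nat n + 1 - s) * rGamma (of_nat n + 1 - s))"
    unfolding superzeta_Mellin[OF s n, symmetric] by (simp only: mult_ac)
  finally show ?thesis using g by simp
qed

lemma integrand_discrete:
  obtains X :: "real set" where "countable X"
    "\<And>y. y \<notin> X \<Longrightarrow> indicat_real {0<..} y *\<^sub>R superzeta_integrand f z s y = indicat_real {0<..} y *\<^sub>R (DL 0 y * of_real y powr (- s))"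
proof (rule that)
  \<comment> \<open>The real offsets of all points where \<open>f\<close> is not analytic, on the
    ray or off it. They are countable, hence a null set; for other y the functions \<open>f\<close>
    and \<open>F\<close> agree near z + y, and so do their logarithmic derivatives.\<close>
  define X where "X = (\<lambda>w. Re (w - z)) ` {w. \<not> f analytic_on {w}}"
  show "countable X" unfolding X_def using J(1) by (intro countable_image) (auto intro: countable_subset)
  show "indicat_real {0<..} y *\<^sub>R superzeta_integrand f z s y = indicat_real {0<..} y *\<^sub>R (DL 0 y * of_real y powr (- s))"
    if "y \<notin> X" for y
  proof -
    have "f analytic_on {z + of_real y}"
    proof (rule ccontr)
      assume "\<not> f analytic_on {z + of_real y}"
      then have "Re (z + of_real y - z) \<in> X" unfolding X_def by blast
      with that show False by simp
    qed
    then show ?thesis by (simp add: superzeta_integrand_def DL_def F_def)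
  qed
qed

lemma integrand_iff:
  "set_integrable lborel {0<..} (superzeta_integrand f z s) \<longleftrightarrow> set_integrable lborel {0<..} (\<lambda>y. DL 0 y * of_real y powr (- s))"
  "(LBINT y:{0<..}. superzeta_integrand f z s y) = (LBINT y:{0<..}. DL 0 y * of_real y powr (- s))"
proof -
  obtain X :: "real set" where X: "countable X"
    "\<And>y. y \<notin> X \<Longrightarrow> indicat_real {0<..} y *\<^sub>R superzeta_integrand f z s y = indicat_real {0<..} y *\<^sub>R (DL 0 y * of_real y powr (- s))"
    by (rule integrand_discrete) (rule that)
  show "set_integrable lborel {0<..} (superzeta_integrand f z s) \<longleftrightarrow> set_integrable lborel {0<..} (\<lambda>y. DL 0 y * of_real y powr (- s))"
    unfolding set_integrable_def by (rule integrable_discrete_difference[OF X(1)]) (use X(2) in auto)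
  show "(LBINT y:{0<..}. superzeta_integrand f z s y) = (LBINT y:{0<..}. DL 0 y * of_real y powr (- s))"
    unfolding set_lebesgue_integral_def by (rule integral_discrete_difference[OF X(1)]) (use X(2) in auto)
qed

end

theorem theorem4p1:
  fixes f :: "complex \<Rightarrow> complex" and \<kappa> :: real and z :: complex
  assumes "f meromorphic_on UNIV"
    and "meromorphic_order f = ereal \<kappa>"
    and "zeta_type f"
    and "z \<in> superzeta_domain f"
  shows "(\<forall>s. Re s > \<kappa> \<longrightarrow>
            (\<lambda>\<rho>. norm (of_nat (ord_at f \<rho>) * (z - \<rho>) powr (- s))) summable_on zeros_of f \<and>
            (\<lambda>\<rho>. norm (of_nat (ord_at f \<rho>) * (z - \<rho>) powr (- s))) summable_on poles_of f) \<and>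
         (\<exists>F I :: complex \<Rightarrow> complex.
            F holomorphic_on UNIV \<and>
            (\<forall>s. Re s > \<kappa> \<longrightarrow> F s = superzeta f s z) \<and>
            I nicely_meromorphic_on UNIV \<and>
            (\<forall>s. Re s < 1 \<longrightarrow> set_integrable lborel {0<..} (superzeta_integrand f z s)) \<and>
            (\<forall>s. set_integrable lborel {0<..} (superzeta_integrand f z s) \<longrightarrow>
                 I s = (LBINT y:{0<..}. superzeta_integrand f z s y)) \<and>
            (\<forall>s. \<not> is_pole I s \<longrightarrow> F s = sin (of_real pi * s) / of_real pi * I s))"
proof -
  interpret superzeta_setup f \<kappa> z by unfold_locales (fact assms)+
  obtain I where I: "I nicely_meromorphic_on UNIV"
    "\<And>s. set_integrable lborel {0<..} (\<lambda>y. DL 0 y * of_real y powr (- s)) \<Longrightarrow>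
       I s = (LBINT y:{0<..}. DL 0 y * of_real y powr (- s))"
    "\<And>s. \<not> is_pole I s \<Longrightarrow> DL.Z s = sin (of_real pi * s) / of_real pi * I s"
    by (rule DL.meromorphic_continuation) (rule that)
  show ?thesis
  proof (rule conjI[OF _ exI[of _ DL.Z, OF exI[of _ I]]]; intro conjI allI impI)
    show "set_integrable lborel {0<..} (superzeta_integrand f z s)" if "Re s < 1" for s
      unfolding integrand_iff using that by (intro DL.integrable_integrand) simp
    show "I s = (LBINT y:{0<..}. superzeta_integrand f z s y)"
      if "set_integrable lborel {0<..} (superzeta_integrand f z s)" for s
      using that unfolding integrand_iff by (rule I(2))
  qed (use norm_summable_zeros_poles DL.Z_holomorphic superzeta_eq_Z I in auto)
qed

end
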